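(* The function $\varrho_1:\mathbb{R}^2\to\mathbb{R}$ reaches its infimum $\mathrm{S}_0$ on $\mathbb{R}^2$, so that $$\mathrm{S}_0=\min_{(\alpha,\xi)\in\mathbb{R}^2}\varrho_1(\alpha,\xi),$$ and this minimum is reached on the set $\big\{(\alpha,\xi)\in\mathbb{R}^2:\ |\xi|\le\frac23|\alpha|^3\big\}$; that is, there is a point $(\alpha,\xi)$ of this set with $\varrho_1(\alpha,\xi)=\mathrm{S}_0$.
   Context: For $(\alpha,\xi)\in\mathbb{R}^2$, let $\mathsf{X}_{\alpha,\xi}=D_t^2+\big(\xi+\alpha^2t-\frac{t^3}{3}\big)^2$, $D_t=-i\partial_t$, be the self-adjoint operator acting on $L^2(\mathbb{R})$ (it has compact resolvent), and let $\varrho_1(\alpha,\xi)=\min\mathrm{Spec}(\mathsf{X}_{\alpha,\xi})$ be its lowest eigenvalue. *)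

theory Defs
  imports "HOL-Analysis.Analysis"
begin

text \<open>
  Elements of the complex Hilbert space \<open>L\<^sup>2(\<real>)\<close> are represented by Borel measurable square-integrable
  functions; equality in \<open>L\<^sup>2(\<real>)\<close> is equality almost everywhere.
\<close>

definition L2 :: "(real \<Rightarrow> complex) set" where
  "L2 = {u. u \<in> borel_measurable lborel \<and> integrable lborel (\<lambda>t. (cmod (u t))\<^sup>2)}"

definition L2_norm :: "(real \<Rightarrow> complex) \<Rightarrow> real" where
  "L2_norm u = sqrt (LINT t|lborel. (cmod (u t))\<^sup>2)"

definition test_functions :: "(real \<Rightarrow> complex) set" where
  "test_functions =
     {\<phi>. (\<forall>n t. ((\<lambda>f s. vector_derivative f (at s)) ^^ n) \<phi> differentiable (at t)) \<and>
         (\<exists>K. \<forall>t. \<bar>t\<bar> > K \<longrightarrow> \<phi> t = 0)}"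

definition D_t :: "(real \<Rightarrow> complex) \<Rightarrow> real \<Rightarrow> complex" where
  "D_t u = (\<lambda>t. - \<i> * vector_derivative u (at t))"

definition X_expr :: "real \<Rightarrow> real \<Rightarrow> (real \<Rightarrow> complex) \<Rightarrow> real \<Rightarrow> complex" where
  "X_expr \<alpha> \<xi> u = (\<lambda>t. D_t (D_t u) t + of_real ((\<xi> + \<alpha>\<^sup>2 * t - t ^ 3 / 3)\<^sup>2) * u t)"

text \<open>
  Unbounded operators in \<open>L\<^sup>2(\<real>)\<close> are given by their graphs. The expression \<open>X_expr \<alpha> \<xi>\<close>, a
  Schroedinger operator with nonnegative smooth potential, is essentially self-adjoint on the
  compactly supported smooth functions. The self-adjoint operator is therefore its closure, whose
  graph is the closure in \<open>L\<^sup>2(\<real>) \<times> L\<^sup>2(\<real>)\<close> of the graph on these functions.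
\<close>

definition X_op :: "real \<Rightarrow> real \<Rightarrow> ((real \<Rightarrow> complex) \<times> (real \<Rightarrow> complex)) set" where
  "X_op \<alpha> \<xi> =
     {(u, f). u \<in> L2 \<and> f \<in> L2 \<and>
        (\<exists>\<phi>. (\<forall>n::nat. \<phi> n \<in> test_functions) \<and>
             (\<lambda>n. L2_norm (\<lambda>t. \<phi> n t - u t)) \<longlonglongrightarrow> 0 \<and>
             (\<lambda>n. L2_norm (\<lambda>t. X_expr \<alpha> \<xi> (\<phi> n) t - f t)) \<longlonglongrightarrow> 0)}"

text \<open>
  The three conditions say that \<open>T - z\<close>, as a map from the domain of \<open>T\<close> to \<open>L\<^sup>2(\<real>)\<close>, is
  surjective, is injective (modulo null functions), and has a bounded inverse.
\<close>

definition resolvent_set ::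
  "((real \<Rightarrow> complex) \<times> (real \<Rightarrow> complex)) set \<Rightarrow> complex set" where
  "resolvent_set T =
     {z. (\<forall>g\<in>L2. \<exists>(u, f)\<in>T. AE t in lborel. f t - z * u t = g t) \<and>
         (\<forall>(u, f)\<in>T. (AE t in lborel. f t - z * u t = 0) \<longrightarrow> (AE t in lborel. u t = 0)) \<and>
         (\<exists>C. \<forall>(u, f)\<in>T. L2_norm u \<le> C * L2_norm (\<lambda>t. f t - z * u t))}"

definition spectrum ::
  "((real \<Rightarrow> complex) \<times> (real \<Rightarrow> complex)) set \<Rightarrow> complex set" where
  "spectrum T = - resolvent_set T"

text \<open>
  The spectrum of a self-adjoint operator is real, so its minimum is the least real number in it.
\<close>

definition rho1 :: "real \<Rightarrow> real \<Rightarrow> real" where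
  "rho1 \<alpha> \<xi> = (LEAST r. complex_of_real r \<in> spectrum (X_op \<alpha> \<xi>))"

definition S0 :: real where
  "S0 = (INF (\<alpha>, \<xi>) \<in> UNIV. rho1 \<alpha> \<xi>)"

end

theory Submission
  imports Defs
begin

text \<open>
  Write \<open>p = \<xi> + \<alpha>\<^sup>2 t - t\<^sup>3/3\<close> and \<open>V = p\<^sup>2\<close>. Three facts about the lowest eigenvalue give the theorem.

  \<^item> It is an infimum of Rayleigh quotients: \<open>rho1 \<alpha> \<xi>\<close> is the infimum of
    \<open>\<integral>|\<phi>'|\<^sup>2 + V |\<phi>|\<^sup>2\<close> over normalized test functions \<open>\<phi>\<close> (\<open>least_spectrum_eq_ground\<close>, for any smooth
    \<open>V \<ge> 0\<close>). It is therefore monotone in \<open>V\<close> (\<open>ground_mono\<close>) and continuous in \<open>(\<alpha>, \<xi>)\<close>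
    (\<open>continuous_ground_pot\<close>).

  \<^item> Outside the set \<open>|\<xi>| \<le> 2/3 |\<alpha>|\<^sup>3\<close> the cubic \<open>p\<close> has a single real root \<open>z\<close>. Keep \<open>z\<close> and increase
    \<open>\<alpha>\<^sup>2\<close> until the remaining quadratic factor, which is positive, acquires a double root. This increases
    \<open>|p|\<close> at no point, and it ends on the boundary of the set (\<open>pot_reduction\<close>). So each value of
    \<open>rho1\<close> is bounded below by a value on the set.

  \<^item> On the set, \<open>rho1\<close> tends to infinity with \<open>|\<alpha>|\<close> (\<open>ground_pot_coercive\<close>): the roots of \<open>p\<close> are real and
    spread over a distance at least \<open>2|\<alpha>|\<close>, so that \<open>V\<close> is huge except on short intervals around them,
    and the uncertainty principle excludes low energies there.

  A continuous function on the compact part \<open>|\<alpha>| \<le> A\<close> of the set attains its minimum, which by the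
  other two facts is the minimum over the plane.

  The variational formula needs essential self-adjointness, since otherwise no real number below the
  infimum \<open>m\<close> of the form would lie in the resolvent set. Density of the range of \<open>X - c\<close> on test functions is shown
  first for very negative \<open>c\<close>, where \<open>V - c \<ge> 1\<close>: the Dirichlet problem on \<open>[-N, N]\<close> has a
  solution bounded in \<open>H\<^sup>1\<close> uniformly in \<open>N\<close>, and cutting it off costs only \<open>O(1/N)\<close>
  (\<open>range_dense_positive\<close>). A Neumann iteration carries density to every \<open>c < m\<close>
  (\<open>range_dense_below_ground\<close>). Surjectivity of the closure then follows from the bound below by \<open>m - c\<close>,
  the completeness of \<open>L\<^sup>2\<close> and the density of test functions. Conversely \<open>m\<close> itself is in the
  spectrum by the Cauchy-Schwarz inequality for the nonnegative form of \<open>X - m\<close> (\<open>ground_in_spectrum\<close>).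
\<close>

section \<open>Smooth functions on the line\<close>


definition smooth :: "(real \<Rightarrow> complex) \<Rightarrow> bool" where
  "smooth f \<longleftrightarrow> (\<forall>n t. ((\<lambda>f s. vector_derivative f (at s)) ^^ n) f differentiable (at t))"

abbreviation vd :: "(real \<Rightarrow> complex) \<Rightarrow> real \<Rightarrow> complex" where
  "vd f \<equiv> (\<lambda>s. vector_derivative f (at s))"

lemma smooth_coinduct:
  assumes "f \<in> S"
    and step: "\<And>g. g \<in> S \<Longrightarrow> \<exists>g'\<in>S. \<forall>t. (g has_vector_derivative g' t) (at t)"
  shows "smooth f"
proof -
  have "((\<lambda>f s. vector_derivative f (at s)) ^^ n) f \<in> S" for n
  proof (induction n)
    case 0
    then show ?case using assms(1) by simp
  next
    case (Suc n)
    obtain g' where g': "g' \<in> S" "\<And>t. (((\<lambda>f s. vector_derivative f (at s)) ^^ n) f has_vector_derivative g' t) (at t)"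
      using step[OF Suc] by blast
    have "vd (((\<lambda>f s. vector_derivative f (at s)) ^^ n) f) = g'"
      using g'(2) by (auto intro: vector_derivative_at)
    then show ?case using g'(1) by simp
  qed
  then show ?thesis
    unfolding smooth_def using step
    by (metis differentiableI_vector)
qed

lemma smooth_has_vd: "smooth f \<Longrightarrow> (f has_vector_derivative vd f t) (at t)"
  unfolding smooth_def vector_derivative_works[symmetric]
  by (metis funpow_0)

lemma smooth_vd: "smooth f \<Longrightarrow> smooth (vd f)"
  unfolding smooth_def
  by (metis (mono_tags, lifting) comp_apply funpow_Suc_right)

lemma smooth_continuous: "smooth f \<Longrightarrow> continuous_on A f"
  by (meson continuous_at_imp_continuous_on has_vector_derivative_continuous smooth_has_vd)

lemma smooth_real_continuous:
  assumes "smooth (\<lambda>t. of_real (V t))" shows "continuous_on UNIV V"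
  using continuous_on_Re[OF smooth_continuous[OF assms], of UNIV] by simp

text \<open>
  Smoothness proofs all follow one pattern: a set of functions is given whose derivatives are
  polynomial expressions in its members. The algebra that the set generates is then closed under
  differentiation, and so consists of smooth functions.
\<close>

inductive_set alg_hull :: "(real \<Rightarrow> complex) set \<Rightarrow> (real \<Rightarrow> complex) set" for G where
  gen: "g \<in> G \<Longrightarrow> g \<in> alg_hull G"
| const: "(\<lambda>t. c) \<in> alg_hull G"
| add: "f \<in> alg_hull G \<Longrightarrow> g \<in> alg_hull G \<Longrightarrow> (\<lambda>t. f t + g t) \<in> alg_hull G"
| mult: "f \<in> alg_hull G \<Longrightarrow> g \<in> alg_hull G \<Longrightarrow> (\<lambda>t. f t * g t) \<in> alg_hull G"

lemma smooth_alg_hull: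
  assumes f: "f \<in> alg_hull G"
    and G: "\<And>g. g \<in> G \<Longrightarrow> \<exists>g'\<in>alg_hull G. \<forall>t. (g has_vector_derivative g' t) (at t)"
  shows "smooth f"
proof (rule smooth_coinduct[OF f])
  fix g assume "g \<in> alg_hull G"
  then show "\<exists>g'\<in>alg_hull G. \<forall>t. (g has_vector_derivative g' t) (at t)"
  proof induction
    case (gen g)
    then show ?case by (rule G)
  next
    case (const c)
    show ?case
      by (rule bexI[of _ "\<lambda>t. 0"]) (auto intro: alg_hull.const)
  next
    case (add f g)
    then obtain f' g' where "f' \<in> alg_hull G" "g' \<in> alg_hull G"
      "\<And>t. (f has_vector_derivative f' t) (at t)" "\<And>t. (g has_vector_derivative g' t) (at t)" by blast
    then show ?case
      by (intro bexI[of _ "\<lambda>t. f' t + g' t"] allI has_vector_derivative_add alg_hull.add) auto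
  next
    case (mult f g)
    then obtain f' g' where "f' \<in> alg_hull G" "g' \<in> alg_hull G"
      "\<And>t. (f has_vector_derivative f' t) (at t)" "\<And>t. (g has_vector_derivative g' t) (at t)" by blast
    then show ?case using mult
      by (intro bexI[of _ "\<lambda>t. f t * g' t + f' t * g t"] allI has_vector_derivative_mult alg_hull.add alg_hull.mult) auto
  qed
qed

lemma smooth_if_in_hull_of_smooth: "f \<in> alg_hull (Collect smooth) \<Longrightarrow> smooth f"
  by (erule smooth_alg_hull) (metis alg_hull.gen mem_Collect_eq smooth_has_vd smooth_vd)

lemma smooth_const: "smooth (\<lambda>t. c)"
  by (rule smooth_if_in_hull_of_smooth) (rule alg_hull.const)

lemma smooth_add: "smooth f \<Longrightarrow> smooth g \<Longrightarrow> smooth (\<lambda>t. f t + g t)"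
  by (rule smooth_if_in_hull_of_smooth) (simp add: alg_hull.add alg_hull.gen)

lemma smooth_mult: "smooth f \<Longrightarrow> smooth g \<Longrightarrow> smooth (\<lambda>t. f t * g t)"
  by (rule smooth_if_in_hull_of_smooth) (simp add: alg_hull.mult alg_hull.gen)

lemma smooth_minus: "smooth f \<Longrightarrow> smooth (\<lambda>t. - f t)"
  using smooth_mult[OF smooth_const[of "-1"], of f] by simp

lemma smooth_diff: "smooth f \<Longrightarrow> smooth g \<Longrightarrow> smooth (\<lambda>t. f t - g t)"
  using smooth_add[OF _ smooth_minus, of f g] by simp

lemma smooth_power: "smooth f \<Longrightarrow> smooth (\<lambda>t. f t ^ n)"
  by (induction n) (auto intro: smooth_const smooth_mult)

lemma smooth_of_real: "smooth (\<lambda>t. of_real t)"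
proof (rule smooth_alg_hull[of _ "{\<lambda>t. of_real t}"])
  fix g :: "real \<Rightarrow> complex" assume "g \<in> {\<lambda>t. of_real t}"
  then show "\<exists>g'\<in>alg_hull {\<lambda>t. of_real t}. \<forall>t. (g has_vector_derivative g' t) (at t)"
    by (intro bexI[of _ "\<lambda>t. 1"])
       (auto intro: alg_hull.const intro!: derivative_eq_intros simp: has_vector_derivative_def of_real_def)
qed (simp add: alg_hull.gen)

lemma affine_comp_has_vd:
  assumes "smooth f"
  shows "((\<lambda>t. f (a + b * t)) has_vector_derivative of_real b * vd f (a + b * t)) (at t)"
proof -
  have "((\<lambda>t. a + b * t) has_vector_derivative b) (at t)"
    by (auto intro!: derivative_eq_intros simp: has_vector_derivative_def)
  from vector_diff_chain_at[OF this smooth_has_vd[OF assms, of "a + b * t"]]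
  show ?thesis by (simp add: o_def scaleR_conv_of_real)
qed

lemma smooth_affine_comp:
  assumes "smooth f" shows "smooth (\<lambda>t. f (a + b * t))"
proof (rule smooth_alg_hull[of _ "{\<lambda>t. f (a + b * t) | f. smooth f}"])
  let ?G = "{\<lambda>t. f (a + b * t) | f. smooth f}"
  fix g assume "g \<in> ?G"
  then obtain f where f: "g = (\<lambda>t. f (a + b * t))" "smooth f" by auto
  show "\<exists>g'\<in>alg_hull ?G. \<forall>t. (g has_vector_derivative g' t) (at t)"
  proof (intro bexI[of _ "\<lambda>t. of_real b * vd f (a + b * t)"] allI)
    show "(\<lambda>t. of_real b * vd f (a + b * t)) \<in> alg_hull ?G"
      by (rule alg_hull.mult[OF alg_hull.const alg_hull.gen]) (use f smooth_vd in auto)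
    show "(g has_vector_derivative of_real b * vd f (a + b * t)) (at t)" for t
      unfolding f(1) by (rule affine_comp_has_vd[OF f(2)])
  qed
qed (use assms in \<open>auto intro: alg_hull.gen\<close>)

lemma vd_affine: "smooth f \<Longrightarrow> vd (\<lambda>t. f (a + b * t)) t = of_real b * vd f (a + b * t)"
  by (rule vector_derivative_at, rule affine_comp_has_vd)

lemma vd_mult:
  assumes "smooth f" "smooth g" shows "vd (\<lambda>t. f t * g t) t = f t * vd g t + vd f t * g t"
  by (rule vector_derivative_at, rule has_vector_derivative_mult)
     (use assms smooth_has_vd in auto)

lemma vd_add:
  assumes "smooth f" "smooth g" shows "vd (\<lambda>t. f t + g t) t = vd f t + vd g t"
  by (rule vector_derivative_at, rule has_vector_derivative_add)
     (use assms smooth_has_vd in auto)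

lemma vd_cmult:
  assumes "smooth f" shows "vd (\<lambda>t. c * f t) t = c * vd f t"
  by (rule vector_derivative_at, rule has_vector_derivative_mult_right)
     (use assms smooth_has_vd in auto)

lemma smooth_inverse:
  assumes "smooth f" "\<And>t. f t \<noteq> 0"
  shows "smooth (\<lambda>t. inverse (f t))"
proof (rule smooth_alg_hull[of _ "insert (\<lambda>t. inverse (f t)) (Collect smooth)"])
  let ?G = "insert (\<lambda>t. inverse (f t)) (Collect smooth)"
  fix g assume g: "g \<in> ?G"
  show "\<exists>g'\<in>alg_hull ?G. \<forall>t. (g has_vector_derivative g' t) (at t)"
  proof (cases "smooth g")
    case True
    then show ?thesis by (metis alg_hull.gen insertI2 mem_Collect_eq smooth_has_vd smooth_vd)
  next
    case False
    then have g: "g = (\<lambda>t. inverse (f t))" using g by auto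
    show ?thesis
    proof (intro bexI allI)
      show "(\<lambda>t. (- 1) * vd f t * (inverse (f t) * inverse (f t))) \<in> alg_hull ?G"
        by (intro alg_hull.mult alg_hull.const alg_hull.gen) (use assms(1) smooth_vd in auto)
      fix t
      have "(inverse has_field_derivative - (inverse (f t) ^ Suc (Suc 0))) (at (f t))"
        by (rule DERIV_inverse) (use assms in auto)
      from field_vector_diff_chain_at[OF smooth_has_vd[OF assms(1)] this]
      show "(g has_vector_derivative (- 1) * vd f t * (inverse (f t) * inverse (f t))) (at t)"
        unfolding g by (simp add: o_def algebra_simps)
    qed
  qed
qed (simp add: alg_hull.gen)

text \<open>
  Regularity of solutions: the derivatives of \<open>u\<close> and \<open>v\<close> lie in the algebra generated by \<open>u\<close>, \<open>v\<close> and
  the smooth functions.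
\<close>

lemma smooth_ode:
  assumes Q: "smooth Q" and g: "smooth g"
    and u: "\<And>t. (u has_vector_derivative v t) (at t)"
    and v: "\<And>t. (v has_vector_derivative Q t * u t + g t) (at t)"
  shows "smooth u"
proof (rule smooth_alg_hull[of _ "insert u (insert v (Collect smooth))"])
  let ?G = "insert u (insert v (Collect smooth))"
  fix h assume "h \<in> ?G"
  then consider "h = u" | "h = v" | "smooth h" by auto
  then show "\<exists>g'\<in>alg_hull ?G. \<forall>t. (h has_vector_derivative g' t) (at t)"
  proof cases
    case 1
    then show ?thesis using u by (intro bexI[of _ v]) (auto intro: alg_hull.gen)
  next
    case 2
    then show ?thesis using v Q g
      by (intro bexI[of _ "\<lambda>t. Q t * u t + g t"] alg_hull.add alg_hull.mult) (auto intro: alg_hull.gen)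
  next
    case 3
    then show ?thesis by (metis alg_hull.gen insertI2 mem_Collect_eq smooth_has_vd smooth_vd)
  qed
qed (simp add: alg_hull.gen)

text \<open>
  The functions \<open>exp (-1/t) / t\<^sup>k\<close>, extended by zero to \<open>t \<le> 0\<close>, form a family whose derivatives are
  linear combinations of its members; all of them are flat at the origin.
\<close>

definition flat :: "nat \<Rightarrow> real \<Rightarrow> real" where
  "flat k t = (if t > 0 then exp (- inverse t) * inverse t ^ k else 0)"

lemma flat_tendsto_0: "((\<lambda>t. flat k t) \<longlongrightarrow> 0) (at 0)"
proof -
  have "((\<lambda>x. x ^ k / exp x) \<longlongrightarrow> 0) (at_top :: real filter)"
    by (rule tendsto_power_div_exp_0)
  then have "((\<lambda>t. inverse t ^ k / exp (inverse t)) \<longlongrightarrow> 0) (at_right (0::real))"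
    by (rule filterlim_compose[OF _ filterlim_inverse_at_top_right])
  then have "((\<lambda>t. flat k t) \<longlongrightarrow> 0) (at_right 0)"
    by (rule Lim_transform_eventually)
       (auto simp: flat_def exp_minus field_simps eventually_at_filter)
  moreover have "((\<lambda>t. flat k t) \<longlongrightarrow> 0) (at_left 0)"
    by (rule tendsto_eventually) (auto simp: flat_def eventually_at_filter)
  ultimately show ?thesis by (simp add: filterlim_at_split)
qed

lemma flat_deriv: "(flat k has_real_derivative (flat (k + 2) t - k * flat (k + 1) t)) (at t)"
proof -
  consider "t > 0" | "t < 0" | "t = 0" by linarith
  then show ?thesis
  proof cases
    case 1
    have pow: "((\<lambda>t. inverse t ^ k) has_real_derivative - (k * inverse t ^ (k + 1))) (at t)"
    proof (induction k)
      case (Suc k)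
      have "((\<lambda>t. inverse t * inverse t ^ k) has_real_derivative
          - (inverse t * inverse t) * inverse t ^ k + - (k * inverse t ^ (k + 1)) * inverse t) (at t)"
        using 1 by (intro DERIV_mult Suc) (auto intro!: derivative_eq_intros)
      then show ?case by (simp add: algebra_simps)
    qed simp
    have exp: "((\<lambda>t. exp (- inverse t)) has_real_derivative exp (- inverse t) * (inverse t * inverse t)) (at t)"
      using 1 by (auto intro!: derivative_eq_intros)
    have "((\<lambda>t. exp (- inverse t) * inverse t ^ k) has_real_derivative (flat (k + 2) t - k * flat (k + 1) t)) (at t)"
      using DERIV_mult[OF exp pow] 1 by (simp add: flat_def algebra_simps)
    then show ?thesis
      by (rule has_field_derivative_transform_within_open[where S = "{0<..}"])
         (use 1 in \<open>auto simp: flat_def\<close>)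
  next
    case 2
    have "((\<lambda>t. 0) has_real_derivative 0) (at t)" by simp
    then have "(flat k has_real_derivative 0) (at t)"
      by (rule has_field_derivative_transform_within_open[where S = "{..<0}"])
         (use 2 in \<open>auto simp: flat_def\<close>)
    then show ?thesis using 2 by (simp add: flat_def)
  next
    case 3
    have "(\<lambda>h. (flat k (0 + h) - flat k 0) / h) = flat (Suc k)"
      by (rule ext) (simp add: flat_def field_simps)
    then have "(flat k has_real_derivative 0) (at 0)"
      unfolding DERIV_def using flat_tendsto_0[of "Suc k"] by simp
    then show ?thesis using 3 by (simp add: flat_def)
  qed
qed

lemma smooth_flat: "smooth (\<lambda>t. of_real (flat k t))"
proof (rule smooth_alg_hull[of _ "range (\<lambda>k t. of_real (flat k t))"])
  let ?G = "range (\<lambda>k t. complex_of_real (flat k t))"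
  fix g assume "g \<in> ?G"
  then obtain k where g: "g = (\<lambda>t. of_real (flat k t))" by auto
  have "(\<lambda>t. of_real (flat (k + 2) t) + (- of_nat k) * of_real (flat (k + 1) t)) \<in> alg_hull ?G"
    by (intro alg_hull.add alg_hull.mult alg_hull.const alg_hull.gen) auto
  then show "\<exists>g'\<in>alg_hull ?G. \<forall>t. (g has_vector_derivative g' t) (at t)"
  proof (rule bexI[rotated], intro allI)
    fix t show "(g has_vector_derivative of_real (flat (k + 2) t) + (- of_nat k) * of_real (flat (k + 1) t)) (at t)"
      using has_vector_derivative_of_real[OF flat_deriv[of k t]]
      unfolding g by simp
  qed
qed (auto intro: alg_hull.gen)

text \<open>
  A smooth transition from \<open>0\<close> on \<open>t \<le> 0\<close> to \<open>1\<close> on \<open>t \<ge> 1\<close>.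
\<close>

definition step :: "real \<Rightarrow> real" where
  "step t = flat 0 t / (flat 0 t + flat 0 (1 - t))"

lemma flat_nonneg: "flat k t \<ge> 0"
  by (simp add: flat_def)

lemma step_denom_pos: "flat 0 t + flat 0 (1 - t) > 0"
proof (cases "t > 0")
  case True
  then have "flat 0 t > 0" by (simp add: flat_def)
  then show ?thesis using flat_nonneg[of 0 "1 - t"] by linarith
next
  case False
  then have "flat 0 (1 - t) > 0" by (simp add: flat_def)
  then show ?thesis using flat_nonneg[of 0 t] by linarith
qed

lemma step_bounds: "0 \<le> step t" "step t \<le> 1"
  using step_denom_pos[of t] flat_nonneg[of 0 t] flat_nonneg[of 0 "1 - t"] by (auto simp: step_def)

lemma step_eq_0: "t \<le> 0 \<Longrightarrow> step t = 0"
  by (simp add: step_def flat_def)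

lemma step_eq_1: "t \<ge> 1 \<Longrightarrow> step t = 1"
  by (simp add: step_def flat_def)

lemma smooth_step: "smooth (\<lambda>t. of_real (step t))"
proof -
  have "smooth (\<lambda>t. of_real (flat 0 t) * inverse (of_real (flat 0 t) + of_real (flat 0 (1 + (-1) * t))))"
  proof (intro smooth_mult smooth_inverse smooth_add smooth_flat smooth_affine_comp[of "\<lambda>t. of_real (flat 0 t)"])
    fix t show "of_real (flat 0 t) + of_real (flat 0 (1 + (-1) * t)) \<noteq> (0::complex)"
      using step_denom_pos[of t] by (simp flip: of_real_add)
  qed
  then show ?thesis by (simp add: step_def divide_inverse)
qed


section \<open>Test functions\<close>

lemma test_functions_iff: "\<phi> \<in> test_functions \<longleftrightarrow> smooth \<phi> \<and> (\<exists>K. \<forall>t. \<bar>t\<bar> > K \<longrightarrow> \<phi> t = 0)"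
  by (simp add: test_functions_def smooth_def)

lemma test_smooth: "\<phi> \<in> test_functions \<Longrightarrow> smooth \<phi>"
  by (simp add: test_functions_iff)

lemma test_has_vd: "\<phi> \<in> test_functions \<Longrightarrow> (\<phi> has_vector_derivative vd \<phi> t) (at t)"
  by (simp add: smooth_has_vd test_smooth)

lemma vd_eq_0:
  assumes "\<And>t. \<bar>t\<bar> > K \<Longrightarrow> \<phi> t = 0" "\<bar>t\<bar> > K" shows "vd \<phi> t = 0"
proof (rule vector_derivative_at)
  have "open ({K<..} \<union> {..<-K})" by auto
  then show "(\<phi> has_vector_derivative 0) (at t)"
    by (rule has_vector_derivative_transform_within_open[OF has_vector_derivative_const[of 0]])
       (use assms in auto)
qed

lemma test_vd: assumes "\<phi> \<in> test_functions" shows "vd \<phi> \<in> test_functions"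
proof -
  obtain K where "\<And>t. \<bar>t\<bar> > K \<Longrightarrow> \<phi> t = 0" using assms test_functions_iff by auto
  then have "\<forall>t. \<bar>t\<bar> > K \<longrightarrow> vd \<phi> t = 0" using vd_eq_0[of K \<phi>] by blast
  then show ?thesis using assms by (auto simp: test_functions_iff smooth_vd)
qed

lemma test_mult: assumes "smooth f" "\<phi> \<in> test_functions" shows "(\<lambda>t. f t * \<phi> t) \<in> test_functions"
  using assms by (auto simp: test_functions_iff intro!: smooth_mult)

lemma test_add: assumes "\<psi> \<in> test_functions" "\<phi> \<in> test_functions" shows "(\<lambda>t. \<psi> t + \<phi> t) \<in> test_functions"
proof -
  obtain K L where "\<And>t. \<bar>t\<bar> > K \<Longrightarrow> \<phi> t = 0" "\<And>t. \<bar>t\<bar> > L \<Longrightarrow> \<psi> t = 0"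
    using assms test_functions_iff by auto
  then have "\<forall>t. \<bar>t\<bar> > max K L \<longrightarrow> \<psi> t + \<phi> t = 0" by auto
  then show ?thesis using assms by (auto simp only: test_functions_iff intro!: smooth_add)
qed

lemma test_cmult: "\<phi> \<in> test_functions \<Longrightarrow> (\<lambda>t. c * \<phi> t) \<in> test_functions"
  by (intro test_mult smooth_const)

lemma test_diff: "\<psi> \<in> test_functions \<Longrightarrow> \<phi> \<in> test_functions \<Longrightarrow> (\<lambda>t. \<psi> t - \<phi> t) \<in> test_functions"
  using test_add[OF _ test_cmult[of \<phi> "-1"], of \<psi>] by simp

lemma test_zero: "(\<lambda>t. 0) \<in> test_functions"
  by (auto simp: test_functions_iff smooth_const)

text \<open>
  Continuous functions with compact support: the class in which all integrations by parts take place.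
  It also covers real-valued integrands such as \<open>|\<phi>|\<^sup>2\<close>.
\<close>

definition ccont :: "(real \<Rightarrow> 'a::real_normed_vector) \<Rightarrow> bool" where
  "ccont f \<longleftrightarrow> continuous_on UNIV f \<and> (\<exists>K. \<forall>t. \<bar>t\<bar> > K \<longrightarrow> f t = 0)"

lemma test_ccont: "\<phi> \<in> test_functions \<Longrightarrow> ccont \<phi>"
  by (simp add: ccont_def test_functions_iff smooth_continuous)

lemma integrable_ccont:
  fixes f :: "real \<Rightarrow> 'a::euclidean_space"
  assumes "ccont f" shows "integrable lborel f"
proof -
  obtain K where K: "\<And>t. \<bar>t\<bar> > K \<Longrightarrow> f t = 0" using assms by (auto simp: ccont_def)
  have "set_integrable lborel {-K..K} f"
    using assms by (intro borel_integrable_atLeastAtMost') (auto simp: ccont_def intro: continuous_on_subset)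
  moreover have "(\<lambda>x. indicator {-K..K} x *\<^sub>R f x) = f"
    using K by (fastforce simp: indicator_def)
  ultimately show ?thesis by (simp add: set_integrable_def)
qed

lemma integral_derivative_ccont:
  fixes F :: "real \<Rightarrow> 'a::euclidean_space"
  assumes F: "\<And>t. (F has_vector_derivative f t) (at t)" and cF: "ccont F" and cf: "ccont f"
  shows "(LINT t|lborel. f t) = 0"
proof -
  obtain K1 K2 where K: "\<And>t. \<bar>t\<bar> > K1 \<Longrightarrow> F t = 0" "\<And>t. \<bar>t\<bar> > K2 \<Longrightarrow> f t = 0"
    using cF cf by (auto simp: ccont_def)
  define K where "K = max 0 (max K1 K2) + 1"
  have "(\<lambda>x. indicator {-K..K} x *\<^sub>R f x) = f"
    using K(2) by (fastforce simp: indicator_def K_def)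
  moreover have "has_bochner_integral lborel (\<lambda>x. indicator {-K .. K} x *\<^sub>R f x) (F K - F (-K))"
    using cf by (intro has_bochner_integral_FTC_Icc)
      (auto simp: K_def ccont_def intro: has_vector_derivative_at_within[OF F] continuous_on_subset)
  ultimately have "has_bochner_integral lborel f (F K - F (-K))" by simp
  then show ?thesis using K(1)[of K] K(1)[of "-K"]
    by (auto simp: has_bochner_integral_iff K_def)
qed

lemma ccont_mult_left: "continuous_on UNIV f \<Longrightarrow> ccont g \<Longrightarrow> ccont (\<lambda>t. f t *\<^sub>R g t)"
  by (auto simp: ccont_def intro!: continuous_intros)

lemma ccont_add:
  assumes "ccont f" "ccont g" shows "ccont (\<lambda>t. f t + g t)"
proof -
  obtain K L where "\<And>t. \<bar>t\<bar> > K \<Longrightarrow> f t = 0" "\<And>t. \<bar>t\<bar> > L \<Longrightarrow> g t = 0"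
    using assms ccont_def by metis
  then have "\<forall>t. \<bar>t\<bar> > max K L \<longrightarrow> f t + g t = 0" by auto
  then show ?thesis using assms by (auto simp only: ccont_def intro!: continuous_intros)
qed

lemma ccont_inner:
  fixes f g :: "real \<Rightarrow> complex"
  assumes "continuous_on UNIV f" "ccont g" shows "ccont (\<lambda>t. f t \<bullet> g t)"
proof -
  obtain K where "\<And>t. \<bar>t\<bar> > K \<Longrightarrow> g t = 0" using assms ccont_def by metis
  then have "\<forall>t. \<bar>t\<bar> > K \<longrightarrow> f t \<bullet> g t = 0" by simp
  then show ?thesis using assms by (auto simp only: ccont_def intro!: continuous_on_inner)
qed

lemma ccont_norm2: "ccont g \<Longrightarrow> ccont (\<lambda>t. (norm (g t))\<^sup>2)"
  by (auto simp: ccont_def intro!: continuous_intros)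

section \<open>The space of square-integrable functions\<close>

text \<open>
  The real part of the inner product of \<open>L\<^sup>2\<close>. Regarding \<open>L\<^sup>2\<close> as a real Hilbert space is enough, because the
  operators are symmetric and only real spectral parameters occur.
\<close>

definition ip :: "(real \<Rightarrow> complex) \<Rightarrow> (real \<Rightarrow> complex) \<Rightarrow> real" where
  "ip u v = (LINT t|lborel. u t \<bullet> v t)"

lemma L2_norm_sq: "(L2_norm u)\<^sup>2 = (LINT t|lborel. (cmod (u t))\<^sup>2)"
  by (simp add: L2_norm_def)

lemma L2_norm_nonneg: "L2_norm u \<ge> 0"
  by (simp add: L2_norm_def)

lemma ip_self: "ip u u = (L2_norm u)\<^sup>2"
  by (simp add: ip_def L2_norm_sq power2_norm_eq_inner)

lemma ip_commute: "ip u v = ip v u"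
  by (simp add: ip_def inner_commute)

lemma test_L2: assumes "\<phi> \<in> test_functions" shows "\<phi> \<in> L2"
  using integrable_ccont[OF test_ccont[OF assms]] integrable_ccont[OF ccont_norm2[OF test_ccont[OF assms]]]
  by (auto simp: L2_def)

lemma L2_measurable: "u \<in> L2 \<Longrightarrow> u \<in> borel_measurable lborel"
  by (simp add: L2_def)

lemma L2_integrable: "u \<in> L2 \<Longrightarrow> integrable lborel (\<lambda>t. (cmod (u t))\<^sup>2)"
  by (simp add: L2_def)

lemma L2_I_bound:
  assumes "u \<in> borel_measurable lborel" "integrable lborel g" "\<And>t. (cmod (u t))\<^sup>2 \<le> g t"
  shows "u \<in> L2"
proof -
  have [measurable]: "u \<in> borel_measurable borel" using assms(1) by simp
  have "integrable lborel (\<lambda>t. (cmod (u t))\<^sup>2)"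
    by (rule Bochner_Integration.integrable_bound[OF assms(2)])
       (use assms(3) in \<open>auto intro!: AE_I2 simp: order.trans[OF _ abs_ge_self]\<close>)
  then show ?thesis using assms(1) by (simp add: L2_def)
qed

lemma sq_sum_le: "(cmod (x + y))\<^sup>2 \<le> 2 * (cmod x)\<^sup>2 + 2 * (cmod y)\<^sup>2"
proof -
  have "(cmod (x + y))\<^sup>2 \<le> (cmod x + cmod y)\<^sup>2" by (simp add: norm_triangle_ineq power_mono)
  also have "\<dots> \<le> 2 * (cmod x)\<^sup>2 + 2 * (cmod y)\<^sup>2" using sum_squares_bound[of "cmod x" "cmod y"] by (simp add: power2_sum)
  finally show ?thesis .
qed

lemma L2_add: assumes "u \<in> L2" "v \<in> L2" shows "(\<lambda>t. u t + v t) \<in> L2"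
  by (rule L2_I_bound[where g = "\<lambda>t. 2 * (cmod (u t))\<^sup>2 + 2 * (cmod (v t))\<^sup>2"])
     (use assms sq_sum_le in \<open>auto simp: L2_def\<close>)

lemma L2_cmult: assumes "u \<in> L2" shows "(\<lambda>t. c * u t) \<in> L2"
  using assms by (auto simp: L2_def norm_mult power_mult_distrib)

lemma L2_diff: "u \<in> L2 \<Longrightarrow> v \<in> L2 \<Longrightarrow> (\<lambda>t. u t - v t) \<in> L2"
  using L2_add[OF _ L2_cmult[of v "-1"], of u] by simp

lemma L2_ip_integrable: assumes "u \<in> L2" "v \<in> L2" shows "integrable lborel (\<lambda>t. u t \<bullet> v t)"
proof -
  have [measurable]: "u \<in> borel_measurable borel" "v \<in> borel_measurable borel" using assms by (auto simp: L2_def)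
  show ?thesis
  proof (rule Bochner_Integration.integrable_bound[where f = "\<lambda>t. (cmod (u t))\<^sup>2 + (cmod (v t))\<^sup>2"])
    show "AE t in lborel. norm (u t \<bullet> v t) \<le> norm ((cmod (u t))\<^sup>2 + (cmod (v t))\<^sup>2)"
    proof (rule AE_I2)
      fix t
      have "\<bar>u t \<bullet> v t\<bar> \<le> cmod (u t) * cmod (v t)" by (rule Cauchy_Schwarz_ineq2)
      also have "\<dots> \<le> (cmod (u t))\<^sup>2 + (cmod (v t))\<^sup>2"
        using sum_squares_bound[of "cmod (u t)" "cmod (v t)"] mult_nonneg_nonneg[OF norm_ge_zero norm_ge_zero, of "u t" "v t"]
        by linarith
      finally show "norm (u t \<bullet> v t) \<le> norm ((cmod (u t))\<^sup>2 + (cmod (v t))\<^sup>2)" by simp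
    qed
  qed (use assms in \<open>auto simp: L2_def\<close>)
qed

lemma ip_add_left: "u \<in> L2 \<Longrightarrow> v \<in> L2 \<Longrightarrow> w \<in> L2 \<Longrightarrow> ip (\<lambda>t. u t + v t) w = ip u w + ip v w"
  by (simp add: ip_def inner_add_left L2_ip_integrable)

lemma ip_diff_left: "u \<in> L2 \<Longrightarrow> v \<in> L2 \<Longrightarrow> w \<in> L2 \<Longrightarrow> ip (\<lambda>t. u t - v t) w = ip u w - ip v w"
  by (simp add: ip_def inner_diff_left L2_ip_integrable)

lemma ip_scale_left: "ip (\<lambda>t. of_real c * u t) w = c * ip u w"
  by (simp add: ip_def flip: scaleR_conv_of_real)

text \<open>
  The algebra behind the Cauchy-Schwarz inequality, stated so that it applies both to the inner product of
  \<open>L\<^sup>2\<close> and to the quadratic form of a Schroedinger operator.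
\<close>

lemma discriminant_le:
  fixes a b c :: real
  assumes "\<And>s. 0 \<le> a + 2 * s * b + s\<^sup>2 * c" "c \<ge> 0"
  shows "b\<^sup>2 \<le> a * c"
proof (cases "c = 0")
  case True
  have "b = 0"
  proof (rule ccontr)
    assume "b \<noteq> 0"
    then show False using assms(1)[of "- (a + 1) / (2 * b)"] True by (simp add: field_simps)
  qed
  then show ?thesis using True by simp
next
  case False
  then have "c > 0" using assms(2) by simp
  then show ?thesis using assms(1)[of "- b / c"] by (simp add: field_simps power2_eq_square)
qed

lemma ip_cauchy_schwarz: assumes "u \<in> L2" "v \<in> L2" shows "\<bar>ip u v\<bar> \<le> L2_norm u * L2_norm v"
proof -
  have "(ip u v)\<^sup>2 \<le> ip u u * ip v v"
  proof (rule discriminant_le)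
    fix s :: real
    let ?w = "\<lambda>t. u t + of_real s * v t"
    have sv: "(\<lambda>t. of_real s * v t) \<in> L2" by (rule L2_cmult[OF assms(2)])
    have w: "?w \<in> L2" by (rule L2_add[OF assms(1) sv])
    have "0 \<le> ip ?w ?w" by (simp add: ip_self)
    also have "ip ?w ?w = ip u ?w + s * ip v ?w"
      using ip_add_left[OF assms(1) sv w] ip_scale_left[of s v ?w] by simp
    also have "\<dots> = ip u u + s * ip v u + s * (ip u v + s * ip v v)"
      using ip_add_left[OF assms(1) sv assms(1)] ip_add_left[OF assms(1) sv assms(2)]
        ip_scale_left[of s v] ip_commute[of u ?w] ip_commute[of v ?w] by simp
    also have "\<dots> = ip u u + 2 * s * ip u v + s\<^sup>2 * ip v v"
      by (simp add: ip_commute algebra_simps power2_eq_square)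
    finally show "0 \<le> ip u u + 2 * s * ip u v + s\<^sup>2 * ip v v" .
  qed (simp add: ip_self)
  then have "\<bar>ip u v\<bar>\<^sup>2 \<le> (L2_norm u * L2_norm v)\<^sup>2" by (simp add: ip_self power_mult_distrib)
  then show ?thesis by (rule power2_le_imp_le) (simp add: L2_norm_nonneg)
qed

lemma L2_triangle: assumes "u \<in> L2" "v \<in> L2" shows "L2_norm (\<lambda>t. u t + v t) \<le> L2_norm u + L2_norm v"
proof (rule power2_le_imp_le)
  have w: "(\<lambda>t. u t + v t) \<in> L2" using assms by (rule L2_add)
  have "(L2_norm (\<lambda>t. u t + v t))\<^sup>2 = ip u u + 2 * ip u v + ip v v"
    using ip_add_left[OF assms w] ip_add_left[OF assms assms(1)] ip_add_left[OF assms assms(2)]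
      ip_commute[of u "\<lambda>t. u t + v t"] ip_commute[of v "\<lambda>t. u t + v t"] ip_commute[of u v]
    unfolding ip_self[symmetric] by linarith
  also have "\<dots> \<le> (L2_norm u + L2_norm v)\<^sup>2"
    using ip_cauchy_schwarz[OF assms] by (simp add: ip_self power2_sum)
  finally show "(L2_norm (\<lambda>t. u t + v t))\<^sup>2 \<le> (L2_norm u + L2_norm v)\<^sup>2" .
qed (simp add: L2_norm_nonneg)

lemma L2_norm_cmult: "L2_norm (\<lambda>t. c * u t) = cmod c * L2_norm u"
  by (simp add: L2_norm_def norm_mult power_mult_distrib real_sqrt_mult)

lemma L2_norm_minus_commute: "L2_norm (\<lambda>t. u t - v t) = L2_norm (\<lambda>t. v t - u t)"
  by (simp add: L2_norm_def norm_minus_commute)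

lemma L2_triangle_diff:
  assumes "u \<in> L2" "v \<in> L2" "w \<in> L2"
  shows "L2_norm (\<lambda>t. u t - w t) \<le> L2_norm (\<lambda>t. u t - v t) + L2_norm (\<lambda>t. v t - w t)"
  using L2_triangle[OF L2_diff[OF assms(1,2)] L2_diff[OF assms(2,3)]] by simp

lemma L2_norm_le_diff:
  assumes "u \<in> L2" "v \<in> L2"
  shows "\<bar>L2_norm u - L2_norm v\<bar> \<le> L2_norm (\<lambda>t. u t - v t)"
  using L2_triangle[OF L2_diff[OF assms] assms(2)] L2_triangle[OF L2_diff[OF assms(2,1)] assms(1)]
    L2_norm_minus_commute[of u v] by simp

lemma L2_norm_cong_AE:
  assumes "u \<in> L2" "v \<in> L2" "AE t in lborel. u t = v t"
  shows "L2_norm u = L2_norm v"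
  unfolding L2_norm_def using assms
  by (intro arg_cong[of _ _ sqrt] integral_cong_AE) (auto simp: L2_def)

lemma L2_norm_eq_0: assumes "u \<in> L2" "L2_norm u = 0" shows "AE t in lborel. u t = 0"
proof -
  have "(LINT t|lborel. (cmod (u t))\<^sup>2) = 0" using assms(2) by (simp add: L2_norm_def)
  then show ?thesis
    using integral_nonneg_eq_0_iff_AE[OF L2_integrable[OF assms(1)]] by auto
qed

lemma L2_nn_integral: "u \<in> L2 \<Longrightarrow> (\<integral>\<^sup>+t. ennreal ((cmod (u t))\<^sup>2) \<partial>lborel) = ennreal ((L2_norm u)\<^sup>2)"
  by (simp add: L2_norm_sq nn_integral_eq_integral L2_integrable)

text \<open>
  A subsequence with increments \<open>w k\<close> of norm at most \<open>2\<^sup>-\<^sup>k\<close> converges almost everywhere, and Fatou's lemma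
  identifies its pointwise limit as the limit in norm. For almost every \<open>t\<close> the series
  \<open>\<Sum>k. 2\<^sup>k |w k t|\<^sup>2\<close> is finite, as its integral is, and this gives convergence of \<open>\<Sum>k. w k t\<close> because
  \<open>2 |x| \<le> 2\<^sup>k |x|\<^sup>2 + 2\<^sup>-\<^sup>k\<close>.
\<close>

lemma L2_complete:
  assumes u: "\<And>n. u n \<in> L2"
    and cauchy: "\<And>e. e > 0 \<Longrightarrow> \<exists>N. \<forall>m\<ge>N. \<forall>n\<ge>N. L2_norm (\<lambda>t. u m t - u n t) < e"
  shows "\<exists>v\<in>L2. (\<lambda>n. L2_norm (\<lambda>t. u n t - v t)) \<longlonglongrightarrow> 0"
proof -
  have [measurable]: "u n \<in> borel_measurable borel" for n using u[of n] by (simp add: L2_def)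
  have "\<forall>k. \<exists>N. \<forall>m\<ge>N. \<forall>n\<ge>N. L2_norm (\<lambda>t. u m t - u n t) < (1/2)^k"
    by (intro allI cauchy) simp
  then obtain N where N: "\<And>k m n. m \<ge> N k \<Longrightarrow> n \<ge> N k \<Longrightarrow> L2_norm (\<lambda>t. u m t - u n t) < (1/2)^k"
    by metis
  \<comment> \<open>The sum makes both \<open>r k\<close> and \<open>r (Suc k)\<close> at least \<open>N k\<close>.\<close>
  define r where "r k = (\<Sum>j\<le>k. N j)" for k
  have r: "N k \<le> r k" "N k \<le> r (Suc k)" for k
    unfolding r_def by (auto intro: member_le_sum trans_le_add1)
  define w where "w k t = u (r (Suc k)) t - u (r k) t" for k t
  have [measurable]: "w k \<in> borel_measurable borel" for k unfolding w_def by measurable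
  have wL2: "w k \<in> L2" for k unfolding w_def by (intro L2_diff u)
  have wn: "L2_norm (w k) \<le> (1/2)^k" for k
    using N[OF r(2) r(1), of k] by (simp add: w_def[abs_def] less_imp_le)
  have "(\<integral>\<^sup>+t. (\<Sum>k. ennreal (2^k * (cmod (w k t))\<^sup>2)) \<partial>lborel)
      = (\<Sum>k. \<integral>\<^sup>+t. ennreal (2^k * (cmod (w k t))\<^sup>2) \<partial>lborel)"
    by (rule nn_integral_suminf) measurable
  also have "\<dots> \<le> (\<Sum>k. ennreal ((1/2)^k))"
  proof (intro suminf_le summableI)
    fix k
    have "(\<integral>\<^sup>+t. ennreal (2^k * (cmod (w k t))\<^sup>2) \<partial>lborel) = ennreal (2^k * (L2_norm (w k))\<^sup>2)"
      using L2_nn_integral[OF wL2[of k]] by (simp add: ennreal_mult nn_integral_cmult)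
    also have "(L2_norm (w k))\<^sup>2 \<le> ((1/2)^k)\<^sup>2" using wn L2_norm_nonneg by (intro power_mono) auto
    then have "2^k * (L2_norm (w k))\<^sup>2 \<le> 2^k * ((1/2)^k)\<^sup>2" by simp
    also have "\<dots> = (1/2::real)^k" by (simp add: power2_eq_square power_divide)
    finally show "(\<integral>\<^sup>+t. ennreal (2^k * (cmod (w k t))\<^sup>2) \<partial>lborel) \<le> ennreal ((1/2)^k)"
      by (simp add: ennreal_leI)
  qed
  also have "\<dots> = ennreal (\<Sum>k. (1/2)^k)"
    by (rule suminf_ennreal2) (auto intro: summable_geometric)
  finally have "(\<integral>\<^sup>+t. (\<Sum>k. ennreal (2^k * (cmod (w k t))\<^sup>2)) \<partial>lborel) \<noteq> \<infinity>"
    by (auto simp: top_unique)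
  then have "AE t in lborel. (\<Sum>k. ennreal (2^k * (cmod (w k t))\<^sup>2)) \<noteq> \<infinity>"
    by (intro nn_integral_PInf_AE) measurable
  then have lim: "AE t in lborel. (\<lambda>k. u (r k) t) \<longlonglongrightarrow> lim (\<lambda>k. u (r k) t)"
  proof eventually_elim
    case (elim t)
    have "summable (\<lambda>k. 2^k * (cmod (w k t))\<^sup>2)"
      using elim by (intro summable_suminf_not_top) auto
    then have s: "summable (\<lambda>k. 2^k * (cmod (w k t))\<^sup>2 + (1/2)^k)"
      by (rule summable_add) (auto intro: summable_geometric)
    have "summable (\<lambda>k. w k t)"
    proof (rule summable_comparison_test'[OF s, of 0])
      fix k
      have "0 \<le> (2^k * cmod (w k t) - 1)\<^sup>2 / 2^k" by simp
      also have "\<dots> = 2^k * (cmod (w k t))\<^sup>2 + (1/2)^k - 2 * cmod (w k t)"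
        by (simp add: power2_diff power_mult_distrib field_simps power2_eq_square power_divide)
      finally show "norm (w k t) \<le> 2^k * (cmod (w k t))\<^sup>2 + (1/2)^k"
        using norm_ge_zero[of "w k t"] by linarith
    qed
    then have "convergent (\<lambda>n. \<Sum>k<n. w k t)" by (simp add: summable_iff_convergent)
    moreover have "(\<Sum>k<n. w k t) = u (r n) t - u (r 0) t" for n
      unfolding w_def by (rule sum_lessThan_telescope)
    ultimately have "convergent (\<lambda>n. u (r n) t - u (r 0) t)" by simp
    then have "convergent (\<lambda>n. (u (r n) t - u (r 0) t) + u (r 0) t)"
      by (intro convergent_add convergent_const)
    then show ?case by (simp add: convergent_LIMSEQ_iff)
  qed
  define v where "v t = lim (\<lambda>k. u (r k) t)" for t
  have vm[measurable]: "v \<in> borel_measurable borel" unfolding v_def by measurable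
  have bound: "(\<integral>\<^sup>+t. ennreal ((cmod (u n t - v t))\<^sup>2) \<partial>lborel) \<le> ennreal (((1/2)^j)\<^sup>2)" if n: "n \<ge> N j" for n j
  proof -
    have "(\<integral>\<^sup>+t. ennreal ((cmod (u n t - v t))\<^sup>2) \<partial>lborel)
        = (\<integral>\<^sup>+t. liminf (\<lambda>k. ennreal ((cmod (u n t - u (r k) t))\<^sup>2)) \<partial>lborel)"
    proof (rule nn_integral_cong_AE)
      show "AE t in lborel. ennreal ((cmod (u n t - v t))\<^sup>2) = liminf (\<lambda>k. ennreal ((cmod (u n t - u (r k) t))\<^sup>2))"
        using lim
      proof eventually_elim
        case (elim t)
        then have "(\<lambda>k. ennreal ((cmod (u n t - u (r k) t))\<^sup>2)) \<longlonglongrightarrow> ennreal ((cmod (u n t - v t))\<^sup>2)"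
          unfolding v_def by (intro tendsto_intros)
        then show ?case by (intro lim_imp_Liminf[symmetric]) auto
      qed
    qed
    also have "\<dots> \<le> liminf (\<lambda>k. \<integral>\<^sup>+t. ennreal ((cmod (u n t - u (r k) t))\<^sup>2) \<partial>lborel)"
      by (rule nn_integral_liminf) measurable
    also have "\<dots> \<le> ennreal (((1/2)^j)\<^sup>2)"
    proof (rule Liminf_le)
      have "(\<integral>\<^sup>+t. ennreal ((cmod (u n t - u (r k) t))\<^sup>2) \<partial>lborel) \<le> ennreal (((1/2)^j)\<^sup>2)" if "k \<ge> j" for k
      proof -
        have "N j \<le> r k" using that unfolding r_def by (intro member_le_sum) auto
        then have "L2_norm (\<lambda>t. u n t - u (r k) t) \<le> (1/2)^j" using N n less_imp_le by blast
        then have "(L2_norm (\<lambda>t. u n t - u (r k) t))\<^sup>2 \<le> ((1/2)^j)\<^sup>2" by (intro power_mono L2_norm_nonneg)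
        then show ?thesis using L2_nn_integral[OF L2_diff[OF u u], of n "r k"] by (simp add: ennreal_leI)
      qed
      then show "\<forall>\<^sub>F k in sequentially. (\<integral>\<^sup>+t. ennreal ((cmod (u n t - u (r k) t))\<^sup>2) \<partial>lborel) \<le> ennreal (((1/2)^j)\<^sup>2)"
        by (auto simp: eventually_sequentially)
    qed simp
    finally show ?thesis .
  qed
  have dL2: "(\<lambda>t. u n t - v t) \<in> L2" if "n \<ge> N j" for n j
  proof -
    have "integrable lborel (\<lambda>t. (cmod (u n t - v t))\<^sup>2)"
      using bound[OF that] by (intro integrableI_nonneg) (auto simp: le_less_trans)
    then show ?thesis by (simp add: L2_def)
  qed
  have vL2: "v \<in> L2" using L2_diff[OF u[of "N 0"] dL2[of 0 "N 0"]] by simp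
  have "L2_norm (\<lambda>t. u n t - v t) \<le> (1/2)^j" if "n \<ge> N j" for n j
  proof -
    have "(L2_norm (\<lambda>t. u n t - v t))\<^sup>2 \<le> ((1/2)^j)\<^sup>2"
      using bound[OF that] L2_nn_integral[OF dL2[OF that]] by simp
    then show ?thesis by (rule power2_le_imp_le) simp
  qed
  note b = this
  have "(\<lambda>n. L2_norm (\<lambda>t. u n t - v t)) \<longlonglongrightarrow> 0"
  proof (rule LIMSEQ_I)
    fix e :: real assume "e > 0"
    then obtain j where "(1/2)^j < e" using real_arch_pow_inv[of e "1/2"] by auto
    then have "\<forall>n\<ge>N j. norm (L2_norm (\<lambda>t. u n t - v t) - 0) < e" using b L2_norm_nonneg by (fastforce simp: le_less_trans)
    then show "\<exists>no. \<forall>n\<ge>no. norm (L2_norm (\<lambda>t. u n t - v t) - 0) < e" by blast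
  qed
  then show ?thesis using vL2 by blast
qed


section \<open>Density of the test functions\<close>

text \<open>
  The closure of the test functions in \<open>L\<^sup>2\<close>, to be shown equal to \<open>L\<^sup>2\<close>. It is closed under sums,
  multiples and dominated limits, so it is enough to reach indicators of intervals, then of Borel
  sets, then simple functions.
\<close>

definition test_closure :: "(real \<Rightarrow> complex) set" where
  "test_closure = {u \<in> L2. \<forall>e>0. \<exists>\<phi>\<in>test_functions. L2_norm (\<lambda>t. \<phi> t - u t) < e}"

lemma test_closure_limit:
  assumes v: "\<And>n. v n \<in> test_closure" and u: "u \<in> L2"
    and lim: "(\<lambda>n. L2_norm (\<lambda>t. v n t - u t)) \<longlonglongrightarrow> 0"
  shows "u \<in> test_closure"
  unfolding test_closure_def
proof (intro CollectI conjI u allI impI)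
  fix e :: real assume "e > 0"
  then obtain n where n: "L2_norm (\<lambda>t. v n t - u t) < e / 2"
    using LIMSEQ_D[OF lim, of "e / 2"] by (auto simp: L2_norm_nonneg)
  obtain \<phi> where \<phi>: "\<phi> \<in> test_functions" "L2_norm (\<lambda>t. \<phi> t - v n t) < e / 2"
    using v[of n] \<open>e > 0\<close> unfolding test_closure_def by (auto dest!: spec[of _ "e / 2"])
  have "v n \<in> L2" using v unfolding test_closure_def by auto
  then show "\<exists>\<phi>\<in>test_functions. L2_norm (\<lambda>t. \<phi> t - u t) < e"
    using L2_triangle_diff[OF test_L2[OF \<phi>(1)] _ u, of "v n"] n \<phi> by (intro bexI[of _ \<phi>]) auto
qed

lemma test_in_closure: "\<phi> \<in> test_functions \<Longrightarrow> \<phi> \<in> test_closure"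
  by (auto simp: test_closure_def test_L2 L2_norm_def intro!: bexI[of _ \<phi>])

lemma test_closure_add:
  assumes "u \<in> test_closure" "v \<in> test_closure"
  shows "(\<lambda>t. u t + v t) \<in> test_closure"
  unfolding test_closure_def
proof (intro CollectI conjI allI impI)
  have L: "u \<in> L2" "v \<in> L2" using assms by (auto simp: test_closure_def)
  then show "(\<lambda>t. u t + v t) \<in> L2" by (rule L2_add)
  fix e :: real assume "e > 0"
  then have "e / 2 > 0" by simp
  then obtain \<phi> \<psi> where \<phi>: "\<phi> \<in> test_functions" "L2_norm (\<lambda>t. \<phi> t - u t) < e / 2"
      and \<psi>: "\<psi> \<in> test_functions" "L2_norm (\<lambda>t. \<psi> t - v t) < e / 2"
    using assms unfolding test_closure_def by blast
  have "L2_norm (\<lambda>t. (\<phi> t - u t) + (\<psi> t - v t)) < e"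
    using L2_triangle[OF L2_diff[OF test_L2[OF \<phi>(1)] L(1)] L2_diff[OF test_L2[OF \<psi>(1)] L(2)]] \<phi> \<psi> by simp
  then show "\<exists>\<phi>\<in>test_functions. L2_norm (\<lambda>t. \<phi> t - (u t + v t)) < e"
    by (intro bexI[OF _ test_add[OF \<phi>(1) \<psi>(1)]]) (simp add: algebra_simps)
qed

lemma test_closure_cmult:
  assumes "u \<in> test_closure" shows "(\<lambda>t. c * u t) \<in> test_closure"
  unfolding test_closure_def
proof (intro CollectI conjI allI impI)
  have L: "u \<in> L2" using assms by (auto simp: test_closure_def)
  then show "(\<lambda>t. c * u t) \<in> L2" by (rule L2_cmult)
  fix e :: real assume "e > 0"
  then have e': "e / (cmod c + 1) > 0" by (simp add: add_nonneg_pos)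
  then obtain \<phi> where \<phi>: "\<phi> \<in> test_functions" "L2_norm (\<lambda>t. \<phi> t - u t) < e / (cmod c + 1)"
    using assms unfolding test_closure_def by blast
  have "cmod c * L2_norm (\<lambda>t. \<phi> t - u t) \<le> cmod c * (e / (cmod c + 1))"
    using \<phi> by (intro mult_left_mono) auto
  also have "\<dots> < e" using \<open>e > 0\<close> add_nonneg_pos[OF norm_ge_zero[of c] zero_less_one] by (simp add: field_simps)
  finally have "L2_norm (\<lambda>t. c * (\<phi> t - u t)) < e" by (simp add: L2_norm_cmult)
  then show "\<exists>\<phi>\<in>test_functions. L2_norm (\<lambda>t. \<phi> t - c * u t) < e"
    by (intro bexI[OF _ test_cmult[OF \<phi>(1)]]) (simp add: algebra_simps)
qed

lemma L2_dominated_convergence: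
  assumes v: "\<And>n. v n \<in> borel_measurable lborel" and u: "u \<in> borel_measurable lborel"
    and g: "integrable lborel g" and bound: "\<And>n t. (cmod (v n t))\<^sup>2 \<le> g t"
    and lim: "\<And>t. (\<lambda>n. v n t) \<longlonglongrightarrow> u t"
  shows "u \<in> L2" "(\<lambda>n. L2_norm (\<lambda>t. v n t - u t)) \<longlonglongrightarrow> 0"
proof -
  have [measurable]: "\<And>n. v n \<in> borel_measurable borel" "u \<in> borel_measurable borel" using v u by auto
  have ub: "(cmod (u t))\<^sup>2 \<le> g t" for t
    by (rule LIMSEQ_le_const2[where X = "\<lambda>n. (cmod (v n t))\<^sup>2"])
       (auto intro!: tendsto_intros lim bound)
  show "u \<in> L2" by (rule L2_I_bound[OF u g ub])
  have "(\<lambda>n. LINT t|lborel. (cmod (v n t - u t))\<^sup>2) \<longlonglongrightarrow> (LINT t|(lborel :: real measure). (0::real))"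
  proof (rule integral_dominated_convergence[where w = "\<lambda>t. 4 * g t"])
    show "AE t in lborel. (\<lambda>n. (cmod (v n t - u t))\<^sup>2) \<longlonglongrightarrow> 0"
    proof (rule AE_I2)
      fix t
      have "(\<lambda>n. (cmod (v n t - u t))\<^sup>2) \<longlonglongrightarrow> (cmod (u t - u t))\<^sup>2" by (intro tendsto_intros lim)
      then show "(\<lambda>n. (cmod (v n t - u t))\<^sup>2) \<longlonglongrightarrow> 0" by simp
    qed
    fix n
    have "(cmod (v n t - u t))\<^sup>2 \<le> 4 * g t" for t
      using sq_sum_le[of "v n t" "- u t"] bound[of n t] ub[of t] by simp
    then show "AE t in lborel. norm ((cmod (v n t - u t))\<^sup>2) \<le> 4 * g t" by simp
  qed (use g in auto)
  then have "(\<lambda>n. sqrt (LINT t|lborel. (cmod (v n t - u t))\<^sup>2)) \<longlonglongrightarrow> sqrt 0"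
    by (intro tendsto_real_sqrt) simp
  then show "(\<lambda>n. L2_norm (\<lambda>t. v n t - u t)) \<longlonglongrightarrow> 0" by (simp add: L2_norm_def)
qed

lemma test_closure_dominated:
  assumes "\<And>n. v n \<in> test_closure" and "u \<in> borel_measurable lborel"
    and "integrable lborel g" and "\<And>n t. (cmod (v n t))\<^sup>2 \<le> g t"
    and "\<And>t. (\<lambda>n. v n t) \<longlonglongrightarrow> u t"
  shows "u \<in> test_closure"
proof (rule test_closure_limit[OF assms(1)])
  have m: "\<And>n. v n \<in> borel_measurable lborel" using assms(1) by (simp add: test_closure_def L2_def)
  show "u \<in> L2" "(\<lambda>n. L2_norm (\<lambda>t. v n t - u t)) \<longlonglongrightarrow> 0"
    using L2_dominated_convergence[OF m assms(2-5)] by auto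
qed

text \<open>
  Products of two smooth steps, at the two ends of the interval and steepened by the factor \<open>n\<close>.
\<close>

lemma indicator_interval_in_test_closure: "indicator {a<..<b::real} \<in> test_closure"
proof (rule test_closure_dominated[where g = "indicator {a..b}"])
  define v where "v n t = complex_of_real (step (of_nat n * (t - a))) * of_real (step (of_nat n * (b - t)))"
    for n :: nat and t :: real
  have "v n \<in> test_functions" for n
  proof -
    have "smooth (\<lambda>t. of_real (step (- (of_nat n * a) + of_nat n * t)))"
         "smooth (\<lambda>t. of_real (step (of_nat n * b + (- of_nat n) * t)))"
      by (rule smooth_affine_comp[OF smooth_step])+
    then have "smooth (v n)" unfolding v_def
      by (auto intro!: smooth_mult simp: algebra_simps)
    moreover have "v n t = 0" if "\<bar>t\<bar> > max \<bar>a\<bar> \<bar>b\<bar>" for t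
    proof -
      have "of_nat n * (t - a) \<le> 0 \<or> of_nat n * (b - t) \<le> (0::real)"
        using that by (intro disj_forward[OF _ mult_nonneg_nonpos mult_nonneg_nonpos, where P' = "t \<le> a" and Q' = "b \<le> t"]) auto
      then show ?thesis by (auto simp: v_def step_eq_0)
    qed
    ultimately show ?thesis by (auto simp only: test_functions_iff)
  qed
  then show "v n \<in> test_closure" for n by (rule test_in_closure)
  show "integrable lborel (indicat_real {a..b})" by (simp add: integrable_indicator_iff emeasure_lborel_Icc_eq)
  fix t
  have zero: "v n t = 0" if "t \<notin> {a<..<b}" for n
  proof -
    have "of_nat n * (t - a) \<le> 0 \<or> of_nat n * (b - t) \<le> (0::real)"
      using that by (auto simp: mult_le_0_iff)
    then show ?thesis by (auto simp: v_def step_eq_0)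
  qed
  show "(cmod (v n t))\<^sup>2 \<le> indicat_real {a..b} t" for n
  proof (cases "t \<in> {a<..<b}")
    case True
    have "cmod (v n t) \<le> 1 * 1"
      unfolding v_def norm_mult using step_bounds by (intro mult_mono) auto
    then show ?thesis using True by (auto simp: indicator_def power_le_one)
  qed (simp add: zero)
  show "(\<lambda>n. v n t) \<longlonglongrightarrow> indicator {a<..<b} t"
  proof (cases "t \<in> {a<..<b}")
    case True
    then obtain n1 n2 :: nat where n: "1 < of_nat n1 * (t - a)" "1 < of_nat n2 * (b - t)"
      using ex_less_of_nat_mult[of "t - a" 1] ex_less_of_nat_mult[of "b - t" 1] by auto
    have "v n t = 1" if "n \<ge> max n1 n2" for n
    proof -
      have "of_nat n1 * (t - a) \<le> of_nat n * (t - a)" "of_nat n2 * (b - t) \<le> of_nat n * (b - t)"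
        using that True by (auto intro!: mult_right_mono)
      then show ?thesis using n by (simp add: v_def step_eq_1)
    qed
    then have "eventually (\<lambda>n. v n t = 1) sequentially" unfolding eventually_sequentially by blast
    then show ?thesis using True by (simp add: tendsto_eventually)
  qed (simp add: zero)
qed auto

lemma sets_borel_greaterThan: "sets (borel :: real measure) = sigma_sets UNIV (range greaterThan)"
  by (subst borel_Ioi) (simp add: sets_measure_of)

text \<open>
  Induction over the Borel sets generated by half-lines, which form an intersection-stable
  system. The cut to \<open>(-N, N)\<close> keeps complements and disjoint unions within finite measure.
\<close>

lemma indicator_bounded_in_test_closure:
  assumes "A \<in> sets borel"
  shows "indicator (A \<inter> {-N<..<N::real}) \<in> test_closure"
proof -
  have A: "A \<in> sigma_sets UNIV (range (\<lambda>a::real. {a<..}))"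
    using assms sets_borel_greaterThan by simp
  have stable: "Int_stable (range (\<lambda>a::real. {a<..}))"
  proof -
    have "{a<..} \<inter> {b<..} = {max a b<..}" for a b :: real by auto
    then show ?thesis by (auto simp: Int_stable_def)
  qed
  have "range (\<lambda>a::real. {a<..}) \<subseteq> Pow UNIV" by simp
  from stable this A show ?thesis
  proof (induction rule: sigma_sets_induct_disjoint)
    case (basic A)
    then obtain a where "A = {a<..}" by auto
    then have "A \<inter> {-N<..<N} = {max a (-N)<..<N}" by auto
    then show ?case using indicator_interval_in_test_closure[of "max a (-N)" N] by simp
  next
    case empty
    show ?case using test_in_closure[OF test_zero] by simp
  next
    case (compl A)
    have "(\<lambda>t. indicator {-N<..<N} t + (-1) * indicator (A \<inter> {-N<..<N}) t) \<in> test_closure"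
      by (intro test_closure_add test_closure_cmult compl indicator_interval_in_test_closure)
    moreover have "(\<lambda>t. indicator {-N<..<N} t + (-1) * indicator (A \<inter> {-N<..<N}) t) =
        (indicator ((UNIV - A) \<inter> {-N<..<N}) :: real \<Rightarrow> complex)"
      by (auto simp: indicator_def)
    ultimately show ?case by simp
  next
    case (union A)
    have sets: "A i \<in> sets borel" for i
      using union(2) sets_borel_greaterThan by auto
    show ?case
    proof (rule test_closure_dominated[where v = "\<lambda>n t. \<Sum>i<n. indicator (A i \<inter> {-N<..<N}) t"
            and g = "indicator {-N..N}"])
      fix n
      show "(\<lambda>t. \<Sum>i<n. indicator (A i \<inter> {-N<..<N}) t) \<in> test_closure"
        by (induction n) (auto intro: test_in_closure[OF test_zero] test_closure_add union)
      have eq: "(\<Sum>i<n. indicator (A i \<inter> {-N<..<N}) t) = (indicator (\<Union>i<n. A i \<inter> {-N<..<N}) t :: complex)" for t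
        using union(1) by (subst indicator_UN_disjoint) (auto simp: disjoint_family_on_def)
      fix t
      show "(cmod (\<Sum>i<n. indicator (A i \<inter> {-N<..<N}) t))\<^sup>2 \<le> indicat_real {-N..N} t"
        unfolding eq by (auto simp: indicator_def)
    next
      fix t
      have "(\<lambda>i. indicator (A i \<inter> {-N<..<N}) t :: real) sums indicator (\<Union>i. A i \<inter> {-N<..<N}) t"
        using union(1) by (intro indicator_sums) (auto simp: disjoint_family_on_def)
      then have "(\<lambda>i. complex_of_real (indicator (A i \<inter> {-N<..<N}) t)) sums of_real (indicator (\<Union>i. A i \<inter> {-N<..<N}) t)"
        by (rule sums_of_real)
      moreover have "complex_of_real (indicator B t) = indicator B t" for B by (simp add: indicator_def)
      ultimately have "(\<lambda>i. indicator (A i \<inter> {-N<..<N}) t :: complex) sums indicator (\<Union>i. A i \<inter> {-N<..<N}) t"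
        by simp
      then show "(\<lambda>n. \<Sum>i<n. indicator (A i \<inter> {-N<..<N}) t :: complex) \<longlonglongrightarrow> indicator (\<Union>(range A) \<inter> {-N<..<N}) t"
        unfolding sums_def by (simp add: Int_UN_distrib2)
    next
      have "(\<Union>i. A i) \<in> sets borel" using sets by blast
      then have "\<Union>(range A) \<inter> {-N<..<N} \<in> sets lborel" by simp
      then show "indicator (\<Union>(range A) \<inter> {-N<..<N}) \<in> borel_measurable lborel"
        by (rule borel_measurable_indicator)
    qed (simp add: integrable_indicator_iff emeasure_lborel_Icc_eq)
  qed
qed

lemma indicator_in_test_closure:
  assumes A: "A \<in> sets lborel" and fin: "emeasure lborel A < \<infinity>"
  shows "indicator A \<in> test_closure"
proof (rule test_closure_dominated[where v = "\<lambda>n. indicator (A \<inter> {- real n<..<real n})" and g = "indicator A"])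
  show "indicator (A \<inter> {- real n<..<real n}) \<in> test_closure" for n
    using A by (intro indicator_bounded_in_test_closure) simp
  show "integrable lborel (indicat_real A)" using A fin by simp
  show "indicator A \<in> borel_measurable lborel" using A by simp
  fix t :: real
  show "(cmod (indicator (A \<inter> {- real n<..<real n}) t))\<^sup>2 \<le> indicat_real A t" for n
    by (auto simp: indicator_def)
  obtain n0 :: nat where "\<bar>t\<bar> < real n0" using reals_Archimedean2 by blast
  then have "indicator (A \<inter> {- real n<..<real n}) t = (indicator A t :: complex)" if "n \<ge> n0" for n
    using that by (auto simp: indicator_def)
  then have "eventually (\<lambda>n. indicator (A \<inter> {- real n<..<real n}) t = (indicator A t :: complex)) sequentially"
    unfolding eventually_sequentially by blast
  then show "(\<lambda>n. indicator (A \<inter> {- real n<..<real n}) t) \<longlonglongrightarrow> (indicator A t :: complex)"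
    by (rule tendsto_eventually)
qed

lemma test_functions_dense:
  assumes u: "u \<in> L2" shows "u \<in> test_closure"
proof -
  have um: "u \<in> borel_measurable lborel" using u by (rule L2_measurable)
  from borel_measurable_implies_sequence_metric[OF um, of 0] obtain F where
    F: "\<And>i. simple_function lborel (F i)" "\<And>t. (\<lambda>i. F i t) \<longlonglongrightarrow> u t"
    "\<And>i t. cmod (F i t) \<le> 2 * cmod (u t)" by auto
  have F2: "(cmod (F i t))\<^sup>2 \<le> 4 * (cmod (u t))\<^sup>2" for i t
    using power_mono[OF F(3) norm_ge_zero, of i t 2] by (simp add: power_mult_distrib)
  show ?thesis
  proof (rule test_closure_dominated[where v = F and g = "\<lambda>t. 4 * (cmod (u t))\<^sup>2"])
    fix i
    have Fm: "F i \<in> borel_measurable lborel" using F(1) by (rule borel_measurable_simple_function)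
    have Fi: "F i \<in> L2"
      by (rule L2_I_bound[OF Fm _ F2]) (use L2_integrable[OF u] in simp)
    have fin: "finite (range (F i))" using simple_functionD(1)[OF F(1)] by simp
    have ind: "(\<lambda>t. y * indicator (F i -` {y}) t) \<in> test_closure" for y
    proof (cases "y = 0")
      case True
      then show ?thesis using test_in_closure[OF test_zero] by simp
    next
      case False
      have s: "F i -` {y} \<in> sets lborel" using simple_functionD(2)[OF F(1)[of i], of "{y}"] by simp
      have "integrable lborel (indicat_real (F i -` {y}))"
      proof (rule Bochner_Integration.integrable_bound[where f = "\<lambda>t. (cmod (F i t))\<^sup>2 / (cmod y)\<^sup>2"])
        show "AE t in lborel. norm (indicat_real (F i -` {y}) t) \<le> norm ((cmod (F i t))\<^sup>2 / (cmod y)\<^sup>2)"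
          using False by (auto simp: indicator_def)
      qed (use s L2_integrable[OF Fi] in auto)
      then have "emeasure lborel (F i -` {y}) < \<infinity>"
        using s by (simp add: integrable_indicator_iff)
      then show ?thesis by (intro test_closure_cmult indicator_in_test_closure s)
    qed
    have "(\<lambda>t. \<Sum>y\<in>S. y * indicator (F i -` {y}) t) \<in> test_closure" if "finite S" for S
      using that
    proof (induction S)
      case (insert y S)
      then have "(\<lambda>t. \<Sum>y\<in>S. y * indicator (F i -` {y}) t) \<in> test_closure" by simp
      then show ?case using test_closure_add[OF ind[of y]] unfolding sum.insert[OF insert.hyps] by fastforce
    qed (use test_in_closure[OF test_zero] in simp)
    from this[OF fin]
    have "(\<lambda>t. \<Sum>y\<in>range (F i). y * indicator (F i -` {y}) t) \<in> test_closure" .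
    moreover have "(\<Sum>y\<in>range (F i). y * indicator (F i -` {y}) t) = F i t" for t
    proof -
      have "(\<Sum>y\<in>range (F i). y * indicator (F i -` {y}) t) = (\<Sum>y\<in>range (F i). if y = F i t then y else 0)"
        by (intro sum.cong) (auto simp: indicator_def)
      then show ?thesis using fin by simp
    qed
    ultimately show "F i \<in> test_closure" by simp
  qed (use um F2 F(2) L2_integrable[OF u] in auto)
qed


section \<open>Linear differential equations of second order\<close>

lemma exists_primitive:
  fixes f :: "real \<Rightarrow> complex"
  assumes "continuous_on UNIV f"
  shows "\<exists>F. F c = 0 \<and> (\<forall>t. (F has_vector_derivative f t) (at t))"
proof -
  have "\<exists>F. \<forall>x::real. -\<infinity> < ereal x \<longrightarrow> ereal x < \<infinity> \<longrightarrow> (F has_vector_derivative f x) (at x)"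
    using assms by (intro einterval_antiderivative) (auto simp: continuous_on_eq_continuous_at)
  then obtain F where F: "\<And>x. (F has_vector_derivative f x) (at x)" by auto
  have "((\<lambda>t. F t - F c) has_vector_derivative f t) (at t)" for t
    using has_vector_derivative_diff[OF F has_vector_derivative_const] by simp
  then show ?thesis by (intro exI[of _ "\<lambda>t. F t - F c"]) simp
qed

definition primitive :: "real \<Rightarrow> (real \<Rightarrow> complex) \<Rightarrow> real \<Rightarrow> complex" where
  "primitive c f = (SOME F. F c = 0 \<and> (\<forall>t. (F has_vector_derivative f t) (at t)))"

lemma primitive:
  assumes "continuous_on UNIV f"
  shows "primitive c f c = 0" "(primitive c f has_vector_derivative f t) (at t)"
  using someI_ex[OF exists_primitive[OF assms, of c]] unfolding primitive_def by auto

lemma continuous_of_vd: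
  fixes F :: "real \<Rightarrow> complex"
  shows "(\<And>t. (F has_vector_derivative f t) (at t)) \<Longrightarrow> continuous_on A F"
  by (meson continuous_at_imp_continuous_on has_vector_derivative_continuous)

text \<open>
  The estimate for Picard iteration: integration raises the order of vanishing at \<open>c\<close> and divides by it.
\<close>

lemma primitive_bound:
  fixes F f :: "real \<Rightarrow> complex"
  assumes F: "\<And>t. (F has_vector_derivative f t) (at t)" "F c = 0"
    and f: "\<And>s. \<bar>s - c\<bar> \<le> R \<Longrightarrow> cmod (f s) \<le> K * \<bar>s - c\<bar> ^ n" and t: "\<bar>t - c\<bar> \<le> R"
  shows "cmod (F t) \<le> K * \<bar>t - c\<bar> ^ Suc n / Suc n"
proof (cases "t = c")
  case False
  define \<sigma> where "\<sigma> = sgn (t - c)"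
  have \<sigma>: "\<bar>\<sigma>\<bar> = 1" "t = c + \<sigma> * \<bar>t - c\<bar>" using False by (auto simp: \<sigma>_def sgn_if)
  have G: "((\<lambda>s. F (c + \<sigma> * s)) has_vector_derivative \<sigma> *\<^sub>R f (c + \<sigma> * s)) (at s)" for s
  proof -
    have "((\<lambda>s. c + \<sigma> * s) has_vector_derivative \<sigma>) (at s)"
      by (auto intro!: derivative_eq_intros simp: has_vector_derivative_def)
    from vector_diff_chain_at[OF this F(1)[of "c + \<sigma> * s"]] show ?thesis by (simp add: o_def)
  qed
  have H: "((\<lambda>s. K * s ^ Suc n / Suc n) has_vector_derivative K * s ^ n) (at s)" for s
    unfolding has_real_derivative_iff_has_vector_derivative[symmetric]
    by (auto intro!: derivative_eq_intros simp del: of_nat_Suc power_Suc)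
  have "norm (F (c + \<sigma> * \<bar>t - c\<bar>) - F (c + \<sigma> * 0)) \<le> K * \<bar>t - c\<bar> ^ Suc n / Suc n - K * 0 ^ Suc n / Suc n"
  proof (rule differentiable_bound_general[where f' = "\<lambda>s. \<sigma> *\<^sub>R f (c + \<sigma> * s)" and \<phi>' = "\<lambda>s. K * s ^ n"])
    show "0 < \<bar>t - c\<bar>" using False by simp
    show "continuous_on {0..\<bar>t - c\<bar>} (\<lambda>s. F (c + \<sigma> * s))" by (rule continuous_of_vd[OF G])
    show "continuous_on {0..\<bar>t - c\<bar>} (\<lambda>s. K * s ^ Suc n / Suc n)"
      by (intro continuous_intros) auto
    fix s assume s: "0 < s" "s < \<bar>t - c\<bar>"
    have "cmod (f (c + \<sigma> * s)) \<le> K * \<bar>(c + \<sigma> * s) - c\<bar> ^ n"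
      using s t \<sigma>(1) by (intro f) (simp add: abs_mult)
    then show "norm (\<sigma> *\<^sub>R f (c + \<sigma> * s)) \<le> K * s ^ n"
      using \<sigma>(1) s by (simp add: abs_mult)
    show "((\<lambda>s. F (c + \<sigma> * s)) has_vector_derivative \<sigma> *\<^sub>R f (c + \<sigma> * s)) (at s)" by (rule G)
    show "((\<lambda>s. K * s ^ Suc n / Suc n) has_vector_derivative K * s ^ n) (at s)" by (rule H)
  qed
  then show ?thesis using \<sigma>(2) F(2) by simp
qed (simp add: F)

lemma has_vector_derivative_suminf:
  fixes f f' :: "nat \<Rightarrow> real \<Rightarrow> complex"
  assumes S: "open S" "convex S" "x \<in> S"
    and d: "\<And>n t. t \<in> S \<Longrightarrow> (f n has_vector_derivative f' n t) (at t)"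
    and b: "\<And>n t. t \<in> S \<Longrightarrow> cmod (f n t) \<le> A n" "\<And>n t. t \<in> S \<Longrightarrow> cmod (f' n t) \<le> B n"
    and s: "summable A" "summable B"
  shows "((\<lambda>t. \<Sum>n. f n t) has_vector_derivative (\<Sum>n. f' n x)) (at x)"
proof -
  have U: "uniform_limit S (\<lambda>n t. \<Sum>i<n. f' i t) (\<lambda>t. \<Sum>i. f' i t) sequentially"
    using b(2) s(2) by (intro Weierstrass_m_test) auto
  have "\<exists>g. \<forall>x\<in>S. (\<lambda>n. f n x) sums g x \<and> (g has_derivative (\<lambda>h. h *\<^sub>R (\<Sum>i. f' i x))) (at x within S)"
  proof (rule has_derivative_series[where f' = "\<lambda>n t h. h *\<^sub>R f' n t" and x = x])
    show "(f n has_derivative (\<lambda>h. h *\<^sub>R f' n t)) (at t within S)" if "t \<in> S" for n t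
      using d[OF that] has_vector_derivative_at_within unfolding has_vector_derivative_def by (metis has_derivative_at_withinI)
    fix e :: real assume "e > 0"
    then have "\<forall>\<^sub>F n in sequentially. \<forall>t\<in>S. dist (\<Sum>i<n. f' i t) (\<Sum>i. f' i t) < e"
      using U by (simp add: uniform_limit_iff)
    then show "\<forall>\<^sub>F n in sequentially. \<forall>t\<in>S. \<forall>h. norm ((\<Sum>i<n. h *\<^sub>R f' i t) - h *\<^sub>R (\<Sum>i. f' i t)) \<le> e * norm h"
    proof eventually_elim
      case (elim n)
      show ?case
      proof (intro ballI allI)
        fix t h assume "t \<in> S"
        have "(\<Sum>i<n. h *\<^sub>R f' i t) - h *\<^sub>R (\<Sum>i. f' i t) = h *\<^sub>R ((\<Sum>i<n. f' i t) - (\<Sum>i. f' i t))"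
          by (simp add: scaleR_sum_right scaleR_diff_right)
        then show "norm ((\<Sum>i<n. h *\<^sub>R f' i t) - h *\<^sub>R (\<Sum>i. f' i t)) \<le> e * norm h"
          using elim[rule_format, OF \<open>t \<in> S\<close>] mult_left_mono[of "cmod ((\<Sum>i<n. f' i t) - (\<Sum>i. f' i t))" e "\<bar>h\<bar>"]
          by (simp add: dist_norm mult.commute[of e])
      qed
    qed
  next
    show "(\<lambda>n. f n x) sums (\<Sum>n. f n x)"
      by (rule summable_sums, rule summable_comparison_test'[OF s(1), of 0]) (rule b(1)[OF S(3)])
  qed (fact S)+
  then obtain g where g: "\<And>x. x \<in> S \<Longrightarrow> (\<lambda>n. f n x) sums g x"
    "\<And>x. x \<in> S \<Longrightarrow> (g has_derivative (\<lambda>h. h *\<^sub>R (\<Sum>i. f' i x))) (at x within S)" by blast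
  have "(g has_vector_derivative (\<Sum>i. f' i x)) (at x)"
    using g(2)[OF S(3)] unfolding has_vector_derivative_def at_within_open[OF S(3) S(1)] .
  then show ?thesis
    by (rule has_vector_derivative_transform_within_open[OF _ S(1) S(3)]) (simp add: sums_unique[OF g(1)])
qed

text \<open>
  Existence on the whole line by Picard iteration. The iterates \<open>Y n\<close> and their derivatives \<open>V n\<close> solve
  \<open>Y 0'' = g\<close> with the given initial data and \<open>Y (n+1)'' = Q Y n\<close> with zero data. On each bounded interval they are
  dominated by the terms of an exponential series, so that \<open>\<Sum>n. Y n\<close> can be differentiated twice
  term by term.
\<close>

lemma linear_ode_exists:
  fixes Q g :: "real \<Rightarrow> complex"
  assumes Q: "continuous_on UNIV Q" and g: "continuous_on UNIV g"
  shows "\<exists>y v. y c = a \<and> v c = b \<and> (\<forall>t. (y has_vector_derivative v t) (at t)) \<and>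
     (\<forall>t. (v has_vector_derivative Q t * y t + g t) (at t))"
proof -
  define V0 where "V0 t = b + primitive c g t" for t
  have V0': "(V0 has_vector_derivative g t) (at t)" for t
    unfolding V0_def using has_vector_derivative_add[OF has_vector_derivative_const primitive(2)[OF g]] by simp
  have V0c: "V0 c = b" by (simp add: V0_def primitive[OF g])
  have cV0: "continuous_on A V0" for A by (rule continuous_of_vd[OF V0'])
  define Y0 where "Y0 t = a + primitive c V0 t" for t
  have Y0': "(Y0 has_vector_derivative V0 t) (at t)" for t
    unfolding Y0_def using has_vector_derivative_add[OF has_vector_derivative_const primitive(2)[OF cV0]] by simp
  have Y0c: "Y0 c = a" by (simp add: Y0_def primitive[OF cV0])
  have cY0: "continuous_on A Y0" for A by (rule continuous_of_vd[OF Y0'])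
  define V1 where "V1 y = primitive c (\<lambda>t. Q t * y t)" for y
  define Y where "Y n = ((\<lambda>y. primitive c (V1 y)) ^^ n) Y0" for n
  define V where "V n = (case n of 0 \<Rightarrow> V0 | Suc m \<Rightarrow> V1 (Y m))" for n
  have V1': "(V1 y has_vector_derivative Q t * y t) (at t)" "V1 y c = 0" if "continuous_on UNIV y" for y t
    unfolding V1_def by (intro primitive continuous_intros Q that)+
  have cV1: "continuous_on UNIV (V1 y)" if "continuous_on UNIV y" for y
    by (rule continuous_of_vd[OF V1'(1)[OF that]])
  have Y_Suc: "Y (Suc n) = primitive c (V (Suc n))" for n by (simp add: Y_def V_def)
  have cY: "continuous_on UNIV (Y n)" for n
  proof (induction n)
    case 0 show ?case by (simp add: Y_def cY0)
  next
    case (Suc n)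
    have "continuous_on UNIV (V (Suc n))" using cV1[OF Suc] by (simp add: V_def)
    from primitive(2)[OF this] show ?case unfolding Y_Suc by (rule continuous_of_vd)
  qed
  have cV: "continuous_on UNIV (V n)" for n by (cases n) (auto simp: V_def cV0 cV1 cY)
  have Y': "(Y n has_vector_derivative V n t) (at t)" for n t
  proof (cases n)
    case 0 then show ?thesis using Y0' by (simp add: Y_def V_def)
  next
    case (Suc m)
    then show ?thesis using primitive(2)[OF cV] by (simp add: Y_Suc)
  qed
  define dV where "dV n = (case n of 0 \<Rightarrow> g | Suc m \<Rightarrow> (\<lambda>t. Q t * Y m t))" for n
  have V': "(V n has_vector_derivative dV n t) (at t)" for n t
    by (cases n) (auto simp: V_def dV_def V0' V1' cY)
  have Yc: "Y (Suc n) c = 0" "V (Suc n) c = 0" for n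
    using primitive(1)[OF cV] V1'(2)[OF cY] by (simp_all add: Y_Suc) (simp add: V_def)
  define y where "y t = (\<Sum>n. Y n t)" for t
  define v where "v t = (\<Sum>n. V n t)" for t
  have main: "(y has_vector_derivative v t) (at t) \<and> (v has_vector_derivative Q t * y t + g t) (at t)" for t
  proof -
    define R where "R = \<bar>t - c\<bar> + 1"
    have R: "R \<ge> 1" "t \<in> {c - R<..<c + R}" by (auto simp: R_def)
    have bdd: "\<exists>B\<ge>1. \<forall>s. \<bar>s - c\<bar> \<le> R \<longrightarrow> cmod (h s) \<le> B" if "continuous_on UNIV h" for h :: "real \<Rightarrow> complex"
    proof -
      have "compact (h ` {c - R..c + R})"
        using that by (intro compact_continuous_image) (auto intro: continuous_on_subset)
      then obtain B where "\<And>s. s \<in> {c - R..c + R} \<Longrightarrow> cmod (h s) \<le> B"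
        using compact_imp_bounded bounded_iff by (metis imageI)
      then show ?thesis by (intro exI[of _ "max 1 B"]) (auto simp: abs_le_iff le_max_iff_disj)
    qed
    obtain M where M: "M \<ge> 1" "\<And>s. \<bar>s - c\<bar> \<le> R \<Longrightarrow> cmod (Q s) \<le> M" using bdd[OF Q] by blast
    obtain C1 C2 C3 where "C1 \<ge> 1" "\<And>s. \<bar>s - c\<bar> \<le> R \<Longrightarrow> cmod (Y0 s) \<le> C1"
      "C2 \<ge> 1" "\<And>s. \<bar>s - c\<bar> \<le> R \<Longrightarrow> cmod (V0 s) \<le> C2"
      "C3 \<ge> 1" "\<And>s. \<bar>s - c\<bar> \<le> R \<Longrightarrow> cmod (g s) \<le> C3"
      using bdd[OF cY0] bdd[OF cV0] bdd[OF g] by blast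
    then obtain C where C: "C \<ge> 1" "\<And>s. \<bar>s - c\<bar> \<le> R \<Longrightarrow> cmod (Y0 s) \<le> C"
      "\<And>s. \<bar>s - c\<bar> \<le> R \<Longrightarrow> cmod (V0 s) \<le> C" "\<And>s. \<bar>s - c\<bar> \<le> R \<Longrightarrow> cmod (g s) \<le> C"
      using that[of "max C1 (max C2 C3)"] by (simp add: le_max_iff_disj)
    \<comment> \<open>Powers of \<open>L\<close> dominate both integrations of each step: \<open>Q\<close> costs \<open>M\<close>, the second integration costs \<open>R\<close>.\<close>
    define L where "L = M * R"
    have L: "L \<ge> M" "L \<ge> 0" using M(1) R(1) by (auto simp: L_def mult_le_cancel_left1)
    have bd: "cmod (V n s) \<le> C * L ^ n * \<bar>s - c\<bar> ^ n / fact n \<and> cmod (Y n s) \<le> C * L ^ n * \<bar>s - c\<bar> ^ n / fact n"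
      if "\<bar>s - c\<bar> \<le> R" for n s
      using that
    proof (induction n arbitrary: s)
      case 0
      then show ?case using C by (simp add: V_def Y_def)
    next
      case (Suc n)
      have V1: "cmod (V (Suc n) s) \<le> M * (C * L ^ n / fact n) * \<bar>s - c\<bar> ^ Suc n / Suc n" if "\<bar>s - c\<bar> \<le> R" for s
      proof (rule primitive_bound[OF V' Yc(2) _ that])
        fix s assume s: "\<bar>s - c\<bar> \<le> R"
        have "cmod (Q s) * cmod (Y n s) \<le> M * (C * L ^ n * \<bar>s - c\<bar> ^ n / fact n)"
          using M s Suc.IH[OF s] by (intro mult_mono) auto
        then show "cmod (dV (Suc n) s) \<le> M * (C * L ^ n / fact n) * \<bar>s - c\<bar> ^ n"
          by (simp add: dV_def norm_mult)
      qed
      have nn: "0 \<le> C * L ^ n / fact n" using C(1) L(2) by simp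
      have nnM: "0 \<le> M * (C * L ^ n / fact n)" using nn M(1) by (intro mult_nonneg_nonneg) auto
      have "cmod (V (Suc n) s) \<le> M * (C * L ^ n / fact n) * \<bar>s - c\<bar> ^ Suc n / Suc n" by (rule V1[OF Suc.prems])
      also have "\<dots> \<le> L * (C * L ^ n / fact n) * \<bar>s - c\<bar> ^ Suc n / Suc n"
        using L(1) nn by (intro divide_right_mono mult_right_mono) auto
      also have "\<dots> = C * L ^ Suc n * \<bar>s - c\<bar> ^ Suc n / fact (Suc n)" by (simp add: mult_ac)
      finally have 1: "cmod (V (Suc n) s) \<le> C * L ^ Suc n * \<bar>s - c\<bar> ^ Suc n / fact (Suc n)" .
      have "cmod (Y (Suc n) s) \<le> M * (C * L ^ n / fact n) * \<bar>s - c\<bar> ^ Suc n / Suc n * \<bar>s - c\<bar> ^ Suc 0 / Suc 0"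
      proof (rule primitive_bound[OF Y' Yc(1), where R = "\<bar>s - c\<bar>"])
        fix r assume r: "\<bar>r - c\<bar> \<le> \<bar>s - c\<bar>"
        have "cmod (V (Suc n) r) \<le> M * (C * L ^ n / fact n) * \<bar>r - c\<bar> ^ Suc n / Suc n"
          using r Suc.prems by (intro V1) simp
        also have "\<dots> \<le> M * (C * L ^ n / fact n) * \<bar>s - c\<bar> ^ Suc n / Suc n"
          using r by (intro divide_right_mono mult_left_mono power_mono nnM) auto
        finally show "cmod (V (Suc n) r) \<le> M * (C * L ^ n / fact n) * \<bar>s - c\<bar> ^ Suc n / Suc n * \<bar>r - c\<bar> ^ 0" by simp
      qed simp
      also have "\<dots> \<le> M * (C * L ^ n / fact n) * \<bar>s - c\<bar> ^ Suc n / Suc n * R"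
      proof -
        have "M * (C * L ^ n / fact n) * \<bar>s - c\<bar> ^ Suc n / Suc n * \<bar>s - c\<bar> \<le> M * (C * L ^ n / fact n) * \<bar>s - c\<bar> ^ Suc n / Suc n * R"
          using Suc.prems nnM by (intro mult_left_mono divide_nonneg_nonneg mult_nonneg_nonneg[OF nnM]) auto
        then show ?thesis by simp
      qed
      also have "\<dots> = C * L ^ Suc n * \<bar>s - c\<bar> ^ Suc n / fact (Suc n)" by (simp add: mult_ac L_def)
      finally show ?case using 1 by simp
    qed
    define B where "B n = C * ((L * R) ^ n / fact n)" for n
    have bd2: "cmod (V n s) \<le> B n" "cmod (Y n s) \<le> B n" if "s \<in> {c - R<..<c + R}" for n s
    proof -
      have s: "\<bar>s - c\<bar> \<le> R" using that by auto
      have "C * L ^ n * \<bar>s - c\<bar> ^ n / fact n \<le> C * L ^ n * R ^ n / fact n"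
        using C(1) L(2) s by (intro divide_right_mono mult_left_mono power_mono) auto
      also have "\<dots> = B n" by (simp add: B_def power_mult_distrib)
      finally show "cmod (V n s) \<le> B n" "cmod (Y n s) \<le> B n" using bd[OF s, of n] by linarith+
    qed
    have sB: "summable B"
      unfolding B_def using summable_exp_generic[of "L * R"] by (intro summable_mult) (simp add: divide_inverse mult.commute)
    define B' where "B' n = (case n of 0 \<Rightarrow> C | Suc m \<Rightarrow> M * B m)" for n
    have sB': "summable B'"
      by (subst summable_Suc_iff[symmetric]) (simp add: B'_def sB summable_mult)
    have bd': "cmod (dV n s) \<le> B' n" if "s \<in> {c - R<..<c + R}" for n s
    proof (cases n)
      case 0
      have "\<bar>s - c\<bar> \<le> R" using that by auto
      then show ?thesis using C(4) 0 by (simp add: dV_def B'_def)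
    next
      case (Suc m)
      have "cmod (Q s) * cmod (Y m s) \<le> M * B m"
        using bd2[OF that] M that by (intro mult_mono) (auto simp: abs_le_iff)
      then show ?thesis using Suc by (simp add: dV_def B'_def norm_mult)
    qed
    have "(y has_vector_derivative v t) (at t)"
      unfolding y_def v_def
      by (rule has_vector_derivative_suminf[where S = "{c - R<..<c + R}" and A = B and B = B])
         (use R bd2 Y' sB in auto)
    moreover have "(v has_vector_derivative (\<Sum>n. dV n t)) (at t)"
      unfolding v_def
      by (rule has_vector_derivative_suminf[where S = "{c - R<..<c + R}" and A = B and B = B'])
         (use R bd2 bd' V' sB sB' in auto)
    moreover have "(\<Sum>n. dV n t) = Q t * y t + g t"
    proof -
      have sd: "summable (\<lambda>n. dV n t)"
        using bd'[OF R(2)] by (intro summable_comparison_test'[OF sB', of 0]) auto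
      have sy: "summable (\<lambda>n. Y n t)"
        using bd2[OF R(2)] by (intro summable_comparison_test'[OF sB, of 0]) auto
      have "(\<Sum>n. dV n t) = (\<Sum>n. dV (Suc n) t) + dV 0 t"
        using suminf_split_head[OF sd] by simp
      then show ?thesis by (simp add: dV_def y_def suminf_mult[OF sy])
    qed
    ultimately show ?thesis by simp
  qed
  have "y c = a" "v c = b"
  proof -
    have "(\<lambda>n. Y n c) sums (\<Sum>n<1. Y n c)" "(\<lambda>n. V n c) sums (\<Sum>n<1. V n c)"
      by (rule sums_finite; use Yc in \<open>auto simp: Yc gr0_conv_Suc not_less dest!: Suc_le_D\<close>)+
    then show "y c = a" "v c = b"
      unfolding y_def v_def using Y0c V0c by (auto simp: sums_iff Y_def V_def)
  qed
  then show ?thesis using main by blast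
qed


lemma inner_has_vd:
  fixes u v :: "real \<Rightarrow> complex"
  assumes "(u has_vector_derivative u') (at t)" "(v has_vector_derivative v') (at t)"
  shows "((\<lambda>t. u t \<bullet> v t) has_vector_derivative (u t \<bullet> v' + u' \<bullet> v t)) (at t)"
  using has_derivative_inner[OF assms[unfolded has_vector_derivative_def]]
  by (simp add: has_vector_derivative_def distrib_left)

section \<open>The Dirichlet problem and cutoffs\<close>

text \<open>
  Shooting from \<open>-N\<close>: add to a particular solution \<open>w\<close> a multiple of the homogeneous solution \<open>h\<close> with
  \<open>h (-N) = 0\<close>, \<open>h' (-N) = 1\<close>. This needs \<open>h N \<noteq> 0\<close>, which holds because \<open>h \<bullet> h'\<close> has the derivative
  \<open>q |h|\<^sup>2 + |h'|\<^sup>2 \<ge> 0\<close> and increases strictly at \<open>-N\<close>.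
\<close>

lemma dirichlet_problem:
  fixes q :: "real \<Rightarrow> real" and g :: "real \<Rightarrow> complex"
  assumes q: "continuous_on UNIV q" "\<And>t. q t \<ge> 1" and g: "continuous_on UNIV g" and N: "N > 0"
  shows "\<exists>u v. u (-N) = 0 \<and> u N = 0 \<and> (\<forall>t. (u has_vector_derivative v t) (at t)) \<and>
     (\<forall>t. (v has_vector_derivative of_real (q t) * u t - g t) (at t))"
proof -
  have Q: "continuous_on UNIV (\<lambda>t. complex_of_real (q t))" by (intro continuous_intros q)
  obtain w z where w: "w (-N) = 0" "\<And>t. (w has_vector_derivative z t) (at t)"
    "\<And>t. (z has_vector_derivative of_real (q t) * w t + - g t) (at t)"
    using linear_ode_exists[OF Q continuous_on_minus[OF g], of "-N" 0 0] by auto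
  obtain h k :: "real \<Rightarrow> complex" where h: "h (-N) = 0" "k (-N) = 1" "\<And>t. (h has_vector_derivative k t) (at t)"
    "\<And>t. (k has_vector_derivative of_real (q t) * h t) (at t)"
    using linear_ode_exists[OF Q continuous_on_const[of UNIV 0], of "-N" 0 1] by auto
  \<comment> \<open>If \<open>h N = 0\<close>, then \<open>e = h \<bullet> h'\<close> would vanish at both ends, be nondecreasing, and be positive just right of \<open>-N\<close>.\<close>
  have hN: "h N \<noteq> 0"
  proof
    assume hN: "h N = 0"
    define e where "e t = h t \<bullet> k t" for t
    define e' where "e' t = h t \<bullet> (of_real (q t) * h t) + k t \<bullet> k t" for t
    have e: "(e has_real_derivative e' t) (at t)" for t
      unfolding e_def e'_def has_real_derivative_iff_has_vector_derivative by (rule inner_has_vd[OF h(3,4)])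
    have nn: "e' t \<ge> 0" for t
    proof -
      have "h t \<bullet> (of_real (q t) * h t) = q t * (h t \<bullet> h t)" by (simp flip: scaleR_conv_of_real)
      moreover have "\<dots> \<ge> 0" using q(2)[of t] by (intro mult_nonneg_nonneg) auto
      ultimately show ?thesis unfolding e'_def by simp
    qed
    have "e' (-N) > 0" by (simp add: e'_def h)
    then obtain d where d: "d > 0" "\<And>s. s > 0 \<Longrightarrow> s < d \<Longrightarrow> e (-N) < e (-N + s)"
      using DERIV_pos_inc_right[OF e] by blast
    define s where "s = min (d / 2) N"
    have s: "0 < s" "s < d" "s \<le> N" using d N by (auto simp: s_def)
    have "e (-N + s) \<le> e N"
    proof (rule DERIV_nonneg_imp_nondecreasing[where f = e])
      show "-N + s \<le> N" using s N by simp
      fix x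
      show "\<exists>y. (e has_real_derivative y) (at x) \<and> 0 \<le> y" using e[of x] nn[of x] by blast
    qed
    then show False using d(2)[OF s(1,2)] hN by (simp add: e_def h)
  qed
  define c where "c = w N / h N"
  have 1: "((\<lambda>t. w t - c * h t) has_vector_derivative z t - c * k t) (at t)" for t
    using has_vector_derivative_diff[OF w(2) has_vector_derivative_mult_right[OF h(3), of c]] .
  have 2: "((\<lambda>t. z t - c * k t) has_vector_derivative of_real (q t) * (w t - c * h t) - g t) (at t)" for t
  proof -
    have eq: "of_real (q t) * w t + - g t - c * (of_real (q t) * h t) = of_real (q t) * (w t - c * h t) - g t"
      by (simp add: algebra_simps)
    show ?thesis
      using has_vector_derivative_diff[OF w(3)[of t] has_vector_derivative_mult_right[OF h(4)[of t], of c]]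
      unfolding eq .
  qed
  have 3: "w (-N) - c * h (-N) = 0" "w N - c * h N = 0" using hN by (simp_all add: w(1) h(1) c_def)
  show ?thesis
    by (intro exI[of _ "\<lambda>t. w t - c * h t"] exI[of _ "\<lambda>t. z t - c * k t"] conjI allI 1 2 3)
qed

lemma set_integrable_Icc:
  fixes f :: "real \<Rightarrow> real"
  assumes "continuous_on UNIV f"
  shows "integrable lborel (\<lambda>t. indicator {a..b} t * f t)"
  using borel_integrable_atLeastAtMost'[of a b f] assms
  by (auto simp: set_integrable_def intro: continuous_on_subset)

text \<open>
  Testing the equation with \<open>u\<close> itself gives \<open>\<integral>|u'|\<^sup>2 + q |u|\<^sup>2 = \<integral>g \<bullet> u\<close>. The bound does not depend on
  \<open>N\<close>, which is what allows the solutions to be cut off.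
\<close>

lemma dirichlet_energy_bound:
  fixes q :: "real \<Rightarrow> real" and g u v :: "real \<Rightarrow> complex"
  assumes q: "continuous_on UNIV q" "\<And>t. q t \<ge> 1" and g: "continuous_on UNIV g" and N: "N > 0"
    and u: "u (-N) = 0" "u N = 0" "\<And>t. (u has_vector_derivative v t) (at t)"
    and v: "\<And>t. (v has_vector_derivative of_real (q t) * u t - g t) (at t)"
  shows "(LINT t|lborel. indicator {-N..N} t * ((cmod (v t))\<^sup>2 + (cmod (u t))\<^sup>2))
       \<le> (LINT t|lborel. indicator {-N..N} t * (cmod (g t))\<^sup>2)"
proof -
  have cu: "continuous_on UNIV u" by (rule continuous_of_vd[OF u(3)])
  have cv: "continuous_on UNIV v" by (rule continuous_of_vd[OF v])
  define e' where "e' t = u t \<bullet> (of_real (q t) * u t - g t) + v t \<bullet> v t" for t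
  have ce: "continuous_on UNIV e'" unfolding e'_def by (intro continuous_intros cu cv q g)
  have "has_bochner_integral lborel (\<lambda>t. indicator {-N..N} t *\<^sub>R e' t) (u N \<bullet> v N - u (-N) \<bullet> v (-N))"
    using N ce inner_has_vd[OF u(3) v] unfolding e'_def
    by (intro has_bochner_integral_FTC_Icc[where F = "\<lambda>t. u t \<bullet> v t"])
       (auto intro: has_vector_derivative_at_within continuous_on_subset simp: e'_def)
  then have e0: "(LINT t|lborel. indicator {-N..N} t * e' t) = 0"
    by (simp add: has_bochner_integral_iff u)
  have pw: "(cmod (v t))\<^sup>2 + (cmod (u t))\<^sup>2 \<le> 2 * e' t + (cmod (g t))\<^sup>2" for t
  proof -
    have "0 \<le> (u t - g t) \<bullet> (u t - g t)" by simp
    also have "\<dots> = (cmod (u t))\<^sup>2 - 2 * (u t \<bullet> g t) + (cmod (g t))\<^sup>2"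
      by (simp add: inner_diff_left inner_diff_right inner_commute power2_norm_eq_inner)
    finally have 1: "2 * (u t \<bullet> g t) \<le> (cmod (u t))\<^sup>2 + (cmod (g t))\<^sup>2" by simp
    have 2: "e' t = q t * (cmod (u t))\<^sup>2 - u t \<bullet> g t + (cmod (v t))\<^sup>2"
      by (simp add: e'_def inner_diff_right power2_norm_eq_inner flip: scaleR_conv_of_real)
    have 3: "1 * (cmod (u t))\<^sup>2 \<le> q t * (cmod (u t))\<^sup>2" by (intro mult_right_mono q) simp
    have "0 \<le> (cmod (v t))\<^sup>2" by simp
    then show ?thesis using 1 2 3 by linarith
  qed
  have "(LINT t|lborel. indicator {-N..N} t * ((cmod (v t))\<^sup>2 + (cmod (u t))\<^sup>2))
      \<le> (LINT t|lborel. 2 * (indicator {-N..N} t * e' t) + indicator {-N..N} t * (cmod (g t))\<^sup>2)"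
  proof (rule integral_mono)
    show "indicator {-N..N} t * ((cmod (v t))\<^sup>2 + (cmod (u t))\<^sup>2)
      \<le> 2 * (indicator {-N..N} t * e' t) + indicator {-N..N} t * (cmod (g t))\<^sup>2" for t
      using pw[of t] by (simp add: indicator_def)
  qed (intro Bochner_Integration.integrable_add integrable_mult_right set_integrable_Icc continuous_intros cu cv ce g)+
  also have "\<dots> = 2 * (LINT t|lborel. indicator {-N..N} t * e' t) + (LINT t|lborel. indicator {-N..N} t * (cmod (g t))\<^sup>2)"
    by (subst Bochner_Integration.integral_add)
       (intro integrable_mult_right set_integrable_Icc continuous_intros ce g | simp)+
  finally show ?thesis using e0 by simp
qed

text \<open>
  Cutoffs \<open>step (2 - t/R) * step (2 + t/R)\<close>. One constant \<open>D\<close> serves for all \<open>R\<close>, as each derivative produces a factor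
  \<open>1/R\<close>.
\<close>

lemma cutoff_exists:
  "\<exists>D\<ge>0. \<forall>R\<ge>1. \<exists>\<eta>. smooth \<eta> \<and> (\<forall>t. \<bar>t\<bar> \<le> R \<longrightarrow> \<eta> t = 1) \<and> (\<forall>t. \<bar>t\<bar> > 2 * R \<longrightarrow> \<eta> t = 0) \<and>
     (\<forall>t. cmod (vd \<eta> t) \<le> D / R \<and> cmod (vd (vd \<eta>) t) \<le> D / R)"
proof -
  define \<theta> where "\<theta> t = complex_of_real (step t)" for t
  have sm: "smooth \<theta>" "smooth (vd \<theta>)" "smooth (vd (vd \<theta>))"
    unfolding \<theta>_def[abs_def] by (intro smooth_vd smooth_step)+
  have \<theta>: "cmod (\<theta> t) \<le> 1" for t using step_bounds[of t] by (simp add: \<theta>_def)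
  have zero: "vd \<theta> t = 0" if "\<bar>t\<bar> > 1" for t
  proof (rule vector_derivative_at)
    have "(\<theta> has_vector_derivative 0) (at t)" if "t > 1"
      by (rule has_vector_derivative_transform_within_open[OF has_vector_derivative_const[of 1], of "{1<..}"])
         (use that in \<open>auto simp: \<theta>_def step_eq_1\<close>)
    moreover have "(\<theta> has_vector_derivative 0) (at t)" if "t < -1"
      by (rule has_vector_derivative_transform_within_open[OF has_vector_derivative_const[of 0], of "{..<-1}"])
         (use that in \<open>auto simp: \<theta>_def step_eq_0\<close>)
    ultimately show "(\<theta> has_vector_derivative 0) (at t)" using that by linarith
  qed
  have zero2: "vd (vd \<theta>) t = 0" if "\<bar>t\<bar> > 1" for t by (rule vd_eq_0[OF zero that])
  have bdd: "\<exists>B\<ge>0. \<forall>t. cmod (f t) \<le> B" if f: "smooth f" "\<And>t. \<bar>t\<bar> > 1 \<Longrightarrow> f t = 0" for f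
  proof -
    have "compact (f ` {-1..1})" by (intro compact_continuous_image smooth_continuous f) auto
    then obtain B where B: "\<And>s. s \<in> {-1..1} \<Longrightarrow> cmod (f s) \<le> B"
      using compact_imp_bounded bounded_iff by (metis imageI)
    have "cmod (f t) \<le> max 0 B" for t
    proof (cases "\<bar>t\<bar> > 1")
      case False
      then show ?thesis using B[of t] by (fastforce simp: abs_le_iff le_max_iff_disj)
    qed (simp add: f)
    then show ?thesis by (intro exI[of _ "max 0 B"]) simp
  qed
  obtain B1 where B1: "B1 \<ge> 0" "\<And>t. cmod (vd \<theta> t) \<le> B1" using bdd[OF sm(2) zero] by blast
  obtain B2 where B2: "B2 \<ge> 0" "\<And>t. cmod (vd (vd \<theta>) t) \<le> B2"
    using bdd[OF sm(3)] zero2 by metis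
  \<comment> \<open>The first derivative has two terms \<open>\<theta>\<close> times \<open>\<theta>'\<close>; the second has \<open>\<theta>\<close> times \<open>\<theta>''\<close> twice and \<open>\<theta>'\<close> times \<open>\<theta>'\<close> twice.\<close>
  define D where "D = 2 * B1 + 2 * B2 + 2 * B1\<^sup>2"
  show ?thesis
  proof (intro exI[of _ D] conjI allI impI)
    show "0 \<le> D" using B1 B2 by (simp add: D_def)
    fix R :: real assume R: "R \<ge> 1"
    define r where "r = 1 / R"
    have r: "0 < r" "r \<le> 1" "r * r \<le> r" using R by (auto simp: r_def field_simps)
    define a where "a t = \<theta> (2 + (-r) * t)" for t
    define b where "b t = \<theta> (2 + r * t)" for t
    have sab: "smooth a" "smooth b" unfolding a_def[abs_def] b_def[abs_def] by (intro smooth_affine_comp sm)+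
    define a' where "a' t = of_real (-r) * vd \<theta> (2 + (-r) * t)" for t
    define b' where "b' t = of_real r * vd \<theta> (2 + r * t)" for t
    define a'' where "a'' t = of_real (-r) * (of_real (-r) * vd (vd \<theta>) (2 + (-r) * t))" for t
    define b'' where "b'' t = of_real r * (of_real r * vd (vd \<theta>) (2 + r * t))" for t
    have sab': "smooth a'" "smooth b'" unfolding a'_def[abs_def] b'_def[abs_def]
      by (intro smooth_mult smooth_const smooth_affine_comp sm)+
    have da_fun: "vd a = a'" "vd b = b'" unfolding a_def[abs_def] b_def[abs_def] a'_def[abs_def] b'_def[abs_def]
      by (rule ext, rule vd_affine[OF sm(1)])+
    have da: "vd a t = a' t" "vd b t = b' t" for t using da_fun by metis+
    have da'_fun: "vd a' = a''" "vd b' = b''"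
      unfolding a'_def[abs_def] b'_def[abs_def] a''_def[abs_def] b''_def[abs_def]
      by (rule ext, simp only: vd_cmult[OF smooth_affine_comp[OF sm(2)]] vd_affine[OF sm(2)])+
    have da': "vd a' t = a'' t" "vd b' t = b'' t" for t using da'_fun by metis+
    have 1: "vd (\<lambda>t. a t * b t) = (\<lambda>t. a t * b' t + a' t * b t)"
      by (rule ext) (simp only: vd_mult[OF sab] da)
    have 2: "vd (\<lambda>t. a t * b' t + a' t * b t) t = (a t * b'' t + a' t * b' t) + (a' t * b' t + a'' t * b t)" for t
      by (simp only: vd_add[OF smooth_mult[OF sab(1) sab'(2)] smooth_mult[OF sab'(1) sab(2)]]
        vd_mult[OF sab(1) sab'(2)] vd_mult[OF sab'(1) sab(2)] da da')
    have na: "cmod (a t) \<le> 1" "cmod (b t) \<le> 1" for t by (auto simp: a_def b_def \<theta>)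
    have na': "cmod (a' t) \<le> r * B1" "cmod (b' t) \<le> r * B1" for t
      using r B1 by (auto simp: a'_def b'_def norm_mult intro!: mult_left_mono)
    have na'': "cmod (a'' t) \<le> r * r * B2" "cmod (b'' t) \<le> r * r * B2" for t
      using r B2 by (auto simp: a''_def b''_def norm_mult mult.assoc intro!: mult_left_mono)
    have rB: "0 \<le> r * B1" "0 \<le> r * r * B2" using r B1 B2 by simp_all
    have D1: "cmod (a t * b' t + a' t * b t) \<le> D / R" for t
    proof -
      have "cmod (a t * b' t + a' t * b t) \<le> cmod (a t) * cmod (b' t) + cmod (a' t) * cmod (b t)"
        using norm_triangle_ineq[of "a t * b' t" "a' t * b t"] by (simp add: norm_mult)
      also have "\<dots> \<le> 1 * (r * B1) + (r * B1) * 1"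
        using rB by (intro add_mono mult_mono na na') auto
      also have "\<dots> = r * (2 * B1)" by simp
      also have "\<dots> \<le> r * D" using r B2 by (intro mult_left_mono) (auto simp: D_def)
      finally show ?thesis by (simp add: r_def)
    qed
    have D2: "cmod ((a t * b'' t + a' t * b' t) + (a' t * b' t + a'' t * b t)) \<le> D / R" for t
    proof -
      have "cmod ((a t * b'' t + a' t * b' t) + (a' t * b' t + a'' t * b t))
          \<le> (cmod (a t) * cmod (b'' t) + cmod (a' t) * cmod (b' t)) + (cmod (a' t) * cmod (b' t) + cmod (a'' t) * cmod (b t))"
        by (simp only: norm_mult[symmetric]) (intro order.trans[OF norm_triangle_ineq] add_mono order_refl norm_triangle_ineq)
      also have "\<dots> \<le> (1 * (r * r * B2) + (r * B1) * (r * B1)) + ((r * B1) * (r * B1) + (r * r * B2) * 1)"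
        using rB by (intro add_mono mult_mono na na' na'') auto
      also have "\<dots> = (r * r) * (2 * B2 + 2 * B1\<^sup>2)" by (simp add: algebra_simps power2_eq_square)
      also have "\<dots> \<le> r * D" using r B1 B2 by (intro mult_mono) (auto simp: D_def)
      finally show ?thesis by (simp add: r_def)
    qed
    show "\<exists>\<eta>. smooth \<eta> \<and> (\<forall>t. \<bar>t\<bar> \<le> R \<longrightarrow> \<eta> t = 1) \<and> (\<forall>t. \<bar>t\<bar> > 2 * R \<longrightarrow> \<eta> t = 0) \<and>
     (\<forall>t. cmod (vd \<eta> t) \<le> D / R \<and> cmod (vd (vd \<eta>) t) \<le> D / R)"
    proof (intro exI[of _ "\<lambda>t. a t * b t"] conjI allI impI)
      show "smooth (\<lambda>t. a t * b t)" by (intro smooth_mult sab)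
      show "a t * b t = 1" if "\<bar>t\<bar> \<le> R" for t
      proof -
        have "\<bar>r * t\<bar> \<le> 1" using that R by (simp add: r_def abs_mult field_simps)
        then show ?thesis by (auto simp: a_def b_def \<theta>_def step_eq_1)
      qed
      show "a t * b t = 0" if "\<bar>t\<bar> > 2 * R" for t
      proof -
        have "\<bar>r * t\<bar> > 2" using that R by (simp add: r_def abs_mult field_simps)
        then show ?thesis by (auto simp: a_def b_def \<theta>_def step_eq_0 abs_if split: if_splits)
      qed
      show "cmod (vd (\<lambda>t. a t * b t) t) \<le> D / R" for t
        using D1[of t] by (simp only: vd_mult[OF sab] da)
      show "cmod (vd (vd (\<lambda>t. a t * b t)) t) \<le> D / R" for t
        unfolding 1 using D2[of t] by (simp only: 2)
    qed
  qed
qed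

section \<open>Range of the operator for large potentials\<close>

definition schroedinger :: "(real \<Rightarrow> real) \<Rightarrow> (real \<Rightarrow> complex) \<Rightarrow> real \<Rightarrow> complex" where
  "schroedinger V u t = - vd (vd u) t + of_real (V t) * u t"

text \<open>
  Solve the Dirichlet problem for the right-hand side \<open>g\<close> on \<open>[-2R, 2R]\<close> and multiply the solution \<open>u\<close> by a
  cutoff \<open>\<eta>\<close> that is \<open>1\<close> on the support of \<open>g\<close>. The error \<open>- 2 \<eta>' u' - \<eta>'' u\<close> is
  \<open>O(1/R)\<close> in norm by the uniform energy bound.
\<close>

lemma range_dense_positive:
  assumes V: "smooth (\<lambda>t. of_real (V t))" "\<And>t. V t \<ge> 1" and g: "g \<in> test_functions" and e: "e > 0"
  shows "\<exists>\<phi>\<in>test_functions. L2_norm (\<lambda>t. schroedinger V \<phi> t - g t) < e"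
proof -
  obtain D where D: "D \<ge> 0" "\<And>R. R \<ge> 1 \<Longrightarrow> \<exists>\<eta>. smooth \<eta> \<and> (\<forall>t. \<bar>t\<bar> \<le> R \<longrightarrow> \<eta> t = 1) \<and> (\<forall>t. \<bar>t\<bar> > 2 * R \<longrightarrow> \<eta> t = 0) \<and>
     (\<forall>t. cmod (vd \<eta> t) \<le> D / R \<and> cmod (vd (vd \<eta>) t) \<le> D / R)"
    using cutoff_exists by blast
  obtain K where K: "\<And>t. \<bar>t\<bar> > K \<Longrightarrow> g t = 0" using g test_functions_iff by auto
  have gs: "smooth g" using g by (rule test_smooth)
  have cV: "continuous_on UNIV V" by (rule smooth_real_continuous[OF V(1)])
  define G where "G = L2_norm g"
  \<comment> \<open>Large enough for the cutoff to equal \<open>1\<close> on the support of \<open>g\<close> and for the error \<open>3 D G / R\<close> to be below \<open>e\<close>.\<close>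
  define R where "R = max 1 (max K (3 * D * (G + 1) / e))"
  have R: "R \<ge> 1" "R \<ge> K" "R \<ge> 3 * D * (G + 1) / e" by (auto simp: R_def)
  obtain \<eta> where \<eta>: "smooth \<eta>" "\<And>t. \<bar>t\<bar> \<le> R \<Longrightarrow> \<eta> t = 1" "\<And>t. \<bar>t\<bar> > 2 * R \<Longrightarrow> \<eta> t = 0"
     "\<And>t. cmod (vd \<eta> t) \<le> D / R" "\<And>t. cmod (vd (vd \<eta>) t) \<le> D / R" using D(2)[OF R(1)] by blast
  define N where "N = 2 * R"
  have N: "N > 0" using R by (simp add: N_def)
  obtain u v where uv: "u (-N) = 0" "u N = 0" "\<And>t. (u has_vector_derivative v t) (at t)"
     "\<And>t. (v has_vector_derivative of_real (V t) * u t - g t) (at t)"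
    using dirichlet_problem[OF cV V(2) smooth_continuous[OF gs] N] by blast
  have su: "smooth u"
    by (rule smooth_ode[OF V(1) smooth_minus[OF gs] uv(3)]) (use uv(4) in simp)
  have vu: "vd u t = v t" for t by (rule vector_derivative_at, rule uv)
  have vv: "vd v t = of_real (V t) * u t - g t" for t by (rule vector_derivative_at, rule uv)
  have sv: "smooth v" using smooth_vd[OF su] unfolding vu .
  define \<phi> where "\<phi> t = \<eta> t * u t" for t
  have \<phi>: "\<phi> \<in> test_functions"
    unfolding test_functions_iff \<phi>_def using \<eta>(3) by (auto intro!: smooth_mult \<eta> su)
  have d1: "vd \<phi> = (\<lambda>t. \<eta> t * v t + vd \<eta> t * u t)"
    unfolding \<phi>_def by (rule ext) (simp only: vd_mult[OF \<eta>(1) su] vu)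
  have d2: "vd (vd \<phi>) t = (\<eta> t * (of_real (V t) * u t - g t) + vd \<eta> t * v t) + (vd \<eta> t * v t + vd (vd \<eta>) t * u t)" for t
    unfolding d1 by (simp only: vd_add[OF smooth_mult[OF \<eta>(1) sv] smooth_mult[OF smooth_vd[OF \<eta>(1)] su]]
      vd_mult[OF \<eta>(1) sv] vd_mult[OF smooth_vd[OF \<eta>(1)] su] vv vu)
  have \<eta>g: "\<eta> t * g t = g t" for t
    using \<eta>(2)[of t] K[of t] R(2) by (cases "\<bar>t\<bar> \<le> R") auto
  have diff: "schroedinger V \<phi> t - g t = - (2 * vd \<eta> t * v t + vd (vd \<eta>) t * u t)" for t
    unfolding schroedinger_def d2 using \<eta>g[of t] by (simp add: \<phi>_def algebra_simps)
  have DR: "0 \<le> D / R" using D R by simp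
  have pw: "(cmod (schroedinger V \<phi> t - g t))\<^sup>2 \<le> (3 * D / R)\<^sup>2 * (indicator {-N..N} t * ((cmod (v t))\<^sup>2 + (cmod (u t))\<^sup>2))" for t
  proof (cases "\<bar>t\<bar> > N")
    case True
    have z1: "vd \<eta> t = 0" if "\<bar>t\<bar> > 2 * R" for t
      by (rule vd_eq_0[where K = "2 * R" and \<phi> = \<eta>]) (use \<eta>(3) that in auto)
    then have z: "vd \<eta> t = 0" "vd (vd \<eta>) t = 0"
      using vd_eq_0[where K = "2 * R" and \<phi> = "vd \<eta>" and t = t, OF z1] True by (simp_all add: N_def)
    then have "schroedinger V \<phi> t - g t = 0" unfolding diff z by simp
    then show ?thesis by simp
  next
    case False
    define x where "x = cmod (v t)"
    define y where "y = cmod (u t)"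
    have xy: "x \<ge> 0" "y \<ge> 0" by (auto simp: x_def y_def)
    have "cmod (schroedinger V \<phi> t - g t) \<le> 2 * cmod (vd \<eta> t) * x + cmod (vd (vd \<eta>) t) * y"
      unfolding diff norm_minus_cancel x_def y_def
      using norm_triangle_ineq[of "2 * vd \<eta> t * v t" "vd (vd \<eta>) t * u t"] by (simp add: norm_mult)
    also have "\<dots> \<le> 2 * (D / R) * x + D / R * y"
      using xy by (intro add_mono mult_right_mono mult_left_mono \<eta>) auto
    also have "\<dots> = D / R * (2 * x + y)" by (simp add: algebra_simps)
    finally have "(cmod (schroedinger V \<phi> t - g t))\<^sup>2 \<le> (D / R * (2 * x + y))\<^sup>2" by (intro power_mono) auto
    also have "\<dots> = (D / R)\<^sup>2 * (2 * x + y)\<^sup>2" by (rule power_mult_distrib)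
    also have "\<dots> \<le> (D / R)\<^sup>2 * (9 * (x\<^sup>2 + y\<^sup>2))"
    proof (rule mult_left_mono)
      have "9 * (x\<^sup>2 + y\<^sup>2) - (2 * x + y)\<^sup>2 = 3 * x\<^sup>2 + 6 * y\<^sup>2 + 2 * (x - y)\<^sup>2"
        by (simp add: power2_eq_square algebra_simps)
      also have "\<dots> \<ge> 0" by (intro add_nonneg_nonneg mult_nonneg_nonneg) auto
      finally show "(2 * x + y)\<^sup>2 \<le> 9 * (x\<^sup>2 + y\<^sup>2)" by simp
    qed simp
    also have "\<dots> = (3 * D / R)\<^sup>2 * (x\<^sup>2 + y\<^sup>2)" by (simp add: power_mult_distrib power_divide)
    also have "x\<^sup>2 + y\<^sup>2 = indicator {-N..N} t * ((cmod (v t))\<^sup>2 + (cmod (u t))\<^sup>2)"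
    proof -
      have "t \<in> {-N..N}" using False by auto
      then show ?thesis by (simp add: x_def y_def)
    qed
    finally show ?thesis .
  qed
  have cg: "continuous_on UNIV g" by (rule smooth_continuous[OF gs])
  have cu: "continuous_on UNIV u" "continuous_on UNIV v" by (rule smooth_continuous[OF su], rule smooth_continuous[OF sv])
  have "(L2_norm (\<lambda>t. schroedinger V \<phi> t - g t))\<^sup>2 \<le> (LINT t|lborel. (3 * D / R)\<^sup>2 * (indicator {-N..N} t * ((cmod (v t))\<^sup>2 + (cmod (u t))\<^sup>2)))"
    unfolding L2_norm_sq
    by (rule integral_mono_AE')
       (use pw in \<open>auto intro!: integrable_mult_right set_integrable_Icc continuous_intros cu\<close>)
  also have "\<dots> = (3 * D / R)\<^sup>2 * (LINT t|lborel. indicator {-N..N} t * ((cmod (v t))\<^sup>2 + (cmod (u t))\<^sup>2))" by simp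
  also have "\<dots> \<le> (3 * D / R)\<^sup>2 * (LINT t|lborel. indicator {-N..N} t * (cmod (g t))\<^sup>2)"
    by (intro mult_left_mono dirichlet_energy_bound[OF cV V(2) cg N uv]) auto
  also have "\<dots> \<le> (3 * D / R)\<^sup>2 * (LINT t|lborel. (cmod (g t))\<^sup>2)"
    by (intro mult_left_mono integral_mono set_integrable_Icc continuous_intros cg L2_integrable[OF test_L2[OF g]])
       (auto simp: indicator_def)
  also have "\<dots> = (3 * D / R * G)\<^sup>2" by (simp only: power_mult_distrib[of "3 * D / R" "L2_norm g"] G_def L2_norm_sq)
  finally have "L2_norm (\<lambda>t. schroedinger V \<phi> t - g t) \<le> 3 * D / R * G"
    by (rule power2_le_imp_le) (use D R in \<open>simp add: G_def L2_norm_nonneg\<close>)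
  also have "\<dots> < e"
  proof -
    have "3 * D * (G + 1) \<le> R * e" using R(3) e by (simp add: field_simps)
    moreover have "3 * D * G < R * e"
    proof (cases "D = 0")
      case True then show ?thesis using R e by simp
    next
      case False
      then have "3 * D * G < 3 * D * (G + 1)" using D by simp
      then show ?thesis using calculation by linarith
    qed
    ultimately show ?thesis using R by (simp add: field_simps)
  qed
  finally show ?thesis using \<phi> by blast
qed


section \<open>The bottom of the spectrum\<close>

text \<open>
  The closure of \<open>-d\<^sup>2/dt\<^sup>2 + V\<close> on the test functions, for a general potential.
\<close>

definition schroedinger_op :: "(real \<Rightarrow> real) \<Rightarrow> ((real \<Rightarrow> complex) \<times> (real \<Rightarrow> complex)) set" where
  "schroedinger_op V = {(u, f). u \<in> L2 \<and> f \<in> L2 \<and>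
        (\<exists>\<phi>. (\<forall>n::nat. \<phi> n \<in> test_functions) \<and>
             (\<lambda>n. L2_norm (\<lambda>t. \<phi> n t - u t)) \<longlonglongrightarrow> 0 \<and>
             (\<lambda>n. L2_norm (\<lambda>t. schroedinger V (\<phi> n) t - f t)) \<longlonglongrightarrow> 0)}"

text \<open>
  The infimum of the quadratic form over normalized test functions. Its set of values is nonempty and, for
  \<open>V \<ge> 0\<close>, bounded below by \<open>0\<close>, so \<open>Inf\<close> is a genuine infimum.
\<close>

definition ground_energy :: "(real \<Rightarrow> real) \<Rightarrow> real" where
  "ground_energy V = Inf {ip (schroedinger V \<phi>) \<phi> | \<phi>. \<phi> \<in> test_functions \<and> L2_norm \<phi> = 1}"

lemma schroedinger_test: "smooth (\<lambda>t. of_real (V t)) \<Longrightarrow> \<phi> \<in> test_functions \<Longrightarrow> schroedinger V \<phi> \<in> test_functions"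
  unfolding schroedinger_def
  using test_add[OF test_cmult[OF test_vd[OF test_vd], of \<phi> "-1"] test_mult, of "\<lambda>t. of_real (V t)" \<phi>] by simp

lemma schroedinger_add:
  assumes "\<phi> \<in> test_functions" "\<psi> \<in> test_functions"
  shows "schroedinger V (\<lambda>t. \<phi> t + \<psi> t) t = schroedinger V \<phi> t + schroedinger V \<psi> t"
proof -
  have s: "smooth \<phi>" "smooth \<psi>" using assms test_smooth by auto
  have 1: "vd (\<lambda>t. \<phi> t + \<psi> t) = (\<lambda>t. vd \<phi> t + vd \<psi> t)"
    by (rule ext) (rule vd_add[OF s])
  show ?thesis
    unfolding schroedinger_def 1 by (simp only: vd_add[OF smooth_vd[OF s(1)] smooth_vd[OF s(2)]]) (simp add: algebra_simps)
qed

lemma schroedinger_cmult: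
  assumes "\<phi> \<in> test_functions"
  shows "schroedinger V (\<lambda>t. c * \<phi> t) t = c * schroedinger V \<phi> t"
proof -
  have s: "smooth \<phi>" using assms test_smooth by auto
  have 1: "vd (\<lambda>t. c * \<phi> t) = (\<lambda>t. c * vd \<phi> t)"
    by (rule ext) (rule vd_cmult[OF s])
  show ?thesis
    unfolding schroedinger_def 1 by (simp only: vd_cmult[OF smooth_vd[OF s]]) (simp add: algebra_simps)
qed

lemma schroedinger_diff:
  assumes "\<phi> \<in> test_functions" "\<psi> \<in> test_functions"
  shows "schroedinger V (\<lambda>t. \<phi> t - \<psi> t) t = schroedinger V \<phi> t - schroedinger V \<psi> t"
  using schroedinger_add[OF assms(1) test_cmult[OF assms(2), of "-1"], of V t] schroedinger_cmult[OF assms(2), of V "-1" t]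
  by simp

lemma schroedinger_shift: "schroedinger (\<lambda>t. V t - c) \<phi> t = schroedinger V \<phi> t - of_real c * \<phi> t"
  by (simp add: schroedinger_def algebra_simps)

lemma smooth_shift: "smooth (\<lambda>t. of_real (V t)) \<Longrightarrow> smooth (\<lambda>t. of_real (V t - c))"
  using smooth_diff[OF _ smooth_const[of "of_real c"], of "\<lambda>t. of_real (V t)"] by simp

lemma green_formula:
  assumes V: "smooth (\<lambda>t. of_real (V t))" and \<phi>: "\<phi> \<in> test_functions" and \<psi>: "\<psi> \<in> test_functions"
  shows "ip (schroedinger V \<phi>) \<psi> = (LINT t|lborel. vd \<phi> t \<bullet> vd \<psi> t + V t * (\<phi> t \<bullet> \<psi> t))"
proof -
  have c: "continuous_on UNIV V" "continuous_on UNIV \<phi>" "continuous_on UNIV (vd \<phi>)" "continuous_on UNIV (vd (vd \<phi>))"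
    using smooth_real_continuous[OF V] \<phi> test_smooth smooth_vd smooth_continuous by auto
  have i1: "ccont (\<lambda>t. vd \<phi> t \<bullet> vd \<psi> t)" by (intro ccont_inner c test_ccont test_vd \<psi>)
  have i2: "ccont (\<lambda>t. vd (vd \<phi>) t \<bullet> \<psi> t)" by (intro ccont_inner c test_ccont \<psi>)
  have i3: "ccont (\<lambda>t. V t * (\<phi> t \<bullet> \<psi> t))"
    using ccont_mult_left[OF c(1) ccont_inner[OF c(2) test_ccont[OF \<psi>]]] by simp
  have i4: "ccont (\<lambda>t. vd \<phi> t \<bullet> \<psi> t)" by (intro ccont_inner c test_ccont \<psi>)
  have z: "(LINT t|lborel. vd \<phi> t \<bullet> vd \<psi> t + vd (vd \<phi>) t \<bullet> \<psi> t) = 0"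
    by (rule integral_derivative_ccont[OF inner_has_vd i4 ccont_add[OF i1 i2]])
       (intro test_has_vd test_vd \<phi> \<psi>)+
  have "ip (schroedinger V \<phi>) \<psi> = (LINT t|lborel. (vd \<phi> t \<bullet> vd \<psi> t + V t * (\<phi> t \<bullet> \<psi> t)) - (vd \<phi> t \<bullet> vd \<psi> t + vd (vd \<phi>) t \<bullet> \<psi> t))"
    unfolding ip_def schroedinger_def
    by (intro Bochner_Integration.integral_cong refl) (simp add: inner_add_left inner_diff_left flip: scaleR_conv_of_real)
  also have "\<dots> = (LINT t|lborel. vd \<phi> t \<bullet> vd \<psi> t + V t * (\<phi> t \<bullet> \<psi> t)) - 0"
    unfolding z[symmetric] by (intro Bochner_Integration.integral_diff integrable_ccont ccont_add i1 i2 i3)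
  finally show ?thesis by simp
qed

lemma schroedinger_symmetric:
  assumes V: "smooth (\<lambda>t. of_real (V t))" and "\<phi> \<in> test_functions" and "\<psi> \<in> test_functions"
  shows "ip (schroedinger V \<phi>) \<psi> = ip (schroedinger V \<psi>) \<phi>"
  by (simp add: green_formula[OF assms(1)] assms inner_commute)

lemma schroedinger_nonneg:
  assumes V: "smooth (\<lambda>t. of_real (V t))" "\<And>t. V t \<ge> 0" and \<phi>: "\<phi> \<in> test_functions"
  shows "ip (schroedinger V \<phi>) \<phi> \<ge> 0"
  unfolding green_formula[OF V(1) \<phi> \<phi>] by (intro Bochner_Integration.integral_nonneg) (simp add: V)

lemma exists_normalized_test: "\<exists>\<phi>\<in>test_functions. L2_norm \<phi> = 1"
proof -
  obtain \<psi> where \<psi>: "\<psi> \<in> test_functions" "L2_norm (\<lambda>t. \<psi> t - indicator {0<..<1} t) < 1"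
    using indicator_interval_in_test_closure[of 0 1] unfolding test_closure_def by (auto dest: spec[of _ 1])
  have i: "indicator {0<..<1::real} \<in> L2" using indicator_interval_in_test_closure[of 0 1] by (simp add: test_closure_def)
  have "(L2_norm (indicator {0<..<1::real}))\<^sup>2 = (LINT t|lborel. indicat_real {0<..<1::real} t)"
    unfolding L2_norm_sq by (intro Bochner_Integration.integral_cong refl) (simp add: indicator_def)
  then have "(L2_norm (indicator {0<..<1::real}))\<^sup>2 = 1" by simp
  then have "L2_norm (indicator {0<..<1::real}) = 1"
    using L2_norm_nonneg[of "indicator {0<..<1::real}"] by (simp add: power2_eq_1_iff)
  then have "L2_norm \<psi> > 0" using L2_norm_le_diff[OF test_L2[OF \<psi>(1)] i] \<psi>(2) by simp
  then have "L2_norm (\<lambda>t. of_real (inverse (L2_norm \<psi>)) * \<psi> t) = 1" by (simp add: L2_norm_cmult del: of_real_inverse)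
  then show ?thesis using test_cmult[OF \<psi>(1)] by blast
qed

lemma ground_le_energy:
  assumes V: "smooth (\<lambda>t. of_real (V t))" "\<And>t. V t \<ge> 0" and \<phi>: "\<phi> \<in> test_functions"
  shows "ground_energy V * (L2_norm \<phi>)\<^sup>2 \<le> ip (schroedinger V \<phi>) \<phi>"
proof (cases "L2_norm \<phi> = 0")
  case True
  then show ?thesis using schroedinger_nonneg[OF V \<phi>] by simp
next
  case False
  define c where "c = inverse (L2_norm \<phi>)"
  define \<psi> where "\<psi> t = of_real c * \<phi> t" for t
  have c: "c > 0" using False L2_norm_nonneg[of \<phi>] by (simp add: c_def)
  have \<psi>: "\<psi> \<in> test_functions" unfolding \<psi>_def by (rule test_cmult[OF \<phi>])
  have "L2_norm \<psi> = 1" using c False unfolding \<psi>_def by (simp add: L2_norm_cmult) (simp add: c_def)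
  then have "ground_energy V \<le> ip (schroedinger V \<psi>) \<psi>"
    unfolding ground_energy_def using \<psi> schroedinger_nonneg[OF V] by (intro cInf_lower bdd_belowI[of _ 0]) auto
  also have "\<dots> = c * (c * ip (schroedinger V \<phi>) \<phi>)"
  proof -
    have "schroedinger V \<psi> = (\<lambda>t. of_real c * schroedinger V \<phi> t)" unfolding \<psi>_def by (rule ext) (rule schroedinger_cmult[OF \<phi>])
    then have "ip (schroedinger V \<psi>) \<psi> = c * ip (schroedinger V \<phi>) \<psi>" by (simp only: ip_scale_left)
    also have "ip (schroedinger V \<phi>) \<psi> = c * ip \<phi> (schroedinger V \<phi>)"
      unfolding \<psi>_def by (subst ip_commute) (rule ip_scale_left)
    finally show ?thesis by (simp add: ip_commute)
  qed
  finally have "ground_energy V * (L2_norm \<phi>)\<^sup>2 \<le> c * (c * ip (schroedinger V \<phi>) \<phi>) * (L2_norm \<phi>)\<^sup>2"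
    by (intro mult_right_mono) auto
  also have "\<dots> = ip (schroedinger V \<phi>) \<phi>" using False by (simp add: c_def power2_eq_square field_simps)
  finally show ?thesis .
qed

lemma ground_greatest:
  assumes "\<And>\<phi>. \<phi> \<in> test_functions \<Longrightarrow> L2_norm \<phi> = 1 \<Longrightarrow> M \<le> ip (schroedinger V \<phi>) \<phi>"
  shows "M \<le> ground_energy V"
  unfolding ground_energy_def using exists_normalized_test assms by (intro cInf_greatest) auto

lemma ground_approx:
  assumes "e > 0"
  shows "\<exists>\<phi>\<in>test_functions. L2_norm \<phi> = 1 \<and> ip (schroedinger V \<phi>) \<phi> < ground_energy V + e"
proof (rule ccontr)
  assume "\<not> ?thesis"
  then have "ground_energy V + e \<le> ground_energy V" by (intro ground_greatest) force
  then show False using assms by simp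
qed

lemma shifted_lower_bound:
  assumes V: "smooth (\<lambda>t. of_real (V t))" "\<And>t. V t \<ge> 0" and \<phi>: "\<phi> \<in> test_functions"
  shows "(ground_energy V - c) * L2_norm \<phi> \<le> L2_norm (schroedinger (\<lambda>t. V t - c) \<phi>)"
proof (cases "L2_norm \<phi> = 0")
  case False
  then have pos: "L2_norm \<phi> > 0" using L2_norm_nonneg[of \<phi>] by simp
  have t: "schroedinger V \<phi> \<in> L2" "(\<lambda>t. of_real c * \<phi> t) \<in> L2" "\<phi> \<in> L2"
    using test_L2 schroedinger_test[OF V(1) \<phi>] test_cmult[OF \<phi>] \<phi> by auto
  have s: "schroedinger (\<lambda>t. V t - c) \<phi> \<in> L2" by (intro test_L2 schroedinger_test smooth_shift V \<phi>)
  have "(ground_energy V - c) * (L2_norm \<phi>)\<^sup>2 \<le> ip (schroedinger V \<phi>) \<phi> - c * ip \<phi> \<phi>"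
    using ground_le_energy[OF V \<phi>] by (simp add: ip_self algebra_simps)
  also have "\<dots> = ip (\<lambda>t. schroedinger V \<phi> t - of_real c * \<phi> t) \<phi>"
    using ip_diff_left[OF t] by (simp add: ip_scale_left)
  also have "\<dots> = ip (schroedinger (\<lambda>t. V t - c) \<phi>) \<phi>" unfolding schroedinger_shift ..
  also have "\<dots> \<le> L2_norm (schroedinger (\<lambda>t. V t - c) \<phi>) * L2_norm \<phi>"
    using ip_cauchy_schwarz[OF s t(3)] by simp
  finally show ?thesis using pos by (simp add: power2_eq_square)
qed (simp add: L2_norm_nonneg)

text \<open>
  Let \<open>H c\<close> be the operator with potential \<open>V - c\<close>, let \<open>m\<close> be the ground energy, and choose \<open>b\<close> so far below \<open>c\<close>
  that \<open>H b\<close> has dense range. If \<open>H b \<psi>\<close> approximates a residual \<open>r\<close>, then \<open>r - H c \<psi>\<close> is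
  \<open>(c - b) \<psi>\<close> up to a small error, and \<open>|\<psi>| \<le> |H b \<psi>| / (m - b)\<close>. Hence the residual shrinks by a factor
  close to \<open>q = (c - b)/(m - b) < 1\<close>, and finitely many steps suffice. All residuals are test
  functions, so the iteration takes place inside the domain.
\<close>

lemma range_dense_below_ground:
  assumes V: "smooth (\<lambda>t. of_real (V t))" "\<And>t. V t \<ge> 0" and c: "c < ground_energy V"
    and g: "g \<in> test_functions" and e: "e > 0"
  shows "\<exists>\<phi>\<in>test_functions. L2_norm (\<lambda>t. schroedinger (\<lambda>t. V t - c) \<phi> t - g t) < e"
proof -
  define b where "b = min (-1) (c - 1)"
  have b: "b \<le> -1" "b < c" "b < ground_energy V" using c by (auto simp: b_def)
  define q where "q = (c - b) / (ground_energy V - b)"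
  have q: "0 < q" "q < 1" using b c by (auto simp: q_def field_simps)
  \<comment> \<open>With a relative error \<open>\<delta>\<close> in each step the residual shrinks by \<open>\<delta> + q (1 + \<delta>)\<close>, at most the mean of \<open>q\<close> and \<open>1\<close>.\<close>
  define \<delta> where "\<delta> = (1 - q) / 4"
  have \<delta>: "\<delta> > 0" "\<delta> + q * (1 + \<delta>) \<le> (1 + q) / 2"
  proof -
    have "q * \<delta> \<le> 1 * \<delta>" using q by (intro mult_right_mono) (auto simp: \<delta>_def)
    moreover have "\<delta> + q * (1 + \<delta>) = \<delta> + q + q * \<delta>" by (simp add: distrib_left)
    ultimately have "\<delta> + q * (1 + \<delta>) \<le> 2 * \<delta> + q" by simp
    then show "\<delta> + q * (1 + \<delta>) \<le> (1 + q) / 2" by (simp add: \<delta>_def field_simps)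
    show "\<delta> > 0" using q by (simp add: \<delta>_def)
  qed
  let ?H = "\<lambda>c. schroedinger (\<lambda>t. V t - c)"
  have HT: "?H c \<phi> \<in> test_functions" if "\<phi> \<in> test_functions" for \<phi> c
    by (intro schroedinger_test smooth_shift V that)
  have step: "\<exists>\<psi>\<in>test_functions. L2_norm (\<lambda>t. r t - ?H c \<psi> t) \<le> (1 + q) / 2 * L2_norm r"
    if r: "r \<in> test_functions" for r
  proof (cases "L2_norm r = 0")
    case True
    have "?H c (\<lambda>t. 0) t = 0" for t using schroedinger_cmult[OF test_zero, of _ 0] by simp
    then show ?thesis using True by (intro bexI[OF _ test_zero]) simp
  next
    case False
    then have "\<delta> * L2_norm r > 0" using \<delta>(1) L2_norm_nonneg[of r] by simp
    moreover have "V t - b \<ge> 1" for t using V(2)[of t] b(1) by linarith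
    ultimately obtain \<psi> where \<psi>: "\<psi> \<in> test_functions" "L2_norm (\<lambda>t. ?H b \<psi> t - r t) < \<delta> * L2_norm r"
      using range_dense_positive[OF smooth_shift[OF V(1)] _ r, of b] by blast
    have L: "r \<in> L2" "?H b \<psi> \<in> L2" "\<psi> \<in> L2" using test_L2 HT r \<psi>(1) by auto
    have "(ground_energy V - b) * L2_norm \<psi> \<le> L2_norm (?H b \<psi>)" by (rule shifted_lower_bound[OF V \<psi>(1)])
    also have "\<dots> \<le> (1 + \<delta>) * L2_norm r"
      using L2_norm_le_diff[OF L(2,1)] \<psi>(2) by (simp add: distrib_right)
    finally have "L2_norm \<psi> \<le> (1 + \<delta>) * L2_norm r / (ground_energy V - b)" using b by (simp add: field_simps)
    then have "(c - b) * L2_norm \<psi> \<le> (c - b) * ((1 + \<delta>) * L2_norm r / (ground_energy V - b))"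
      using b by (intro mult_left_mono) auto
    then have n1: "(c - b) * L2_norm \<psi> \<le> q * (1 + \<delta>) * L2_norm r" by (simp add: q_def)
    have "(\<lambda>t. r t - ?H c \<psi> t) = (\<lambda>t. (r t - ?H b \<psi> t) + of_real (c - b) * \<psi> t)"
      by (rule ext) (simp add: schroedinger_shift algebra_simps)
    then have "L2_norm (\<lambda>t. r t - ?H c \<psi> t) \<le> L2_norm (\<lambda>t. r t - ?H b \<psi> t) + L2_norm (\<lambda>t. of_real (c - b) * \<psi> t)"
      using L2_triangle[OF L2_diff[OF L(1,2)] L2_cmult[OF L(3)]] by simp
    also have "\<dots> \<le> \<delta> * L2_norm r + q * (1 + \<delta>) * L2_norm r"
      using \<psi>(2) n1 b(2) by (intro add_mono) (simp_all add: L2_norm_minus_commute[of r] L2_norm_cmult del: of_real_diff)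
    also have "\<dots> = (\<delta> + q * (1 + \<delta>)) * L2_norm r" by (simp add: algebra_simps)
    also have "\<dots> \<le> (1 + q) / 2 * L2_norm r" by (intro mult_right_mono \<delta> L2_norm_nonneg)
    finally show ?thesis using \<psi>(1) by blast
  qed
  have iter: "\<exists>\<phi>\<in>test_functions. L2_norm (\<lambda>t. g t - ?H c \<phi> t) \<le> ((1 + q) / 2) ^ n * L2_norm g" for n
  proof (induction n)
    case 0
    have "?H c (\<lambda>t. 0) t = 0" for t using schroedinger_cmult[OF test_zero, of _ 0] by simp
    then show ?case by (intro bexI[OF _ test_zero]) simp
  next
    case (Suc n)
    then obtain \<phi> where \<phi>: "\<phi> \<in> test_functions" "L2_norm (\<lambda>t. g t - ?H c \<phi> t) \<le> ((1 + q) / 2) ^ n * L2_norm g" by blast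
    have r: "(\<lambda>t. g t - ?H c \<phi> t) \<in> test_functions" by (intro test_diff g HT \<phi>)
    obtain \<psi> where \<psi>: "\<psi> \<in> test_functions"
      "L2_norm (\<lambda>t. (g t - ?H c \<phi> t) - ?H c \<psi> t) \<le> (1 + q) / 2 * L2_norm (\<lambda>t. g t - ?H c \<phi> t)"
      using step[OF r] by blast
    have "L2_norm (\<lambda>t. g t - ?H c (\<lambda>t. \<phi> t + \<psi> t) t) \<le> (1 + q) / 2 * L2_norm (\<lambda>t. g t - ?H c \<phi> t)"
      using \<psi>(2) by (simp add: schroedinger_add[OF \<phi>(1) \<psi>(1)] algebra_simps)
    also have "\<dots> \<le> (1 + q) / 2 * (((1 + q) / 2) ^ n * L2_norm g)"
      using \<phi>(2) q by (intro mult_left_mono) auto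
    finally show ?case by (intro bexI[OF _ test_add[OF \<phi>(1) \<psi>(1)]]) simp
  qed
  have "(\<lambda>n. ((1 + q) / 2) ^ n * L2_norm g) \<longlonglongrightarrow> 0 * L2_norm g"
    using q by (intro tendsto_mult tendsto_const LIMSEQ_realpow_zero) auto
  then have "eventually (\<lambda>n. ((1 + q) / 2) ^ n * L2_norm g < e) sequentially"
    using e by (intro order_tendstoD(2)[of _ 0]) simp_all
  then obtain n where "((1 + q) / 2) ^ n * L2_norm g < e" unfolding eventually_sequentially by blast
  then show ?thesis using iter[of n] by (auto simp: L2_norm_minus_commute[of g] intro: le_less_trans)
qed

lemma L2_norm_tendsto:
  assumes v: "\<And>n. v n \<in> L2" and u: "u \<in> L2" and lim: "(\<lambda>n. L2_norm (\<lambda>t. v n t - u t)) \<longlonglongrightarrow> 0"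
  shows "(\<lambda>n. L2_norm (v n)) \<longlonglongrightarrow> L2_norm u"
proof (rule LIM_zero_cancel, rule tendsto_rabs_zero_cancel, rule real_tendsto_sandwich[OF _ _ tendsto_const lim])
  show "\<forall>\<^sub>F n in sequentially. \<bar>L2_norm (v n) - L2_norm u\<bar> \<le> L2_norm (\<lambda>t. v n t - u t)"
    using L2_norm_le_diff[OF v u] by (intro always_eventually allI)
qed simp

lemma L2_tendsto_combination:
  assumes v: "\<And>n. v n \<in> L2" "\<And>n. w n \<in> L2" "v0 \<in> L2" "w0 \<in> L2"
    and lim: "(\<lambda>n. L2_norm (\<lambda>t. v n t - v0 t)) \<longlonglongrightarrow> 0" "(\<lambda>n. L2_norm (\<lambda>t. w n t - w0 t)) \<longlonglongrightarrow> 0"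
  shows "(\<lambda>n. L2_norm (\<lambda>t. (v n t + c * w n t) - (v0 t + c * w0 t))) \<longlonglongrightarrow> 0"
proof (rule real_tendsto_sandwich[OF _ _ tendsto_const])
  have "L2_norm (\<lambda>t. (v n t + c * w n t) - (v0 t + c * w0 t))
      \<le> L2_norm (\<lambda>t. v n t - v0 t) + cmod c * L2_norm (\<lambda>t. w n t - w0 t)" for n
  proof -
    have "(\<lambda>t. (v n t + c * w n t) - (v0 t + c * w0 t)) = (\<lambda>t. (v n t - v0 t) + c * (w n t - w0 t))"
      by (rule ext) (simp add: algebra_simps)
    then show ?thesis
      using L2_triangle[OF L2_diff[OF v(1,3)] L2_cmult[OF L2_diff[OF v(2,4)]], of n c n]
      by (simp only: L2_norm_cmult)
  qed
  then show "\<forall>\<^sub>F n in sequentially. L2_norm (\<lambda>t. (v n t + c * w n t) - (v0 t + c * w0 t))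
      \<le> L2_norm (\<lambda>t. v n t - v0 t) + cmod c * L2_norm (\<lambda>t. w n t - w0 t)"
    by (intro always_eventually allI)
  have "(\<lambda>n. L2_norm (\<lambda>t. v n t - v0 t) + cmod c * L2_norm (\<lambda>t. w n t - w0 t)) \<longlonglongrightarrow> 0 + cmod c * 0"
    by (intro tendsto_intros lim)
  then show "(\<lambda>n. L2_norm (\<lambda>t. v n t - v0 t) + cmod c * L2_norm (\<lambda>t. w n t - w0 t)) \<longlonglongrightarrow> 0" by simp
qed (simp add: L2_norm_nonneg)

lemma schroedinger_op_lower_bound:
  assumes V: "smooth (\<lambda>t. of_real (V t))" "\<And>t. V t \<ge> 0" and uf: "(u, f) \<in> schroedinger_op V"
  shows "(ground_energy V - c) * L2_norm u \<le> L2_norm (\<lambda>t. f t - of_real c * u t)"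
proof -
  obtain \<phi> where L: "u \<in> L2" "f \<in> L2" and \<phi>: "\<And>n::nat. \<phi> n \<in> test_functions"
    "(\<lambda>n. L2_norm (\<lambda>t. \<phi> n t - u t)) \<longlonglongrightarrow> 0" "(\<lambda>n. L2_norm (\<lambda>t. schroedinger V (\<phi> n) t - f t)) \<longlonglongrightarrow> 0"
    using uf unfolding schroedinger_op_def by auto
  have \<phi>L: "\<phi> n \<in> L2" "schroedinger V (\<phi> n) \<in> L2" for n using test_L2 \<phi>(1) schroedinger_test[OF V(1)] by auto
  let ?w = "\<lambda>t. f t - of_real c * u t"
  have w: "?w \<in> L2" by (intro L2_diff L L2_cmult)
  have sL: "schroedinger (\<lambda>t. V t - c) (\<phi> n) \<in> L2" for n by (intro test_L2 schroedinger_test smooth_shift V \<phi>)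
  have conv1: "(\<lambda>n. L2_norm (\<phi> n)) \<longlonglongrightarrow> L2_norm u" by (rule L2_norm_tendsto[OF \<phi>L(1) L(1) \<phi>(2)])
  have "(\<lambda>n. L2_norm (\<lambda>t. schroedinger (\<lambda>t. V t - c) (\<phi> n) t - ?w t)) \<longlonglongrightarrow> 0"
    using L2_tendsto_combination[OF \<phi>L(2,1) L(2,1) \<phi>(3,2), of "- of_real c"] by (simp add: schroedinger_shift)
  then have conv2: "(\<lambda>n. L2_norm (schroedinger (\<lambda>t. V t - c) (\<phi> n))) \<longlonglongrightarrow> L2_norm ?w"
    by (rule L2_norm_tendsto[OF sL w])
  show ?thesis
    by (rule LIMSEQ_le[OF tendsto_mult[OF tendsto_const conv1] conv2]) (intro exI[of _ 0] allI impI shifted_lower_bound[OF V \<phi>(1)])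
qed

text \<open>
  Approximate \<open>g\<close> by \<open>H \<phi> n\<close> with test functions \<open>\<phi> n\<close>. As the shifted operator \<open>H\<close> is bounded below, the \<open>\<phi> n\<close> form a Cauchy
  sequence; its limit solves the equation by definition of the closure.
\<close>

lemma schroedinger_op_surjective:
  assumes V: "smooth (\<lambda>t. of_real (V t))" "\<And>t. V t \<ge> 0" and c: "c < ground_energy V" and g: "g \<in> L2"
  shows "\<exists>u. (u, \<lambda>t. g t + of_real c * u t) \<in> schroedinger_op V"
proof -
  let ?H = "schroedinger (\<lambda>t. V t - c)"
  have "\<exists>\<phi>\<in>test_functions. L2_norm (\<lambda>t. ?H \<phi> t - g t) < 1 / Suc n" for n
  proof -
    define e where "e = 1 / real (Suc n)"
    have e: "e / 2 > 0" by (simp add: e_def)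
    obtain h where h: "h \<in> test_functions" "L2_norm (\<lambda>t. h t - g t) < e / 2"
      using test_functions_dense[OF g] e unfolding test_closure_def by blast
    obtain \<phi> where \<phi>: "\<phi> \<in> test_functions" "L2_norm (\<lambda>t. ?H \<phi> t - h t) < e / 2"
      using range_dense_below_ground[OF V c h(1) e] by auto
    have "?H \<phi> \<in> L2" by (intro test_L2 schroedinger_test smooth_shift V \<phi>)
    from L2_triangle_diff[OF this test_L2[OF h(1)] g] have "L2_norm (\<lambda>t. ?H \<phi> t - g t) < e" using h(2) \<phi>(2) by linarith
    then show ?thesis using \<phi>(1) unfolding e_def by blast
  qed
  then obtain \<phi> where \<phi>: "\<And>n. \<phi> n \<in> test_functions" "\<And>n. L2_norm (\<lambda>t. ?H (\<phi> n) t - g t) < 1 / Suc n"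
    by metis
  have HL: "?H (\<phi> n) \<in> L2" for n by (intro test_L2 schroedinger_test smooth_shift V \<phi>)
  have "(\<lambda>n. 1 / real (Suc n)) \<longlonglongrightarrow> 0" by (rule LIMSEQ_Suc[OF lim_1_over_n])
  then have lim: "(\<lambda>n. L2_norm (\<lambda>t. ?H (\<phi> n) t - g t)) \<longlonglongrightarrow> 0"
  proof (rule real_tendsto_sandwich[OF _ _ tendsto_const, rotated 2])
    show "\<forall>\<^sub>F n in sequentially. L2_norm (\<lambda>t. ?H (\<phi> n) t - g t) \<le> 1 / real (Suc n)"
      using less_imp_le[OF \<phi>(2)] by (intro always_eventually allI)
  qed (simp add: L2_norm_nonneg)
  have "\<exists>u\<in>L2. (\<lambda>n. L2_norm (\<lambda>t. \<phi> n t - u t)) \<longlonglongrightarrow> 0"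
  proof (rule L2_complete)
    show "\<phi> n \<in> L2" for n using \<phi>(1) by (rule test_L2)
    fix e :: real assume e: "e > 0"
    define e' where "e' = (ground_energy V - c) * e / 2"
    have e': "e' > 0" using e c by (simp add: e'_def)
    then obtain N where N: "\<And>n. n \<ge> N \<Longrightarrow> L2_norm (\<lambda>t. ?H (\<phi> n) t - g t) < e'"
      using LIMSEQ_D[OF lim e'] L2_norm_nonneg by (auto simp: L2_norm_nonneg)
    have "L2_norm (\<lambda>t. \<phi> m t - \<phi> n t) < e" if "m \<ge> N" "n \<ge> N" for m n
    proof -
      have "(ground_energy V - c) * L2_norm (\<lambda>t. \<phi> m t - \<phi> n t) \<le> L2_norm (?H (\<lambda>t. \<phi> m t - \<phi> n t))"
        by (rule shifted_lower_bound[OF V test_diff[OF \<phi>(1) \<phi>(1)]])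
      also have "?H (\<lambda>t. \<phi> m t - \<phi> n t) = (\<lambda>t. ?H (\<phi> m) t - ?H (\<phi> n) t)"
        by (rule ext) (rule schroedinger_diff[OF \<phi>(1) \<phi>(1)])
      also have "L2_norm (\<lambda>t. ?H (\<phi> m) t - ?H (\<phi> n) t) \<le> L2_norm (\<lambda>t. ?H (\<phi> m) t - g t) + L2_norm (\<lambda>t. g t - ?H (\<phi> n) t)"
        by (rule L2_triangle_diff[OF HL g HL])
      also have "\<dots> < e' + e'" using N[OF that(1)] N[OF that(2)] L2_norm_minus_commute[of g "?H (\<phi> n)"] by simp
      also have "\<dots> = (ground_energy V - c) * e" by (simp add: e'_def)
      finally show ?thesis using c by simp
    qed
    then show "\<exists>N. \<forall>m\<ge>N. \<forall>n\<ge>N. L2_norm (\<lambda>t. \<phi> m t - \<phi> n t) < e" by blast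
  qed
  then obtain u where u: "u \<in> L2" "(\<lambda>n. L2_norm (\<lambda>t. \<phi> n t - u t)) \<longlonglongrightarrow> 0" by blast
  have "(\<lambda>n. L2_norm (\<lambda>t. schroedinger V (\<phi> n) t - (g t + of_real c * u t))) \<longlonglongrightarrow> 0"
    using L2_tendsto_combination[OF HL test_L2[OF \<phi>(1)] g u(1) lim u(2), of "of_real c"] by (simp add: schroedinger_shift)
  moreover have "(\<lambda>t. g t + of_real c * u t) \<in> L2" by (intro L2_add L2_cmult g u)
  ultimately have "(u, \<lambda>t. g t + of_real c * u t) \<in> schroedinger_op V"
    unfolding schroedinger_op_def using u \<phi>(1) by (intro CollectI case_prodI conjI exI[of _ \<phi>]) auto
  then show ?thesis by (rule exI[of _ u])
qed

lemma below_ground_in_resolvent: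
  assumes V: "smooth (\<lambda>t. of_real (V t))" "\<And>t. V t \<ge> 0" and c: "c < ground_energy V"
  shows "of_real c \<in> resolvent_set (schroedinger_op V)"
  unfolding resolvent_set_def
proof (intro CollectI conjI)
  show "\<forall>g\<in>L2. \<exists>(u, f)\<in>schroedinger_op V. AE t in lborel. f t - of_real c * u t = g t"
  proof
    fix g assume g: "g \<in> L2"
    obtain u where "(u, \<lambda>t. g t + of_real c * u t) \<in> schroedinger_op V"
      by (rule exE[OF schroedinger_op_surjective[OF V c g]])
    then show "\<exists>(u, f)\<in>schroedinger_op V. AE t in lborel. f t - of_real c * u t = g t"
      by (intro bexI[of _ "(u, \<lambda>t. g t + of_real c * u t)"]) auto
  qed
  have L: "u \<in> L2 \<and> f \<in> L2" if "(u, f) \<in> schroedinger_op V" for u f using that by (auto simp: schroedinger_op_def)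
  have bound: "L2_norm u \<le> 1 / (ground_energy V - c) * L2_norm (\<lambda>t. f t - of_real c * u t)" if "(u, f) \<in> schroedinger_op V" for u f
    using schroedinger_op_lower_bound[OF V that, of c] c by (simp add: field_simps)
  have "AE t in lborel. u t = 0"
    if uf: "(u, f) \<in> schroedinger_op V" and z: "AE t in lborel. f t - of_real c * u t = 0" for u f
  proof -
    have "L2_norm (\<lambda>t. f t - of_real c * u t) = L2_norm (\<lambda>t. 0)"
      using L[OF uf] by (intro L2_norm_cong_AE z L2_diff L2_cmult test_L2[OF test_zero]) auto
    also have "\<dots> = 0" by (simp add: L2_norm_def)
    finally have "L2_norm u = 0" using bound[OF uf] L2_norm_nonneg[of u] by simp
    then show ?thesis using L[OF uf] L2_norm_eq_0 by blast
  qed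
  then show "\<forall>(u, f)\<in>schroedinger_op V. (AE t in lborel. f t - of_real c * u t = 0) \<longrightarrow> (AE t in lborel. u t = 0)"
    by blast
  show "\<exists>C. \<forall>(u, f)\<in>schroedinger_op V. L2_norm u \<le> C * L2_norm (\<lambda>t. f t - of_real c * u t)"
    using bound by blast
qed

text \<open>
  If \<open>m\<close> were in the resolvent set with a bound \<open>C\<close> for the inverse, take a normalized test function \<open>\<psi>\<close>
  with form value \<open>B \<psi> \<psi> < e = 1 / (|C| + 1)\<close>, where \<open>B\<close> is the nonnegative form of \<open>X - m\<close>, and solve
  \<open>(X - m) u = \<psi>\<close>. With approximants \<open>\<phi> n\<close> of \<open>u\<close>, the Cauchy-Schwarz inequality for \<open>B\<close> gives in the limit
  \<open>1 = |\<psi>|\<^sup>4 \<le> |\<psi>| |u| B \<psi> \<psi> \<le> C e < 1\<close>.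
\<close>

lemma ground_in_spectrum:
  assumes V: "smooth (\<lambda>t. of_real (V t))" "\<And>t. V t \<ge> 0"
  shows "of_real (ground_energy V) \<in> spectrum (schroedinger_op V)"
proof (rule ccontr)
  let ?m = "ground_energy V"
  let ?H = "schroedinger (\<lambda>t. V t - ?m)"
  assume "of_real ?m \<notin> spectrum (schroedinger_op V)"
  then have R: "of_real ?m \<in> resolvent_set (schroedinger_op V)" by (simp add: spectrum_def)
  then have "\<exists>C. \<forall>(u, f)\<in>schroedinger_op V. L2_norm u \<le> C * L2_norm (\<lambda>t. f t - of_real ?m * u t)"
    by (simp add: resolvent_set_def)
  then obtain C where C: "\<And>u f. (u, f) \<in> schroedinger_op V \<Longrightarrow> L2_norm u \<le> C * L2_norm (\<lambda>t. f t - of_real ?m * u t)"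
    by auto
  define e where "e = 1 / (\<bar>C\<bar> + 1)"
  have e: "e > 0" by (simp add: e_def add_nonneg_pos)
  obtain \<psi> where \<psi>: "\<psi> \<in> test_functions" "L2_norm \<psi> = 1" "ip (schroedinger V \<psi>) \<psi> < ?m + e"
    using ground_approx[OF e] by blast
  have \<psi>L: "\<psi> \<in> L2" by (rule test_L2[OF \<psi>(1)])
  obtain u f where uf: "(u, f) \<in> schroedinger_op V" "AE t in lborel. f t - of_real ?m * u t = \<psi> t"
  proof -
    have "\<forall>g\<in>L2. \<exists>(u, f)\<in>schroedinger_op V. AE t in lborel. f t - of_real ?m * u t = g t"
      using R by (simp add: resolvent_set_def)
    from bspec[OF this \<psi>L] show thesis using that by auto
  qed
  obtain \<phi> where L: "u \<in> L2" "f \<in> L2" and \<phi>: "\<And>n::nat. \<phi> n \<in> test_functions"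
    "(\<lambda>n. L2_norm (\<lambda>t. \<phi> n t - u t)) \<longlonglongrightarrow> 0" "(\<lambda>n. L2_norm (\<lambda>t. schroedinger V (\<phi> n) t - f t)) \<longlonglongrightarrow> 0"
    using uf(1) unfolding schroedinger_op_def by auto
  let ?w = "\<lambda>t. f t - of_real ?m * u t"
  have wL: "?w \<in> L2" by (intro L2_diff L L2_cmult)
  have w1: "L2_norm ?w = 1" using L2_norm_cong_AE[OF wL \<psi>L uf(2)] \<psi>(2) by simp
  have HT: "?H \<phi> \<in> test_functions" if "\<phi> \<in> test_functions" for \<phi>
    by (intro schroedinger_test smooth_shift V that)
  have \<phi>L: "\<phi> n \<in> L2" "schroedinger V (\<phi> n) \<in> L2" "?H (\<phi> n) \<in> L2" for n
    using test_L2 \<phi>(1) HT schroedinger_test[OF V(1)] by auto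
  define B where "B a b = ip (?H a) b" for a b
  have Bnn: "B a a \<ge> 0" if a: "a \<in> test_functions" for a
  proof -
    have "B a a = ip (schroedinger V a) a - ?m * ip a a"
      unfolding B_def schroedinger_shift
      using ip_diff_left[OF test_L2[OF schroedinger_test[OF V(1) a]] test_L2[OF test_cmult[OF a, of "of_real ?m"]] test_L2[OF a]]
      by (simp add: ip_scale_left)
    then show ?thesis using ground_le_energy[OF V a] by (simp add: ip_self)
  qed
  have B\<psi>: "B \<psi> \<psi> < e"
  proof -
    have "B \<psi> \<psi> = ip (schroedinger V \<psi>) \<psi> - ?m * ip \<psi> \<psi>"
      unfolding B_def schroedinger_shift
      using ip_diff_left[OF test_L2[OF schroedinger_test[OF V(1) \<psi>(1)]] test_L2[OF test_cmult[OF \<psi>(1), of "of_real ?m"]] \<psi>L]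
      by (simp add: ip_scale_left)
    then show ?thesis using \<psi> by (simp add: ip_self)
  qed
  have cs: "(B a \<psi>)\<^sup>2 \<le> B a a * B \<psi> \<psi>" if a: "a \<in> test_functions" for a
  proof (rule discriminant_le)
    fix s :: real
    have s\<psi>: "(\<lambda>t. of_real s * \<psi> t) \<in> test_functions" by (rule test_cmult[OF \<psi>(1)])
    let ?x = "\<lambda>t. a t + of_real s * \<psi> t"
    have x: "?x \<in> test_functions" by (rule test_add[OF a s\<psi>])
    have lin: "B ?x b = B a b + s * B \<psi> b" if b: "b \<in> test_functions" for b
    proof -
      have "?H ?x = (\<lambda>t. ?H a t + of_real s * ?H \<psi> t)"
        by (rule ext) (simp only: schroedinger_add[OF a s\<psi>] schroedinger_cmult[OF \<psi>(1)])
      then have "B ?x b = ip (\<lambda>t. ?H a t + of_real s * ?H \<psi> t) b" unfolding B_def by (rule arg_cong[where f = "\<lambda>h. ip h b"])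
      also have "\<dots> = ip (?H a) b + ip (\<lambda>t. of_real s * ?H \<psi> t) b"
        by (rule ip_add_left[OF test_L2[OF HT[OF a]] test_L2[OF test_cmult[OF HT[OF \<psi>(1)]]] test_L2[OF b]])
      finally show ?thesis by (simp only: ip_scale_left B_def)
    qed
    have sym: "B b d = B d b" if "b \<in> test_functions" "d \<in> test_functions" for b d
      unfolding B_def by (rule schroedinger_symmetric[OF smooth_shift[OF V(1)] that])
    have "0 \<le> B ?x ?x" by (rule Bnn[OF x])
    also have "B ?x ?x = B ?x a + s * B ?x \<psi>"
      using lin[OF x] sym[OF a x] sym[OF \<psi>(1) x] by simp
    also have "\<dots> = B a a + 2 * s * B a \<psi> + s\<^sup>2 * B \<psi> \<psi>"
      using lin[OF a] lin[OF \<psi>(1)] sym[OF a \<psi>(1)] by (simp add: algebra_simps power2_eq_square)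
    finally show "0 \<le> B a a + 2 * s * B a \<psi> + s\<^sup>2 * B \<psi> \<psi>" .
  qed (rule Bnn[OF \<psi>(1)])
  have conv0: "(\<lambda>n. L2_norm (\<lambda>t. ?H (\<phi> n) t - ?w t)) \<longlonglongrightarrow> 0"
    using L2_tendsto_combination[OF \<phi>L(2,1) L(2,1) \<phi>(3,2), of "- of_real ?m"] by (simp add: schroedinger_shift)
  have convH: "(\<lambda>n. L2_norm (?H (\<phi> n))) \<longlonglongrightarrow> L2_norm ?w" by (rule L2_norm_tendsto[OF \<phi>L(3) wL conv0])
  have conv\<phi>: "(\<lambda>n. L2_norm (\<phi> n)) \<longlonglongrightarrow> L2_norm u" by (rule L2_norm_tendsto[OF \<phi>L(1) L(1) \<phi>(2)])
  have convB: "(\<lambda>n. B (\<phi> n) \<psi>) \<longlonglongrightarrow> ip ?w \<psi>"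
  proof (rule LIM_zero_cancel, rule tendsto_rabs_zero_cancel, rule real_tendsto_sandwich[OF _ _ tendsto_const conv0])
    have "\<bar>B (\<phi> n) \<psi> - ip ?w \<psi>\<bar> \<le> L2_norm (\<lambda>t. ?H (\<phi> n) t - ?w t)" for n
      using ip_cauchy_schwarz[OF L2_diff[OF \<phi>L(3) wL] \<psi>L, of n] ip_diff_left[OF \<phi>L(3) wL \<psi>L, of n] \<psi>(2)
      by (simp add: B_def)
    then show "\<forall>\<^sub>F n in sequentially. \<bar>B (\<phi> n) \<psi> - ip ?w \<psi>\<bar> \<le> L2_norm (\<lambda>t. ?H (\<phi> n) t - ?w t)" by simp
  qed simp
  have ipw: "ip ?w \<psi> = 1"
  proof -
    have "ip ?w \<psi> = ip \<psi> \<psi>"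
      unfolding ip_def using uf(2) L2_ip_integrable[OF wL \<psi>L] L2_ip_integrable[OF \<psi>L \<psi>L]
      by (intro integral_cong_AE) (auto simp: borel_measurable_integrable)
    then show ?thesis using \<psi>(2) by (simp add: ip_self)
  qed
  have "(B (\<phi> n) \<psi>)\<^sup>2 \<le> L2_norm (?H (\<phi> n)) * L2_norm (\<phi> n) * e" for n
  proof -
    have "(B (\<phi> n) \<psi>)\<^sup>2 \<le> B (\<phi> n) (\<phi> n) * B \<psi> \<psi>" by (rule cs[OF \<phi>(1)])
    also have "\<dots> \<le> (L2_norm (?H (\<phi> n)) * L2_norm (\<phi> n)) * e"
      using ip_cauchy_schwarz[OF \<phi>L(3) \<phi>L(1), of n n] Bnn[OF \<psi>(1)] B\<psi> L2_norm_nonneg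
      by (intro mult_mono) (auto simp: B_def)
    finally show ?thesis .
  qed
  then have "(ip ?w \<psi>)\<^sup>2 \<le> L2_norm ?w * L2_norm u * e"
    by (intro LIMSEQ_le[OF tendsto_power[OF convB] tendsto_mult[OF tendsto_mult[OF convH conv\<phi>] tendsto_const]])
       (intro exI[of _ 0] allI impI)
  then have "1 \<le> L2_norm u * e" by (simp add: ipw w1)
  also have "L2_norm u \<le> C" using C[OF uf(1)] w1 by simp
  then have "L2_norm u * e \<le> C * e" using e by (intro mult_right_mono) auto
  also have "C * e < 1" by (simp add: e_def field_simps add_nonneg_pos)
  finally show False by simp
qed

lemma least_spectrum_eq_ground:
  assumes V: "smooth (\<lambda>t. of_real (V t))" "\<And>t. V t \<ge> 0"
  shows "(LEAST r. complex_of_real r \<in> spectrum (schroedinger_op V)) = ground_energy V"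
proof (rule Least_equality)
  show "of_real (ground_energy V) \<in> spectrum (schroedinger_op V)" by (rule ground_in_spectrum[OF V])
  fix y assume "complex_of_real y \<in> spectrum (schroedinger_op V)"
  then show "ground_energy V \<le> y"
    using below_ground_in_resolvent[OF V, of y] by (force simp: spectrum_def)
qed


section \<open>Comparison of ground energies\<close>

lemma energy_formula:
  assumes V: "smooth (\<lambda>t. of_real (V t))" and \<phi>: "\<phi> \<in> test_functions"
  shows "ip (schroedinger V \<phi>) \<phi> = (LINT t|lborel. (cmod (vd \<phi> t))\<^sup>2 + V t * (cmod (\<phi> t))\<^sup>2)"
  by (simp add: green_formula[OF V \<phi> \<phi>] power2_norm_eq_inner)

lemma integrable_energy:
  assumes V: "continuous_on UNIV V" and \<phi>: "\<phi> \<in> test_functions"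
  shows "integrable lborel (\<lambda>t. (cmod (vd \<phi> t))\<^sup>2 + V t * (cmod (\<phi> t))\<^sup>2)"
  using ccont_add[OF ccont_norm2[OF test_ccont[OF test_vd[OF \<phi>]]] ccont_mult_left[OF V ccont_norm2[OF test_ccont[OF \<phi>]]]]
  by (intro integrable_ccont) simp

lemma ground_mono:
  assumes V: "smooth (\<lambda>t. of_real (V t))" "\<And>t. V t \<ge> 0" and W: "smooth (\<lambda>t. of_real (W t))"
    and le: "\<And>t. V t \<le> W t"
  shows "ground_energy V \<le> ground_energy W"
proof (rule ground_greatest)
  fix \<phi> assume \<phi>: "\<phi> \<in> test_functions" "L2_norm \<phi> = 1"
  have "ground_energy V \<le> ip (schroedinger V \<phi>) \<phi>" using ground_le_energy[OF V \<phi>(1)] \<phi>(2) by simp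
  also have "\<dots> \<le> ip (schroedinger W \<phi>) \<phi>"
    unfolding energy_formula[OF V(1) \<phi>(1)] energy_formula[OF W \<phi>(1)]
    by (intro integral_mono integrable_energy smooth_real_continuous V W \<phi> add_left_mono mult_right_mono le) simp
  finally show "ground_energy V \<le> ip (schroedinger W \<phi>) \<phi>" .
qed

text \<open>
  The inequality \<open>\<integral>|\<phi>' + f \<phi>|\<^sup>2 \<ge> 0\<close> says, after integrating \<open>(f |\<phi>|\<^sup>2)'\<close>, that
  \<open>\<integral>|\<phi>'|\<^sup>2 \<ge> \<integral>(f' - f\<^sup>2) |\<phi>|\<^sup>2\<close>. A function \<open>f\<close> that increases steeply where \<open>V\<close> is small thus turns kinetic
  energy into a pointwise lower bound.
\<close>

lemma riccati_lower_bound: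
  assumes V: "smooth (\<lambda>t. of_real (V t))"
    and f: "\<And>t. (f has_real_derivative f' t) (at t)" "continuous_on UNIV f'"
    and M: "\<And>t. M \<le> V t + f' t - (f t)\<^sup>2"
  shows "M \<le> ground_energy V"
proof (rule ground_greatest)
  fix \<phi> assume \<phi>: "\<phi> \<in> test_functions" "L2_norm \<phi> = 1"
  have cf: "continuous_on UNIV f"
    using f(1) by (auto intro!: continuous_at_imp_continuous_on DERIV_isCont)
  have c\<phi>: "continuous_on UNIV \<phi>" "continuous_on UNIV (vd \<phi>)"
    using \<phi>(1) test_smooth smooth_vd smooth_continuous by auto
  define F where "F t = f t * (\<phi> t \<bullet> \<phi> t)" for t
  define F' where "F' t = f t * (2 * (\<phi> t \<bullet> vd \<phi> t)) + f' t * (\<phi> t \<bullet> \<phi> t)" for t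
  have F: "(F has_vector_derivative F' t) (at t)" for t
  proof -
    have "((\<lambda>t. \<phi> t \<bullet> \<phi> t) has_real_derivative \<phi> t \<bullet> vd \<phi> t + vd \<phi> t \<bullet> \<phi> t) (at t)"
      unfolding has_real_derivative_iff_has_vector_derivative by (intro inner_has_vd test_has_vd \<phi>)
    from DERIV_mult[OF f(1)[of t] this] show ?thesis
      unfolding has_real_derivative_iff_has_vector_derivative[symmetric] F_def F'_def
      by (simp add: inner_commute algebra_simps)
  qed
  have c: "ccont (\<lambda>t. \<phi> t \<bullet> \<phi> t)" "ccont (\<lambda>t. vd \<phi> t \<bullet> \<phi> t)" by (intro ccont_inner c\<phi> test_ccont \<phi>)+
  have cF: "ccont F" unfolding F_def using ccont_mult_left[OF cf c(1)] by simp
  have cF': "ccont F'"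
    unfolding F'_def
    using ccont_add[OF ccont_mult_left[OF continuous_on_mult_left[OF cf, of 2] c(2)] ccont_mult_left[OF f(2) c(1)]]
    by (simp add: inner_commute algebra_simps)
  have int0: "(LINT t|lborel. F' t) = 0" by (rule integral_derivative_ccont[OF F cF cF'])
  have iF': "integrable lborel F'" by (rule integrable_ccont[OF cF'])
  have i\<phi>: "integrable lborel (\<lambda>t. M * (cmod (\<phi> t))\<^sup>2)" using L2_integrable[OF test_L2[OF \<phi>(1)]] by simp
  have pw: "M * (cmod (\<phi> t))\<^sup>2 - F' t \<le> (cmod (vd \<phi> t))\<^sup>2 + V t * (cmod (\<phi> t))\<^sup>2" for t
  proof -
    have "0 \<le> (vd \<phi> t + f t *\<^sub>R \<phi> t) \<bullet> (vd \<phi> t + f t *\<^sub>R \<phi> t)" by simp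
    also have "\<dots> = (cmod (vd \<phi> t))\<^sup>2 + 2 * (f t * (\<phi> t \<bullet> vd \<phi> t)) + (f t)\<^sup>2 * (cmod (\<phi> t))\<^sup>2"
      unfolding power2_norm_eq_inner
      by (simp add: inner_add_left inner_add_right inner_commute power2_eq_square algebra_simps)
    finally have 1: "0 \<le> (cmod (vd \<phi> t))\<^sup>2 + 2 * (f t * (\<phi> t \<bullet> vd \<phi> t)) + (f t)\<^sup>2 * (cmod (\<phi> t))\<^sup>2" .
    have 2: "F' t = 2 * (f t * (\<phi> t \<bullet> vd \<phi> t)) + f' t * (cmod (\<phi> t))\<^sup>2"
      by (simp add: F'_def power2_norm_eq_inner)
    have "M * (cmod (\<phi> t))\<^sup>2 \<le> (V t + f' t - (f t)\<^sup>2) * (cmod (\<phi> t))\<^sup>2" by (intro mult_right_mono M) simp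
    then have "M * (cmod (\<phi> t))\<^sup>2 \<le> V t * (cmod (\<phi> t))\<^sup>2 + f' t * (cmod (\<phi> t))\<^sup>2 - (f t)\<^sup>2 * (cmod (\<phi> t))\<^sup>2"
      by (simp add: algebra_simps)
    then show ?thesis using 1 2 by linarith
  qed
  have "M = M * (L2_norm \<phi>)\<^sup>2" using \<phi>(2) by simp
  also have "\<dots> = (LINT t|lborel. M * (cmod (\<phi> t))\<^sup>2) - (LINT t|lborel. F' t)" by (simp add: L2_norm_sq int0)
  also have "\<dots> = (LINT t|lborel. M * (cmod (\<phi> t))\<^sup>2 - F' t)"
    by (rule Bochner_Integration.integral_diff[symmetric, OF i\<phi> iF'])
  also have "\<dots> \<le> ip (schroedinger V \<phi>) \<phi>"
    unfolding energy_formula[OF V \<phi>(1)]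
    by (intro integral_mono Bochner_Integration.integrable_diff i\<phi> iF' integrable_energy smooth_real_continuous V \<phi> pw)
  finally show "M \<le> ip (schroedinger V \<phi>) \<phi>" .
qed

text \<open>
  If the potentials differ by at most \<open>k (1 + V)\<close>, then so do the energies of each normalized test function, with the energy
  in place of \<open>V\<close>; passing to infima gives the same bound for the ground energies.
\<close>

lemma ground_perturbation:
  assumes V: "smooth (\<lambda>t. of_real (V t))" "\<And>t. V t \<ge> 0" and W: "smooth (\<lambda>t. of_real (W t))" "\<And>t. W t \<ge> 0"
    and k: "0 \<le> k" "k \<le> 1" and le: "\<And>t. \<bar>W t - V t\<bar> \<le> k * (1 + V t)"
  shows "\<bar>ground_energy W - ground_energy V\<bar> \<le> k * (1 + ground_energy V)"
proof -
  have E: "\<bar>ip (schroedinger W \<phi>) \<phi> - ip (schroedinger V \<phi>) \<phi>\<bar> \<le> k * (1 + ip (schroedinger V \<phi>) \<phi>)"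
    if \<phi>: "\<phi> \<in> test_functions" "L2_norm \<phi> = 1" for \<phi>
  proof -
    have i: "integrable lborel (\<lambda>t. (cmod (vd \<phi> t))\<^sup>2 + U t * (cmod (\<phi> t))\<^sup>2)" if "smooth (\<lambda>t. of_real (U t))" for U
      by (intro integrable_energy smooth_real_continuous that \<phi>)
    have i2: "integrable lborel (\<lambda>t. (cmod (\<phi> t))\<^sup>2)" by (intro L2_integrable test_L2 \<phi>)
    have eq: "ip (schroedinger W \<phi>) \<phi> - ip (schroedinger V \<phi>) \<phi> = (LINT t|lborel. ((cmod (vd \<phi> t))\<^sup>2 + W t * (cmod (\<phi> t))\<^sup>2) - ((cmod (vd \<phi> t))\<^sup>2 + V t * (cmod (\<phi> t))\<^sup>2))"
      unfolding energy_formula[OF V(1) \<phi>(1)] energy_formula[OF W(1) \<phi>(1)]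
      by (rule Bochner_Integration.integral_diff[symmetric, OF i[OF W(1)] i[OF V(1)]])
    have "\<bar>ip (schroedinger W \<phi>) \<phi> - ip (schroedinger V \<phi>) \<phi>\<bar>
        \<le> (LINT t|lborel. \<bar>((cmod (vd \<phi> t))\<^sup>2 + W t * (cmod (\<phi> t))\<^sup>2) - ((cmod (vd \<phi> t))\<^sup>2 + V t * (cmod (\<phi> t))\<^sup>2)\<bar>)"
      unfolding eq by (rule integral_abs_bound)
    also have "\<dots> \<le> (LINT t|lborel. k * ((cmod (\<phi> t))\<^sup>2 + ((cmod (vd \<phi> t))\<^sup>2 + V t * (cmod (\<phi> t))\<^sup>2)))"
    proof (intro integral_mono)
      show "integrable lborel (\<lambda>t. \<bar>((cmod (vd \<phi> t))\<^sup>2 + W t * (cmod (\<phi> t))\<^sup>2) - ((cmod (vd \<phi> t))\<^sup>2 + V t * (cmod (\<phi> t))\<^sup>2)\<bar>)"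
        by (intro integrable_abs Bochner_Integration.integrable_diff i V W)
      show "integrable lborel (\<lambda>t. k * ((cmod (\<phi> t))\<^sup>2 + ((cmod (vd \<phi> t))\<^sup>2 + V t * (cmod (\<phi> t))\<^sup>2)))"
        by (intro integrable_mult_right Bochner_Integration.integrable_add[OF i2 i[OF V(1)]])
      fix t
      have "\<bar>((cmod (vd \<phi> t))\<^sup>2 + W t * (cmod (\<phi> t))\<^sup>2) - ((cmod (vd \<phi> t))\<^sup>2 + V t * (cmod (\<phi> t))\<^sup>2)\<bar> = \<bar>(W t - V t) * (cmod (\<phi> t))\<^sup>2\<bar>"
        by (simp add: left_diff_distrib)
      also have "\<dots> = \<bar>W t - V t\<bar> * (cmod (\<phi> t))\<^sup>2" by (simp add: abs_mult)
      also have "\<dots> \<le> k * (1 + V t) * (cmod (\<phi> t))\<^sup>2" by (intro mult_right_mono le) simp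
      also have "\<dots> = k * ((cmod (\<phi> t))\<^sup>2 + V t * (cmod (\<phi> t))\<^sup>2)" by (simp add: algebra_simps)
      also have "\<dots> \<le> k * ((cmod (\<phi> t))\<^sup>2 + ((cmod (vd \<phi> t))\<^sup>2 + V t * (cmod (\<phi> t))\<^sup>2))"
        by (intro mult_left_mono k) simp
      finally show "\<bar>((cmod (vd \<phi> t))\<^sup>2 + W t * (cmod (\<phi> t))\<^sup>2) - ((cmod (vd \<phi> t))\<^sup>2 + V t * (cmod (\<phi> t))\<^sup>2)\<bar>
         \<le> k * ((cmod (\<phi> t))\<^sup>2 + ((cmod (vd \<phi> t))\<^sup>2 + V t * (cmod (\<phi> t))\<^sup>2))" .
    qed
    also have "\<dots> = k * ((L2_norm \<phi>)\<^sup>2 + ip (schroedinger V \<phi>) \<phi>)"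
      unfolding energy_formula[OF V(1) \<phi>(1)] L2_norm_sq
      by (simp only: integral_mult_right_zero Bochner_Integration.integral_add[OF i2 i[OF V(1)]])
    finally show ?thesis using \<phi>(2) by simp
  qed
  have "(ground_energy W - k) / (1 + k) \<le> ground_energy V"
  proof (rule ground_greatest)
    fix \<phi> assume \<phi>: "\<phi> \<in> test_functions" "L2_norm \<phi> = 1"
    have "ground_energy W \<le> ip (schroedinger W \<phi>) \<phi>" using ground_le_energy[OF W \<phi>(1)] \<phi>(2) by simp
    then have "ground_energy W - k \<le> ip (schroedinger V \<phi>) \<phi> * (1 + k)"
      using E[OF \<phi>] by (simp add: algebra_simps)
    then show "(ground_energy W - k) / (1 + k) \<le> ip (schroedinger V \<phi>) \<phi>" using k by (simp add: pos_divide_le_eq)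
  qed
  then have 1: "ground_energy W - ground_energy V \<le> k * (1 + ground_energy V)" using k by (simp add: pos_divide_le_eq algebra_simps)
  have "(1 - k) * ground_energy V - k \<le> ground_energy W"
  proof (rule ground_greatest)
    fix \<phi> assume \<phi>: "\<phi> \<in> test_functions" "L2_norm \<phi> = 1"
    have "ground_energy V \<le> ip (schroedinger V \<phi>) \<phi>" using ground_le_energy[OF V \<phi>(1)] \<phi>(2) by simp
    then have "(1 - k) * ground_energy V \<le> (1 - k) * ip (schroedinger V \<phi>) \<phi>" using k by (intro mult_left_mono) auto
    then show "(1 - k) * ground_energy V - k \<le> ip (schroedinger W \<phi>) \<phi>" using E[OF \<phi>] by (simp add: algebra_simps)
  qed
  then have 2: "ground_energy V - ground_energy W \<le> k * (1 + ground_energy V)" by (simp add: algebra_simps)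
  show ?thesis using 1 2 by linarith
qed

section \<open>The potentials of the family\<close>

definition pot :: "real \<Rightarrow> real \<Rightarrow> real \<Rightarrow> real" where
  "pot \<alpha> \<xi> t = (\<xi> + \<alpha>\<^sup>2 * t - t ^ 3 / 3)\<^sup>2"

lemma pot_nonneg: "pot \<alpha> \<xi> t \<ge> 0"
  by (simp add: pot_def)

lemma smooth_pot: "smooth (\<lambda>t. of_real (pot \<alpha> \<xi> t))"
proof -
  have "smooth (\<lambda>t. (of_real \<xi> + of_real (\<alpha>\<^sup>2) * of_real t - of_real (1/3) * of_real t ^ 3) ^ 2)"
    by (intro smooth_power smooth_diff smooth_add smooth_mult smooth_const smooth_of_real)
  then show ?thesis by (simp add: pot_def)
qed

lemma X_expr_eq_schroedinger:
  assumes "smooth u" shows "X_expr \<alpha> \<xi> u = schroedinger (pot \<alpha> \<xi>) u"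
proof
  fix t
  have "D_t (D_t u) t = - \<i> * vd (\<lambda>t. - \<i> * vd u t) t" unfolding D_t_def ..
  also have "\<dots> = - vd (vd u) t" by (simp only: vd_cmult[OF smooth_vd[OF assms]]) simp
  finally show "X_expr \<alpha> \<xi> u t = schroedinger (pot \<alpha> \<xi>) u t"
    by (simp add: X_expr_def schroedinger_def pot_def)
qed

lemma X_op_eq_schroedinger_op: "X_op \<alpha> \<xi> = schroedinger_op (pot \<alpha> \<xi>)"
proof -
  have "X_expr \<alpha> \<xi> (\<phi> n) = schroedinger (pot \<alpha> \<xi>) (\<phi> n)" if "\<forall>n. \<phi> n \<in> test_functions" for \<phi> and n :: nat
    using that by (intro X_expr_eq_schroedinger test_smooth) simp
  then have eq: "(\<exists>\<phi>. (\<forall>n::nat. \<phi> n \<in> test_functions) \<and> P \<phi> \<and> (\<lambda>n. L2_norm (\<lambda>t. X_expr \<alpha> \<xi> (\<phi> n) t - f t)) \<longlonglongrightarrow> 0) \<longleftrightarrow>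
      (\<exists>\<phi>. (\<forall>n::nat. \<phi> n \<in> test_functions) \<and> P \<phi> \<and> (\<lambda>n. L2_norm (\<lambda>t. schroedinger (pot \<alpha> \<xi>) (\<phi> n) t - f t)) \<longlonglongrightarrow> 0)" for P f
    by (intro ex_cong1 conj_cong refl) simp
  show ?thesis
    unfolding X_op_def schroedinger_op_def eq ..
qed

lemma rho1_eq_ground: "rho1 \<alpha> \<xi> = ground_energy (pot \<alpha> \<xi>)"
  unfolding rho1_def X_op_eq_schroedinger_op by (rule least_spectrum_eq_ground[OF smooth_pot pot_nonneg])

text \<open>
  At \<open>t = 2|\<alpha>|\<close> the cubic takes the value \<open>\<xi> - 2/3 |\<alpha>|\<^sup>3\<close>; its root beyond this point is the one
  kept fixed in the reduction.
\<close>

lemma far_root_exists_nonneg: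
  fixes \<alpha> \<xi> :: real
  assumes "\<xi> \<ge> 2 / 3 * \<bar>\<alpha>\<bar> ^ 3"
  shows "\<exists>t\<ge>2 * \<bar>\<alpha>\<bar>. \<xi> + \<alpha>\<^sup>2 * t - t ^ 3 / 3 = 0"
proof -
  define a where "a = \<bar>\<alpha>\<bar>"
  have a: "a \<ge> 0" "\<alpha>\<^sup>2 = a\<^sup>2" by (auto simp: a_def)
  have "a ^ 3 \<ge> 0" using a(1) by simp
  then have \<xi>: "\<xi> \<ge> 2 / 3 * a ^ 3" "\<xi> \<ge> 0"
    using assms unfolding a_def by linarith+
  define k where "k = \<xi> + 3"
  \<comment> \<open>Far enough to the right for the cubic to be negative.\<close>
  define T where "T = 2 * a + k"
  have k: "k \<ge> 3" using \<xi> by (simp add: k_def)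
  have "\<exists>t\<ge>2 * a. t \<le> T \<and> \<xi> + a\<^sup>2 * t - t ^ 3 / 3 = 0"
  proof (rule IVT2)
    have "T ^ 3 / 3 - a\<^sup>2 * T = k ^ 3 / 3 + (2/3 * a ^ 3 + 3 * a\<^sup>2 * k + 2 * a * k\<^sup>2)"
      by (simp add: T_def power3_eq_cube power2_eq_square algebra_simps)
    moreover have "0 \<le> 2/3 * a ^ 3 + 3 * a\<^sup>2 * k + 2 * a * k\<^sup>2" using a(1) k by simp
    moreover have "k ^ 3 / 3 \<ge> k"
    proof -
      have "3 * 1 * k \<le> k * k * k" using k by (intro mult_mono) auto
      then show ?thesis by (simp add: power3_eq_cube)
    qed
    ultimately show "\<xi> + a\<^sup>2 * T - T ^ 3 / 3 \<le> 0" by (simp add: k_def)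
    show "0 \<le> \<xi> + a\<^sup>2 * (2 * a) - (2 * a) ^ 3 / 3"
      using \<xi>(1) by (simp add: power3_eq_cube power2_eq_square)
    show "2 * a \<le> T" using k by (simp add: T_def)
    show "\<forall>x. 2 * a \<le> x \<and> x \<le> T \<longrightarrow> isCont (\<lambda>t. \<xi> + a\<^sup>2 * t - t ^ 3 / 3) x" by simp
  qed
  then show ?thesis unfolding a(2) using a_def by auto
qed

lemma far_root_exists:
  fixes \<alpha> \<xi> :: real
  assumes "\<bar>\<xi>\<bar> \<ge> 2 / 3 * \<bar>\<alpha>\<bar> ^ 3"
  shows "\<exists>t. \<bar>t\<bar> \<ge> 2 * \<bar>\<alpha>\<bar> \<and> \<xi> + \<alpha>\<^sup>2 * t - t ^ 3 / 3 = 0"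
proof (cases "\<xi> \<ge> 0")
  case True
  then show ?thesis using far_root_exists_nonneg[of \<alpha> \<xi>] assms by force
next
  case False
  then obtain t where "t \<ge> 2 * \<bar>\<alpha>\<bar>" "- \<xi> + \<alpha>\<^sup>2 * t - t ^ 3 / 3 = 0"
    using far_root_exists_nonneg[of \<alpha> "- \<xi>"] assms by auto
  then show ?thesis by (intro exI[of _ "- t"]) (auto simp: power3_eq_cube)
qed

text \<open>
  Dividing by the root \<open>z\<close> gives
  \<open>p = - (t - z) ((t + z/2)\<^sup>2 / 3 + (z\<^sup>2/4 - \<alpha>\<^sup>2))\<close>, where \<open>z\<^sup>2/4 - \<alpha>\<^sup>2 \<ge> 0\<close> because \<open>|z| \<ge> 2|\<alpha>|\<close>. Dropping
  this constant does not increase \<open>|p|\<close> and leaves the cubic with parameters \<open>\<alpha>' = z/2\<close> and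
  \<open>\<xi>' = z\<^sup>3/12\<close>, for which \<open>|\<xi>'| = 2/3 |\<alpha>'|\<^sup>3\<close>.
\<close>

lemma pot_reduction:
  "\<exists>\<alpha>' \<xi>'. \<bar>\<xi>'\<bar> \<le> 2 / 3 * \<bar>\<alpha>'\<bar> ^ 3 \<and> (\<forall>t. pot \<alpha>' \<xi>' t \<le> pot \<alpha> \<xi> t)"
proof (cases "\<bar>\<xi>\<bar> \<le> 2 / 3 * \<bar>\<alpha>\<bar> ^ 3")
  case False
  then obtain z where z: "\<bar>z\<bar> \<ge> 2 * \<bar>\<alpha>\<bar>" "\<xi> + \<alpha>\<^sup>2 * z - z ^ 3 / 3 = 0"
    using far_root_exists[of \<alpha> \<xi>] by auto
  have "(2 * \<bar>\<alpha>\<bar>)\<^sup>2 \<le> \<bar>z\<bar>\<^sup>2" using z(1) by (intro power_mono) auto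
  then have B: "0 \<le> z\<^sup>2 / 4 - \<alpha>\<^sup>2" by (simp add: power_mult_distrib)
  have "pot (z / 2) (z ^ 3 / 12) t \<le> pot \<alpha> \<xi> t" for t
  proof -
    have 1: "z ^ 3 / 12 + (z / 2)\<^sup>2 * t - t ^ 3 / 3 = - (t - z) * ((t + z / 2)\<^sup>2 / 3)"
      by (simp add: power2_eq_square power3_eq_cube field_simps)
    have "\<xi> + \<alpha>\<^sup>2 * t - t ^ 3 / 3 = (\<xi> + \<alpha>\<^sup>2 * t - t ^ 3 / 3) - (\<xi> + \<alpha>\<^sup>2 * z - z ^ 3 / 3)" using z(2) by simp
    also have "\<dots> = - (t - z) * ((t + z / 2)\<^sup>2 / 3 + (z\<^sup>2 / 4 - \<alpha>\<^sup>2))"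
      by (simp add: power2_eq_square power3_eq_cube field_simps)
    finally have 2: "\<xi> + \<alpha>\<^sup>2 * t - t ^ 3 / 3 = - (t - z) * ((t + z / 2)\<^sup>2 / 3 + (z\<^sup>2 / 4 - \<alpha>\<^sup>2))" .
    show ?thesis
      unfolding pot_def 1 2 power_mult_distrib using B by (intro mult_left_mono power_mono) auto
  qed
  moreover have "\<bar>z ^ 3 / 12\<bar> \<le> 2 / 3 * \<bar>z / 2\<bar> ^ 3" by (simp add: power_abs[symmetric] power_divide abs_mult)
  ultimately show ?thesis by blast
qed blast

text \<open>
  The two outer roots are found in \<open>[-2\<alpha>, -\<alpha>]\<close> and \<open>[\<alpha>, 2\<alpha>]\<close>. They are distinct, so they determine
  \<open>\<alpha>\<^sup>2\<close> and \<open>\<xi>\<close>, and the third root is minus their sum. This covers double roots as well.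
\<close>

lemma cubic_factorization:
  fixes \<alpha> \<xi> :: real
  assumes \<alpha>: "\<alpha> > 0" and \<xi>: "\<bar>\<xi>\<bar> \<le> 2 / 3 * \<alpha> ^ 3"
  shows "\<exists>a b c. c - a \<ge> 2 * \<alpha> \<and> (\<forall>t. \<xi> + \<alpha>\<^sup>2 * t - t ^ 3 / 3 = - ((t - a) * (t - b) * (t - c) / 3))"
proof -
  have "\<exists>a\<ge>-2 * \<alpha>. a \<le> - \<alpha> \<and> \<xi> + \<alpha>\<^sup>2 * a - a ^ 3 / 3 = 0"
    by (rule IVT2) (use \<alpha> \<xi> in \<open>auto simp: power2_eq_square power3_eq_cube\<close>)
  then obtain a where a: "a \<le> - \<alpha>" "\<xi> + \<alpha>\<^sup>2 * a - a ^ 3 / 3 = 0" by blast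
  have "\<exists>c\<ge>\<alpha>. c \<le> 2 * \<alpha> \<and> \<xi> + \<alpha>\<^sup>2 * c - c ^ 3 / 3 = 0"
    by (rule IVT2) (use \<alpha> \<xi> in \<open>auto simp: power2_eq_square power3_eq_cube\<close>)
  then obtain c where c: "\<alpha> \<le> c" "\<xi> + \<alpha>\<^sup>2 * c - c ^ 3 / 3 = 0" by blast
  have "(c - a) * (\<alpha>\<^sup>2 - (a\<^sup>2 + a * c + c\<^sup>2) / 3) = (\<xi> + \<alpha>\<^sup>2 * c - c ^ 3 / 3) - (\<xi> + \<alpha>\<^sup>2 * a - a ^ 3 / 3)"
    by (simp add: power2_eq_square power3_eq_cube field_simps)
  then have "\<alpha>\<^sup>2 - (a\<^sup>2 + a * c + c\<^sup>2) / 3 = 0" using a c \<alpha> by simp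
  then have \<alpha>2: "\<alpha>\<^sup>2 = (a\<^sup>2 + a * c + c\<^sup>2) / 3" by simp
  have \<xi>2: "\<xi> = a ^ 3 / 3 - \<alpha>\<^sup>2 * a" using a(2) by simp
  have "\<xi> + \<alpha>\<^sup>2 * t - t ^ 3 / 3 = - ((t - a) * (t - (- a - c)) * (t - c) / 3)" for t
    unfolding \<xi>2 \<alpha>2 by (simp add: power2_eq_square power3_eq_cube field_simps)
  then show ?thesis using a c by (intro exI[of _ a] exI[of _ "- a - c"] exI[of _ c]) auto
qed

text \<open>
  The building block for \<open>f\<close> in \<open>riccati_lower_bound\<close>: \<open>g x = K x / (1 + (x/w)\<^sup>2)\<close> is small,
  of size \<open>K w\<close>, yet has a slope of order \<open>K\<close> near the origin, at the price of a slope no worse than \<open>-K/8\<close>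
  elsewhere.
\<close>

lemma barrier_exists:
  assumes K: "K > 0" and w: "w > 0"
  shows "\<exists>g g'. (\<forall>x. (g has_real_derivative g' x) (at x)) \<and> continuous_on UNIV g' \<and>
    (\<forall>x. \<bar>g x\<bar> \<le> K * w / 2) \<and> (\<forall>x. g' x \<ge> - K / 8) \<and> (\<forall>x. \<bar>x\<bar> \<le> w / 2 \<longrightarrow> g' x \<ge> 12 / 25 * K)"
proof -
  define g where "g x = K * x / (1 + (x / w)\<^sup>2)" for x
  define h where "h y = K * ((1 - y) / (1 + y)\<^sup>2)" for y :: real
  have pos: "1 + (x / w)\<^sup>2 > 0" for x :: real by (simp add: add_pos_nonneg)
  have "(g has_real_derivative h ((x / w)\<^sup>2)) (at x)" for x
  proof -
    have "(g has_real_derivative (K * (1 + (x / w)\<^sup>2) - K * x * (2 * (x / w) * (1 / w))) / ((1 + (x / w)\<^sup>2) * (1 + (x / w)\<^sup>2))) (at x)"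
      unfolding g_def using pos[of x] w
      by (auto intro!: derivative_eq_intros simp: power2_eq_square)
    moreover have "K * (1 + (x / w)\<^sup>2) - K * x * (2 * (x / w) * (1 / w)) = K * (1 - (x / w)\<^sup>2)"
      by (simp add: power2_eq_square algebra_simps)
    ultimately show ?thesis by (simp add: h_def power2_eq_square)
  qed
  moreover have "continuous_on UNIV (\<lambda>x. h ((x / w)\<^sup>2))"
    unfolding h_def using pos w by (intro continuous_intros) (auto simp: less_imp_neq[symmetric])
  moreover have "\<bar>g x\<bar> \<le> K * w / 2" for x
  proof -
    have "0 \<le> (\<bar>x\<bar> / w - 1)\<^sup>2" by simp
    then have "2 * (\<bar>x\<bar> / w) \<le> 1 + (x / w)\<^sup>2" by (simp add: power2_diff power_divide)
    then have "\<bar>x\<bar> \<le> w / 2 * (1 + (x / w)\<^sup>2)" using w by (simp add: field_simps)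
    then have "K * \<bar>x\<bar> \<le> K * (w / 2 * (1 + (x / w)\<^sup>2))" using K by (intro mult_left_mono) auto
    then have "K * \<bar>x\<bar> / (1 + (x / w)\<^sup>2) \<le> K * w / 2" using pos[of x] by (simp add: pos_divide_le_eq)
    then show ?thesis using K pos[of x] by (simp add: g_def abs_mult)
  qed
  moreover have "h y \<ge> - K / 8" if "y \<ge> 0" for y
  proof -
    have "0 \<le> (y - 3)\<^sup>2" by simp
    then have "- ((1 + y)\<^sup>2) \<le> 8 * (1 - y)" by (simp add: power2_eq_square algebra_simps)
    then have "- (1 / 8) \<le> (1 - y) / (1 + y)\<^sup>2" using that by (simp add: pos_le_divide_eq)
    then have "K * - (1 / 8) \<le> h y" unfolding h_def using K by (intro mult_left_mono) auto
    then show ?thesis by simp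
  qed
  moreover have "h ((x / w)\<^sup>2) \<ge> 12 / 25 * K" if x: "\<bar>x\<bar> \<le> w / 2" for x
  proof -
    define y where "y = (x / w)\<^sup>2"
    have "\<bar>x\<bar> / w \<le> 1 / 2" using x w by (simp add: field_simps)
    then have "(\<bar>x\<bar> / w)\<^sup>2 \<le> (1 / 2)\<^sup>2" using w by (intro power_mono) auto
    then have y: "0 \<le> y" "y \<le> 1 / 4" by (auto simp: y_def power_divide)
    have "(1 + y)\<^sup>2 \<le> (5 / 4)\<^sup>2" using y by (intro power_mono) auto
    then have "12 / 25 * (1 + y)\<^sup>2 \<le> 3 / 4" by (simp add: power2_eq_square)
    also have "\<dots> \<le> 1 - y" using y by simp
    finally have "12 / 25 \<le> (1 - y) / (1 + y)\<^sup>2" using y by (simp add: pos_le_divide_eq)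
    then have "K * (12 / 25) \<le> h y" unfolding h_def using K by (intro mult_left_mono) auto
    then show ?thesis by (simp add: y_def)
  qed
  ultimately show ?thesis
    by (intro exI[of _ g] exI[of _ "\<lambda>x. h ((x / w)\<^sup>2)"]) simp
qed

text \<open>
  Use as \<open>f\<close> the sum of one barrier centred at each root. Within \<open>w/2\<close> of a root,
  \<open>f' \<ge> (12/25 - 2/8) K\<close>, which exceeds \<open>M\<close> by more than \<open>f\<^sup>2\<close>. Away from all the roots
  \<open>f'\<close> may be as low as \<open>-3K/8\<close>, but there \<open>|p| \<ge> |\<alpha>| \<delta>\<^sup>2 / 3\<close>, since one of the outer roots is at distance
  at least \<open>|\<alpha>|\<close>.
\<close>

lemma ground_pot_coercive:
  assumes M: "M \<ge> 1"
  shows "\<exists>A>0. \<forall>\<alpha> \<xi>. \<bar>\<alpha>\<bar> \<ge> A \<longrightarrow> \<bar>\<xi>\<bar> \<le> 2 / 3 * \<bar>\<alpha>\<bar> ^ 3 \<longrightarrow> M \<le> ground_energy (pot \<alpha> \<xi>)"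
proof -
  define K where "K = 5 * M"
  \<comment> \<open>The width is chosen such that \<open>K w / 2 = 1/8\<close>, which bounds \<open>f\<^sup>2\<close> by \<open>9/64\<close>.\<close>
  define w where "w = 1 / (20 * M)"
  define \<delta> where "\<delta> = w / 2"
  \<comment> \<open>Away from the roots this gives \<open>|p| \<ge> 2 M\<close>, hence \<open>V \<ge> 4 M\<close>.\<close>
  define A where "A = 6 * M / \<delta>\<^sup>2"
  have pos: "K > 0" "w > 0" "\<delta> > 0" "A > 0" using M by (auto simp: K_def w_def \<delta>_def A_def)
  obtain g g' where g: "\<And>x. (g has_real_derivative g' x) (at x)" "continuous_on UNIV g'"
    "\<And>x. \<bar>g x\<bar> \<le> K * w / 2" "\<And>x. g' x \<ge> - K / 8" "\<And>x. \<bar>x\<bar> \<le> w / 2 \<Longrightarrow> g' x \<ge> 12 / 25 * K"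
    using barrier_exists[OF pos(1,2)] by blast
  have Kw: "K * w / 2 = 1 / 8" using M by (simp add: K_def w_def)
  have "M \<le> ground_energy (pot \<alpha> \<xi>)" if \<alpha>: "\<bar>\<alpha>\<bar> \<ge> A" and \<xi>: "\<bar>\<xi>\<bar> \<le> 2 / 3 * \<bar>\<alpha>\<bar> ^ 3" for \<alpha> \<xi>
  proof -
    have "\<bar>\<alpha>\<bar> > 0" using \<alpha> pos by linarith
    then obtain a b c where abc: "c - a \<ge> 2 * \<bar>\<alpha>\<bar>"
      "\<And>t. \<xi> + \<alpha>\<^sup>2 * t - t ^ 3 / 3 = - ((t - a) * (t - b) * (t - c) / 3)"
      using cubic_factorization[of "\<bar>\<alpha>\<bar>" \<xi>] \<xi> by auto
    define f where "f t = g (t - a) + g (t - b) + g (t - c)" for t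
    define f' where "f' t = g' (t - a) + g' (t - b) + g' (t - c)" for t
    have shift: "((\<lambda>t. g (t - r)) has_real_derivative g' (t - r)) (at t)" for t r
    proof -
      have "((\<lambda>t. t - r) has_real_derivative 1) (at t)" by (auto intro!: derivative_eq_intros)
      from DERIV_chain2[OF g(1) this] show ?thesis by simp
    qed
    show ?thesis
    proof (rule riccati_lower_bound[OF smooth_pot])
      show "(f has_real_derivative f' t) (at t)" for t
        unfolding f_def f'_def by (intro DERIV_add shift)
      have "continuous_on UNIV (\<lambda>t. g' (t - r))" for r
        by (rule continuous_on_compose2[OF g(2)]) (auto intro!: continuous_intros)
      then show "continuous_on UNIV f'" unfolding f'_def by (intro continuous_on_add)
      fix t
      have "\<bar>f t\<bar> \<le> 3 / 8"
        using g(3)[of "t - a"] g(3)[of "t - b"] g(3)[of "t - c"] unfolding Kw f_def by linarith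
      then have "\<bar>f t\<bar>\<^sup>2 \<le> (3 / 8)\<^sup>2" by (intro power_mono) auto
      then have f2: "(f t)\<^sup>2 \<le> 9 / 64" by (simp add: power_divide)
      note lower = g(4)[of "t - a"] g(4)[of "t - b"] g(4)[of "t - c"]
      show "M \<le> pot \<alpha> \<xi> t + f' t - (f t)\<^sup>2"
      proof (cases "\<bar>t - a\<bar> \<le> w / 2 \<or> \<bar>t - b\<bar> \<le> w / 2 \<or> \<bar>t - c\<bar> \<le> w / 2")
        case True
        then have "f' t \<ge> 12 / 25 * K - K / 8 - K / 8"
          using g(5)[of "t - a"] g(5)[of "t - b"] g(5)[of "t - c"] lower unfolding f'_def by linarith
        then show ?thesis using f2 pot_nonneg[of \<alpha> \<xi> t] M unfolding K_def by linarith
      next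
        case False
        then have far: "\<bar>t - a\<bar> \<ge> \<delta>" "\<bar>t - b\<bar> \<ge> \<delta>" "\<bar>t - c\<bar> \<ge> \<delta>" by (auto simp: \<delta>_def)
        have "\<bar>t - a\<bar> \<ge> \<bar>\<alpha>\<bar> \<or> \<bar>t - c\<bar> \<ge> \<bar>\<alpha>\<bar>" using abc(1) by linarith
        then have "A \<le> \<bar>t - a\<bar> \<or> A \<le> \<bar>t - c\<bar>" using \<alpha> by linarith
        then have two: "A * \<delta> \<le> \<bar>t - a\<bar> * \<bar>t - c\<bar>"
        proof
          assume "A \<le> \<bar>t - a\<bar>"
          then show ?thesis using far pos by (intro mult_mono) auto
        next
          assume "A \<le> \<bar>t - c\<bar>"
          then have "\<delta> * A \<le> \<bar>t - a\<bar> * \<bar>t - c\<bar>" using far pos by (intro mult_mono) auto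
          then show ?thesis by (simp add: mult.commute)
        qed
        have "A * \<delta> * \<delta> \<le> \<bar>t - a\<bar> * \<bar>t - c\<bar> * \<bar>t - b\<bar>"
          by (rule mult_mono[OF two far(2)]) (use pos in auto)
        moreover have "A * \<delta> * \<delta> = 6 * M" using pos by (simp add: A_def power2_eq_square)
        ultimately have "2 * M \<le> \<bar>t - a\<bar> * \<bar>t - c\<bar> * \<bar>t - b\<bar> / 3" by simp
        also have "\<dots> = \<bar>\<xi> + \<alpha>\<^sup>2 * t - t ^ 3 / 3\<bar>" unfolding abc(2) by (simp add: abs_mult mult_ac)
        finally have "(2 * M)\<^sup>2 \<le> \<bar>\<xi> + \<alpha>\<^sup>2 * t - t ^ 3 / 3\<bar>\<^sup>2" using M by (intro power_mono) auto
        then have "4 * (M * M) \<le> pot \<alpha> \<xi> t" by (simp add: pot_def power2_eq_square)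
        moreover have "1 * M \<le> M * M" using M by (intro mult_right_mono) auto
        moreover have "f' t \<ge> - (3 * K / 8)" using lower unfolding f'_def by linarith
        ultimately show ?thesis using f2 M unfolding K_def by linarith
      qed
    qed
  qed
  then show ?thesis using pos(4) by blast
qed

text \<open>
  Moving the parameters changes \<open>p\<close> by at most \<open>\<eta> (1 + |t|)\<close>, where \<open>\<eta> = |\<xi> - \<xi>0| + |\<alpha>\<^sup>2 - \<alpha>0\<^sup>2|\<close>, and the cubic growth of \<open>p\<close>
  controls \<open>1 + |t|\<close> by a multiple of \<open>1 + |p|\<close>.
\<close>

lemma pot_perturbation:
  "\<exists>C\<ge>0. \<forall>\<alpha> \<xi> t. \<bar>\<xi> - \<xi>0\<bar> + \<bar>\<alpha>\<^sup>2 - \<alpha>0\<^sup>2\<bar> \<le> 1 \<longrightarrow>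
     \<bar>pot \<alpha> \<xi> t - pot \<alpha>0 \<xi>0 t\<bar> \<le> C * (\<bar>\<xi> - \<xi>0\<bar> + \<bar>\<alpha>\<^sup>2 - \<alpha>0\<^sup>2\<bar>) * (1 + pot \<alpha>0 \<xi>0 t)"
proof -
  define s where "s = 1 + \<bar>\<xi>0\<bar> + \<alpha>0\<^sup>2"
  define L where "L = 3 * s"
  have s: "s \<ge> 1" by (simp add: s_def)
  define p where "p t = \<xi>0 + \<alpha>0\<^sup>2 * t - t ^ 3 / 3" for t
  have tp: "\<bar>t\<bar> \<le> L + \<bar>p t\<bar>" for t
  proof (cases "\<bar>t\<bar> \<le> L")
    case False
    then have t: "\<bar>t\<bar> \<ge> L" "\<bar>t\<bar> \<ge> 1" using s by (auto simp: L_def)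
    have "\<bar>t\<bar> * 1 * L \<le> \<bar>t\<bar> * \<bar>t\<bar> * \<bar>t\<bar>" using t s by (intro mult_mono) (auto simp: L_def)
    then have 1: "\<bar>t\<bar> * s \<le> \<bar>t ^ 3 / 3\<bar>" by (simp add: L_def power3_eq_cube abs_mult)
    have "\<bar>t ^ 3 / 3\<bar> \<le> \<bar>\<xi>0\<bar> + \<bar>\<alpha>0\<^sup>2 * t\<bar> + \<bar>p t\<bar>" unfolding p_def by linarith
    also have "\<bar>\<alpha>0\<^sup>2 * t\<bar> = \<alpha>0\<^sup>2 * \<bar>t\<bar>" by (simp add: abs_mult)
    finally have 2: "\<bar>t ^ 3 / 3\<bar> \<le> \<bar>\<xi>0\<bar> + \<alpha>0\<^sup>2 * \<bar>t\<bar> + \<bar>p t\<bar>" .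
    have "\<bar>\<xi>0\<bar> * 1 \<le> \<bar>\<xi>0\<bar> * \<bar>t\<bar>" using t by (intro mult_left_mono) auto
    moreover have "\<bar>t\<bar> * s = \<bar>t\<bar> + \<bar>\<xi>0\<bar> * \<bar>t\<bar> + \<alpha>0\<^sup>2 * \<bar>t\<bar>" by (simp add: s_def algebra_simps)
    ultimately have "\<bar>t\<bar> \<le> \<bar>p t\<bar>" using 1 2 by linarith
    then show ?thesis using s by (simp add: L_def)
  qed simp
  define C where "C = 4 * (1 + L)\<^sup>2 + 1"
  show ?thesis
  proof (intro exI[of _ C] conjI allI impI)
    show "0 \<le> C" by (simp add: C_def)
    fix \<alpha> \<xi> t
    define \<eta> where "\<eta> = \<bar>\<xi> - \<xi>0\<bar> + \<bar>\<alpha>\<^sup>2 - \<alpha>0\<^sup>2\<bar>"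
    assume "\<bar>\<xi> - \<xi>0\<bar> + \<bar>\<alpha>\<^sup>2 - \<alpha>0\<^sup>2\<bar> \<le> 1"
    then have \<eta>: "0 \<le> \<eta>" "\<eta> \<le> 1" by (auto simp: \<eta>_def)
    define d where "d = (\<xi> - \<xi>0) + (\<alpha>\<^sup>2 - \<alpha>0\<^sup>2) * t"
    define r where "r = 1 + \<bar>t\<bar>"
    have r: "r \<ge> 0" by (simp add: r_def)
    have d: "\<bar>d\<bar> \<le> \<eta> * r"
    proof -
      have "\<bar>d\<bar> \<le> \<bar>\<xi> - \<xi>0\<bar> * 1 + \<bar>\<alpha>\<^sup>2 - \<alpha>0\<^sup>2\<bar> * \<bar>t\<bar>"
        unfolding d_def using abs_triangle_ineq[of "\<xi> - \<xi>0" "(\<alpha>\<^sup>2 - \<alpha>0\<^sup>2) * t"] by (simp add: abs_mult)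
      also have "\<dots> \<le> \<bar>\<xi> - \<xi>0\<bar> * r + \<bar>\<alpha>\<^sup>2 - \<alpha>0\<^sup>2\<bar> * r"
        by (intro add_mono mult_left_mono) (auto simp: r_def)
      finally show ?thesis by (simp add: \<eta>_def distrib_right)
    qed
    have "\<eta> * r \<le> 1 * r" using \<eta> r by (intro mult_right_mono) auto
    then have d1: "\<bar>d\<bar> \<le> r" using d by simp
    have "r \<le> (1 + L) * (1 + \<bar>p t\<bar>)"
    proof -
      have "0 \<le> L * \<bar>p t\<bar>" using s by (simp add: L_def)
      then show ?thesis using tp[of t] by (simp add: r_def algebra_simps)
    qed
    then have "r\<^sup>2 \<le> ((1 + L) * (1 + \<bar>p t\<bar>))\<^sup>2" using r by (intro power_mono)
    also have "\<dots> = (1 + L)\<^sup>2 * (1 + \<bar>p t\<bar>)\<^sup>2" by (rule power_mult_distrib)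
    also have "\<dots> \<le> (1 + L)\<^sup>2 * (2 * (1 + (p t)\<^sup>2))"
    proof (rule mult_left_mono)
      have "0 \<le> (1 - \<bar>p t\<bar>)\<^sup>2" by simp
      then show "(1 + \<bar>p t\<bar>)\<^sup>2 \<le> 2 * (1 + (p t)\<^sup>2)" by (simp add: power2_sum power2_diff)
    qed simp
    finally have r2: "r\<^sup>2 \<le> 2 * (1 + L)\<^sup>2 * (1 + (p t)\<^sup>2)" by (simp add: algebra_simps)
    have p2: "pot \<alpha>0 \<xi>0 t = (p t)\<^sup>2" by (simp add: pot_def p_def)
    have "\<xi> + \<alpha>\<^sup>2 * t - t ^ 3 / 3 = p t + d" by (simp add: p_def d_def algebra_simps)
    then have "pot \<alpha> \<xi> t - pot \<alpha>0 \<xi>0 t = d * (2 * p t + d)"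
      unfolding p2 by (simp add: pot_def power2_eq_square algebra_simps)
    then have "\<bar>pot \<alpha> \<xi> t - pot \<alpha>0 \<xi>0 t\<bar> = \<bar>d\<bar> * \<bar>2 * p t + d\<bar>" by (simp add: abs_mult)
    also have "\<dots> \<le> (\<eta> * r) * (2 * \<bar>p t\<bar> + r)"
      using d d1 \<eta> r by (intro mult_mono) auto
    also have "\<dots> = \<eta> * (2 * (r * \<bar>p t\<bar>) + r\<^sup>2)" by (simp add: power2_eq_square algebra_simps)
    also have "\<dots> \<le> \<eta> * (C * (1 + (p t)\<^sup>2))"
    proof (rule mult_left_mono[OF _ \<eta>(1)])
      have "0 \<le> (r - \<bar>p t\<bar>)\<^sup>2" by simp
      then have "2 * (r * \<bar>p t\<bar>) \<le> r\<^sup>2 + (p t)\<^sup>2" by (simp add: power2_diff)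
      moreover have "C * (1 + (p t)\<^sup>2) = 2 * (2 * (1 + L)\<^sup>2 * (1 + (p t)\<^sup>2)) + (1 + (p t)\<^sup>2)"
        by (simp add: C_def algebra_simps)
      ultimately show "2 * (r * \<bar>p t\<bar>) + r\<^sup>2 \<le> C * (1 + (p t)\<^sup>2)" using r2 by linarith
    qed
    finally show "\<bar>pot \<alpha> \<xi> t - pot \<alpha>0 \<xi>0 t\<bar> \<le> C * (\<bar>\<xi> - \<xi>0\<bar> + \<bar>\<alpha>\<^sup>2 - \<alpha>0\<^sup>2\<bar>) * (1 + pot \<alpha>0 \<xi>0 t)"
      by (simp add: \<eta>_def p2 mult_ac)
  qed
qed

lemma continuous_ground_pot: "continuous_on UNIV (\<lambda>(\<alpha>, \<xi>). ground_energy (pot \<alpha> \<xi>))"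
proof (rule continuous_at_imp_continuous_on, intro ballI)
  fix x :: "real \<times> real"
  obtain \<alpha>0 \<xi>0 where x: "x = (\<alpha>0, \<xi>0)" by (cases x)
  define m where "m y = ground_energy (pot (fst y) (snd y))" for y
  define \<eta> where "\<eta> y = \<bar>snd y - \<xi>0\<bar> + \<bar>(fst y)\<^sup>2 - \<alpha>0\<^sup>2\<bar>" for y :: "real \<times> real"
  obtain C where C: "C \<ge> 0" "\<And>\<alpha> \<xi> t. \<bar>\<xi> - \<xi>0\<bar> + \<bar>\<alpha>\<^sup>2 - \<alpha>0\<^sup>2\<bar> \<le> 1 \<Longrightarrow>
     \<bar>pot \<alpha> \<xi> t - pot \<alpha>0 \<xi>0 t\<bar> \<le> C * (\<bar>\<xi> - \<xi>0\<bar> + \<bar>\<alpha>\<^sup>2 - \<alpha>0\<^sup>2\<bar>) * (1 + pot \<alpha>0 \<xi>0 t)"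
    using pot_perturbation by blast
  have "(\<eta> \<longlongrightarrow> \<bar>snd x - \<xi>0\<bar> + \<bar>(fst x)\<^sup>2 - \<alpha>0\<^sup>2\<bar>) (at x)"
    unfolding \<eta>_def by (intro tendsto_intros)
  then have \<eta>0: "(\<eta> \<longlongrightarrow> 0) (at x)" by (simp add: x)
  have "((\<lambda>y. C * \<eta> y) \<longlongrightarrow> C * 0) (at x)" by (intro tendsto_intros \<eta>0)
  then have C\<eta>: "((\<lambda>y. C * \<eta> y) \<longlongrightarrow> 0) (at x)" by simp
  have bound: "\<forall>\<^sub>F y in at x. \<bar>m y - m x\<bar> \<le> C * \<eta> y * (1 + m x)"
    using order_tendstoD(2)[OF \<eta>0 zero_less_one] order_tendstoD(2)[OF C\<eta> zero_less_one]
  proof eventually_elim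
    case (elim y)
    show ?case unfolding m_def x fst_conv snd_conv
    proof (rule ground_perturbation[OF smooth_pot pot_nonneg smooth_pot pot_nonneg])
      show "0 \<le> C * \<eta> y" using C(1) by (simp add: \<eta>_def)
      show "C * \<eta> y \<le> 1" using elim by simp
      show "\<bar>pot (fst y) (snd y) t - pot \<alpha>0 \<xi>0 t\<bar> \<le> C * \<eta> y * (1 + pot \<alpha>0 \<xi>0 t)" for t
        using C(2)[where \<xi> = "snd y" and \<alpha> = "fst y" and t = t] elim unfolding \<eta>_def by linarith
    qed
  qed
  have "(m \<longlongrightarrow> m x) (at x)"
  proof (rule LIM_zero_cancel, rule tendsto_rabs_zero_cancel, rule real_tendsto_sandwich[OF _ bound tendsto_const])
    have "((\<lambda>y. C * \<eta> y * (1 + m x)) \<longlongrightarrow> 0 * (1 + m x)) (at x)" by (intro tendsto_intros C\<eta>)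
    then show "((\<lambda>y. C * \<eta> y * (1 + m x)) \<longlongrightarrow> 0) (at x)" by simp
  qed simp
  then show "isCont (\<lambda>(\<alpha>, \<xi>). ground_energy (pot \<alpha> \<xi>)) x"
    unfolding isCont_def m_def by (simp add: case_prod_beta')
qed

section \<open>Existence and location of the minimum\<close>

theorem theorem1p9:
  shows "(\<exists>\<alpha> \<xi>. rho1 \<alpha> \<xi> = S0) \<and>
         (\<forall>\<alpha> \<xi>. S0 \<le> rho1 \<alpha> \<xi>) \<and>
         (\<exists>\<alpha> \<xi>. \<bar>\<xi>\<bar> \<le> 2 / 3 * \<bar>\<alpha>\<bar> ^ 3 \<and> rho1 \<alpha> \<xi> = S0)"
proof -
  obtain A where A: "A > 0" "\<And>\<alpha> \<xi>. \<bar>\<alpha>\<bar> \<ge> A \<Longrightarrow> \<bar>\<xi>\<bar> \<le> 2 / 3 * \<bar>\<alpha>\<bar> ^ 3 \<Longrightarrow> max 1 (rho1 0 0) \<le> rho1 \<alpha> \<xi>"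
    using ground_pot_coercive[of "max 1 (rho1 0 0)"] by (auto simp: rho1_eq_ground)
  define K where "K = {x :: real \<times> real. \<bar>snd x\<bar> \<le> 2 / 3 * \<bar>fst x\<bar> ^ 3} \<inter> {x. \<bar>fst x\<bar> \<le> A}"
  have "closed K" unfolding K_def by (intro closed_Int closed_Collect_le continuous_intros)
  moreover have "K \<subseteq> {-A..A} \<times> {- (2 / 3 * A ^ 3)..2 / 3 * A ^ 3}"
  proof
    fix x assume x: "x \<in> K"
    have "\<bar>fst x\<bar> \<le> A" using x by (simp add: K_def)
    moreover from this have "\<bar>fst x\<bar> ^ 3 \<le> A ^ 3" by (intro power_mono) auto
    then have "\<bar>snd x\<bar> \<le> 2 / 3 * A ^ 3" using x by (simp add: K_def)
    ultimately show "x \<in> {-A..A} \<times> {- (2 / 3 * A ^ 3)..2 / 3 * A ^ 3}"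
      unfolding mem_Times_iff atLeastAtMost_iff abs_le_iff by linarith
  qed
  then have "bounded K" by (rule bounded_subset[rotated]) (intro bounded_Times bounded_closed_interval)
  ultimately have "compact K" by (simp add: compact_eq_bounded_closed)
  moreover have K0: "(0, 0) \<in> K" using A(1) by (simp add: K_def)
  moreover have "continuous_on K (\<lambda>(\<alpha>, \<xi>). rho1 \<alpha> \<xi>)"
    unfolding rho1_eq_ground by (rule continuous_on_subset[OF continuous_ground_pot]) simp
  ultimately obtain x where x: "x \<in> K" "\<And>y. y \<in> K \<Longrightarrow> (\<lambda>(\<alpha>, \<xi>). rho1 \<alpha> \<xi>) x \<le> (\<lambda>(\<alpha>, \<xi>). rho1 \<alpha> \<xi>) y"
    using continuous_attains_inf[of K "\<lambda>(\<alpha>, \<xi>). rho1 \<alpha> \<xi>"] by blast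
  obtain a b where ab: "x = (a, b)" by (cases x)
  have min: "rho1 a b \<le> rho1 \<alpha> \<xi>" for \<alpha> \<xi>
  proof -
    obtain \<alpha>' \<xi>' where red: "\<bar>\<xi>'\<bar> \<le> 2 / 3 * \<bar>\<alpha>'\<bar> ^ 3" "\<And>t. pot \<alpha>' \<xi>' t \<le> pot \<alpha> \<xi> t"
      using pot_reduction by blast
    have "rho1 a b \<le> rho1 \<alpha>' \<xi>'"
    proof (cases "\<bar>\<alpha>'\<bar> \<le> A")
      case True
      then show ?thesis using x(2)[of "(\<alpha>', \<xi>')"] red(1) by (simp add: ab K_def)
    next
      case False
      then show ?thesis using A(2)[of \<alpha>' \<xi>'] red(1) x(2)[OF K0] by (simp add: ab)
    qed
    also have "\<dots> \<le> rho1 \<alpha> \<xi>"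
      unfolding rho1_eq_ground by (rule ground_mono[OF smooth_pot pot_nonneg smooth_pot red(2)])
    finally show ?thesis .
  qed
  have "S0 = rho1 a b"
    unfolding S0_def by (rule cInf_eq_minimum) (use min in auto)
  moreover have "\<bar>b\<bar> \<le> 2 / 3 * \<bar>a\<bar> ^ 3" using x(1) by (simp add: ab K_def)
  ultimately show ?thesis using min by metis
qed

end
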